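(* Let $(W,d)$ be a closed Hilbert complex with domain complex $(V,d)$, $I=[0,T]$, $\mathfrak Y=V^{k-1}\times V^k$ and $H=W^{k-1}\times W^k$. Suppose $g\in V_k^*$ (the domain of the adjoint $d^*$ in degree $k$) and $f\in L^2(I,(V^k)')$. Then the problem $$\langle\sigma_t,\omega\rangle+\langle d\sigma,d\omega\rangle=\langle f,d\omega\rangle\quad\forall\omega\in V^{k-1},\ t\in I,$$ $$\langle u_t,\varphi\rangle+\langle d\sigma,\varphi\rangle+\langle du,d\varphi\rangle=\langle f,\varphi\rangle\quad\forall\varphi\in V^k,\ t\in I,$$ $$u(0)=g$$ is well-posed: there exists a unique solution $(\sigma,u)\in L^2(I,\mathfrak Y)\cap H^1(I,\mathfrak Y')\cap C(I,H)$ with $(\sigma(0),u(0))=(d^*g,g)$.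
   Context: A Hilbert complex $(W,d)$ is a sequence of Hilbert spaces $W^k$ (here separable) with closed densely defined linear maps $d^k:V^k\subseteq W^k\to V^{k+1}\subseteq W^{k+1}$, $d\circ d=0$; it is closed if each range $d^{k-1}V^{k-1}$ is closed in $W^k$. The domains $V^k$ carry the graph inner product $\langle v,w\rangle_V=\langle v,w\rangle+\langle dv,dw\rangle$. $d^*$ is the Hilbert space adjoint of $d$; $V_k^*\subseteq W^k$ is the domain of the adjoint of $d^{k-1}$, so $d^*:V_k^*\to W^{k-1}$. Primes denote dual spaces. $\mathfrak Y\subseteq H\subseteq\mathfrak Y'$ is a Gelfand triple (dense continuous embeddings, $H$ identified with its dual), and $\langle F,v\rangle$ denotes both the $W$-inner product and its extension to the duality pairing. $L^2(I,X)$, $H^1(I,X)$ are the Bochner spaces with norms $(\int_I\|u\|_X^2dt)^{1/2}$ and $(\int_I(\|u\|_X^2+\|u_t\|_X^2)dt)^{1/2}$; $C(I,X)$ is the space of bounded continuous functions $I\to X$. Subscript $t$ is the time derivative; since solutions are Bochner functions, the equations hold for almost every $t\in I$. *)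

theory Defs
  imports "HOL-Analysis.Analysis"
begin

section \<open>Hilbert complexes\<close>

text \<open>
  The degrees cannot index a family of types, so the spaces $W^k$ are closed subspaces of one
  ambient real Hilbert space. This loses no generality: a sequence of Hilbert spaces embeds
  isometrically into its Hilbert direct sum. No relation (such as orthogonality) between the
  subspaces of different degree is assumed. A complex that is indexed by a subset of the integers
  is padded with zero spaces. The values of \<open>d k\<close> outside \<open>V k\<close> are irrelevant.
\<close>

locale hilbert_complex =
  fixes W V :: "int \<Rightarrow> 'a::{real_inner, complete_space} set"
    and d :: "int \<Rightarrow> 'a \<Rightarrow> 'a"
  assumes subspace_W: "subspace (W k)"
    and closed_W: "closed (W k)"
    and separable_W: "separable_space (top_of_set (W k))"
    and subspace_V: "subspace (V k)"
    and dense_V: "closure (V k) = W k"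
    and d_add: "v \<in> V k \<Longrightarrow> w \<in> V k \<Longrightarrow> d k (v + w) = d k v + d k w"
    and d_scaleR: "v \<in> V k \<Longrightarrow> d k (c *\<^sub>R v) = c *\<^sub>R d k v"
    and d_closed: "closed {(v, d k v) |v. v \<in> V k}"
    and d_maps: "v \<in> V k \<Longrightarrow> d k v \<in> V (k + 1)"
    and d_d: "v \<in> V k \<Longrightarrow> d (k + 1) (d k v) = 0"

locale closed_hilbert_complex = hilbert_complex +
  assumes closed_range: "closed (d k ` V k)"

definition graph_inner :: "(int \<Rightarrow> 'a::real_inner \<Rightarrow> 'a) \<Rightarrow> int \<Rightarrow> 'a \<Rightarrow> 'a \<Rightarrow> real"
  where "graph_inner d k v w = v \<bullet> w + d k v \<bullet> d k w"

definition graph_norm :: "(int \<Rightarrow> 'a::real_inner \<Rightarrow> 'a) \<Rightarrow> int \<Rightarrow> 'a \<Rightarrow> real"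
  where "graph_norm d k v = sqrt (graph_inner d k v v)"

text \<open>
  \<open>adj_dom W V d k\<close> is $V_k^*$, the domain of the adjoint of $d^{k-1}$, and
  \<open>adj W V d k\<close> is $d^* : V_k^* \to W^{k-1}$. The element \<open>z\<close> is unique because
  \<open>V (k - 1)\<close> is dense in \<open>W (k - 1)\<close>.
\<close>

definition adj_dom ::
    "(int \<Rightarrow> 'a::real_inner set) \<Rightarrow> (int \<Rightarrow> 'a set) \<Rightarrow> (int \<Rightarrow> 'a \<Rightarrow> 'a) \<Rightarrow> int \<Rightarrow> 'a set"
  where "adj_dom W V d k =
    {w \<in> W k. \<exists>z \<in> W (k - 1). \<forall>v \<in> V (k - 1). d (k - 1) v \<bullet> w = v \<bullet> z}"

definition adj ::
    "(int \<Rightarrow> 'a::real_inner set) \<Rightarrow> (int \<Rightarrow> 'a set) \<Rightarrow> (int \<Rightarrow> 'a \<Rightarrow> 'a) \<Rightarrow> int \<Rightarrow> 'a \<Rightarrow> 'a"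
  where "adj W V d k w =
    (THE z. z \<in> W (k - 1) \<and> (\<forall>v \<in> V (k - 1). d (k - 1) v \<bullet> w = v \<bullet> z))"


section \<open>Dual spaces and Bochner spaces\<close>

text \<open>
  A normed space is given below by a carrier \<open>X\<close> and a norm \<open>N\<close> on it, because the
  norms involved (graph norms, dual norms) are not the norm of the surrounding type. Functionals
  on \<open>X\<close> are total functions; to make equality of functionals equality of functions they are
  extended by zero outside \<open>X\<close>.
\<close>

definition dual :: "'b::real_vector set \<Rightarrow> ('b \<Rightarrow> real) \<Rightarrow> ('b \<Rightarrow> real) set"
  where "dual X N = {F.
      (\<forall>v \<in> X. \<forall>w \<in> X. F (v + w) = F v + F w) \<and>
      (\<forall>c. \<forall>v \<in> X. F (c *\<^sub>R v) = c * F v) \<and>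
      (\<exists>C. \<forall>v \<in> X. \<bar>F v\<bar> \<le> C * N v) \<and>
      (\<forall>v. v \<notin> X \<longrightarrow> F v = 0)}"

definition dual_norm :: "'b set \<Rightarrow> ('b \<Rightarrow> real) \<Rightarrow> ('b \<Rightarrow> real) \<Rightarrow> real"
  where "dual_norm X N F = (SUP v \<in> {v \<in> X. N v \<le> 1}. \<bar>F v\<bar>)"

text \<open>The embedding $H \to \mathfrak Y'$ of a Gelfand triple, with \<open>X\<close> in the role of $\mathfrak Y$.\<close>

definition gelfand_embed :: "'b::real_inner set \<Rightarrow> 'b \<Rightarrow> 'b \<Rightarrow> real"
  where "gelfand_embed X h = (\<lambda>v. if v \<in> X then h \<bullet> v else 0)"

definition strongly_measurable_on ::
    "real set \<Rightarrow> 'b::minus set \<Rightarrow> ('b \<Rightarrow> real) \<Rightarrow> (real \<Rightarrow> 'b) \<Rightarrow> bool"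
  where "strongly_measurable_on I X N u \<longleftrightarrow>
    (\<exists>s :: nat \<Rightarrow> real \<Rightarrow> 'b.
      (\<forall>n. simple_function (lebesgue_on I) (s n) \<and> s n ` I \<subseteq> X) \<and>
      (AE t in lebesgue_on I. u t \<in> X \<and> (\<lambda>n. N (s n t - u t)) \<longlonglongrightarrow> 0))"

text \<open>Members of $L^2(I,X)$ are represented by functions; values on a null set do not matter.\<close>

definition bochner_L2 ::
    "real set \<Rightarrow> 'b::minus set \<Rightarrow> ('b \<Rightarrow> real) \<Rightarrow> (real \<Rightarrow> 'b) set"
  where "bochner_L2 I X N =
    {u. strongly_measurable_on I X N u \<and> integrable (lebesgue_on I) (\<lambda>t. (N (u t))\<^sup>2)}"

definition bounded_continuous_into ::
    "real set \<Rightarrow> 'b::metric_space set \<Rightarrow> (real \<Rightarrow> 'b) set"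
  where "bounded_continuous_into I H =
    {u. continuous_on I u \<and> u ` I \<subseteq> H \<and> bounded (u ` I)}"

definition test_function :: "real set \<Rightarrow> (real \<Rightarrow> real) \<Rightarrow> bool"
  where "test_function I \<phi> \<longleftrightarrow>
    (\<forall>n. ((deriv ^^ n) \<phi>) differentiable_on UNIV) \<and>
    (\<exists>K. compact K \<and> K \<subseteq> interior I \<and> (\<forall>t. t \<notin> K \<longrightarrow> \<phi> t = 0))"

text \<open>
  Weak derivative of functions with values in the dual of \<open>X\<close>. The identity
  $\int \phi' u = - \int \phi u'$ between dual-valued Bochner integrals is written by its values at
  all \<open>v \<in> X\<close>; evaluation at \<open>v\<close> is a bounded functional and commutes with the
  Bochner integral.
\<close>

definition weak_derivative_dual ::
    "real set \<Rightarrow> 'b set \<Rightarrow> (real \<Rightarrow> 'b \<Rightarrow> real) \<Rightarrow> (real \<Rightarrow> 'b \<Rightarrow> real) \<Rightarrow> bool"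
  where "weak_derivative_dual I X u u' \<longleftrightarrow>
    (\<forall>\<phi>. test_function I \<phi> \<longrightarrow>
      (\<forall>v \<in> X. (\<integral>t. deriv \<phi> t * u t v \<partial>lebesgue_on I) = - (\<integral>t. \<phi> t * u' t v \<partial>lebesgue_on I)))"

definition bochner_H1_dual ::
    "real set \<Rightarrow> 'b::real_vector set \<Rightarrow> ('b \<Rightarrow> real) \<Rightarrow> (real \<Rightarrow> 'b \<Rightarrow> real) set"
  where "bochner_H1_dual I X N =
    {u \<in> bochner_L2 I (dual X N) (dual_norm X N).
      \<exists>u' \<in> bochner_L2 I (dual X N) (dual_norm X N). weak_derivative_dual I X u u'}"


section \<open>The mixed evolution problem\<close>

definition Y_space :: "(int \<Rightarrow> 'a set) \<Rightarrow> int \<Rightarrow> ('a \<times> 'a) set"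
  where "Y_space V k = V (k - 1) \<times> V k"

definition Y_norm :: "(int \<Rightarrow> 'a::real_inner \<Rightarrow> 'a) \<Rightarrow> int \<Rightarrow> 'a \<times> 'a \<Rightarrow> real"
  where "Y_norm d k y = sqrt ((graph_norm d (k - 1) (fst y))\<^sup>2 + (graph_norm d k (snd y))\<^sup>2)"

definition H_space :: "(int \<Rightarrow> 'a set) \<Rightarrow> int \<Rightarrow> ('a \<times> 'a) set"
  where "H_space W k = W (k - 1) \<times> W k"

text \<open>
  Membership of \<open>(\<sigma>, u)\<close> in
  $L^2(I,\mathfrak Y) \cap H^1(I,\mathfrak Y') \cap C(I,H)$. The functions \<open>\<sigma>\<close>, \<open>u\<close> are
  the continuous representatives, which are defined at every \<open>t \<in> I\<close> and lie in the
  domains \<open>V (k - 1)\<close>, \<open>V k\<close> for almost every \<open>t\<close>.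
\<close>

definition solution_space ::
    "(int \<Rightarrow> 'a::real_inner set) \<Rightarrow> (int \<Rightarrow> 'a set) \<Rightarrow> (int \<Rightarrow> 'a \<Rightarrow> 'a) \<Rightarrow> int \<Rightarrow> real set
      \<Rightarrow> (real \<Rightarrow> 'a \<times> 'a) set"
  where "solution_space W V d k I =
    {U. U \<in> bochner_L2 I (Y_space V k) (Y_norm d k) \<and>
        (\<lambda>t. gelfand_embed (Y_space V k) (U t)) \<in> bochner_H1_dual I (Y_space V k) (Y_norm d k) \<and>
        U \<in> bounded_continuous_into I (H_space W k)}"

text \<open>
  \<open>U'\<close> is the time derivative of \<open>(\<sigma>, u)\<close> in $L^2(I,\mathfrak Y')$, so that
  \<open>U' t (\<omega>, 0)\<close> is $\langle\sigma_t,\omega\rangle$ and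
  \<open>U' t (0, \<phi>)\<close> is $\langle u_t,\varphi\rangle$.
\<close>

definition solves_mixed_problem ::
    "(int \<Rightarrow> 'a::real_inner set) \<Rightarrow> (int \<Rightarrow> 'a set) \<Rightarrow> (int \<Rightarrow> 'a \<Rightarrow> 'a) \<Rightarrow> int \<Rightarrow> real set
      \<Rightarrow> (real \<Rightarrow> 'a \<Rightarrow> real) \<Rightarrow> 'a \<Rightarrow> (real \<Rightarrow> 'a) \<Rightarrow> (real \<Rightarrow> 'a) \<Rightarrow> bool"
  where "solves_mixed_problem W V d k I f g \<sigma> u \<longleftrightarrow>
    (\<lambda>t. (\<sigma> t, u t)) \<in> solution_space W V d k I \<and>
    (\<exists>U' \<in> bochner_L2 I (dual (Y_space V k) (Y_norm d k)) (dual_norm (Y_space V k) (Y_norm d k)).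
      weak_derivative_dual I (Y_space V k) (\<lambda>t. gelfand_embed (Y_space V k) (\<sigma> t, u t)) U' \<and>
      (AE t in lebesgue_on I.
        (\<forall>\<omega> \<in> V (k - 1).
          U' t (\<omega>, 0) + d (k - 1) (\<sigma> t) \<bullet> d (k - 1) \<omega> = f t (d (k - 1) \<omega>)) \<and>
        (\<forall>\<phi> \<in> V k.
          U' t (0, \<phi>) + d (k - 1) (\<sigma> t) \<bullet> \<phi> + d k (u t) \<bullet> d k \<phi> = f t \<phi>))) \<and>
    u 0 = g"

end

theory Submission
  imports Defs
begin

text \<open>
  The graph embedding \<open>(\<sigma>, u) \<mapsto> ((\<sigma>, u), (d \<sigma>, d u))\<close> identifies \<open>Y\<close> with a closed separable subspace
  \<open>G\<close> of a Hilbert space, and Riesz representation turns the problem into \<open>R U' + A U = h\<close> in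
  $L^2(I, G)$, where \<open>R\<close> represents the inner product of \<open>H\<close> and \<open>A\<close> the non-symmetric form of the
  problem, which satisfies a Garding inequality. The energy estimate bounds a $C^1$ function \<open>U\<close> in
  $C(I, H)$ and $L^2(I, G)$ by \<open>U 0\<close> and \<open>R U' + A U\<close>. Existence therefore follows once the
  functions \<open>R U' + A U\<close> with \<open>U\<close> of class $C^1$ and \<open>U 0 = 0\<close> are dense in $L^2(I, G)$.
  For an \<open>h\<close> orthogonal to all of them, the iterated integral \<open>p\<close> of \<open>h\<close> solves
  \<open>\<langle>p, R v\<rangle>' = \<langle>p, A v\<rangle>\<close> for all \<open>v\<close> with end value zero, and this forces \<open>p = 0\<close> by Gronwall's
  argument for \<open>\<langle>p, R p\<rangle>\<close>. Uniqueness follows in the same way from the integral of the difference of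
  two solutions.
\<close>

section \<open>Projection and Riesz representation in Hilbert spaces\<close>

text \<open>A weak solution has its time derivative only in the dual of Y, so testing the equation
  with the solution itself would require the energy identity for L^2(I,Y) \<inter> H^1(I,Y'). The
  argument avoids that identity: the energy estimate is applied only to C^1 functions with values in
  \<open>G\<close>, and both vanishing arguments concern time integrals, which are continuous with
  values in \<open>G\<close>. Two features of the problem shape the operators. The cross term of
  \<open>d \<sigma>\<close> with \<open>u\<close> has no sign, so the form is not coercive; half of
  it is absorbed by \<open>d \<sigma>\<close> and the rest by the norm of H, which is the Garding
  inequality. The load is evaluated at \<open>d \<omega>\<close>, and \<open>d \<circ> d = 0\<close>
  makes the graph norm of \<open>d \<omega>\<close> equal to its plain norm, so both right-hand
  sides together are one bounded functional on Y. Members of L^2 are functions and not classes.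
  Hence the forms below are only semidefinite, and limits are expressed by a distance tending to
  zero.\<close>

locale function_form =
  fixes X :: "('i \<Rightarrow> 'e::real_vector) set"
    and B :: "('i \<Rightarrow> 'e) \<Rightarrow> ('i \<Rightarrow> 'e) \<Rightarrow> real"
  assumes lin: "x \<in> X \<Longrightarrow> y \<in> X \<Longrightarrow> (\<lambda>i. x i + c *\<^sub>R y i) \<in> X"
    and form_lin: "x \<in> X \<Longrightarrow> y \<in> X \<Longrightarrow> z \<in> X \<Longrightarrow> B (\<lambda>i. x i + c *\<^sub>R y i) z = B x z + c * B y z"
    and form_sym: "x \<in> X \<Longrightarrow> y \<in> X \<Longrightarrow> B x y = B y x"
    and form_nonneg: "x \<in> X \<Longrightarrow> 0 \<le> B x x"
begin

abbreviation "sqdist x y \<equiv> B (\<lambda>i. x i - y i) (\<lambda>i. x i - y i)"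

lemma diff_in: "x \<in> X \<Longrightarrow> y \<in> X \<Longrightarrow> (\<lambda>i. x i - y i) \<in> X"
  using lin[of x y "-1"] by simp

lemma form_diff:
  "x \<in> X \<Longrightarrow> y \<in> X \<Longrightarrow> z \<in> X \<Longrightarrow> B (\<lambda>i. x i - y i) z = B x z - B y z"
  using form_lin[of x y z "-1"] by simp

lemma form_expand:
  assumes "x \<in> X" "y \<in> X"
  shows "B (\<lambda>i. x i + c *\<^sub>R y i) (\<lambda>i. x i + c *\<^sub>R y i) = B x x + 2 * c * B x y + c\<^sup>2 * B y y"
proof -
  let ?z = "\<lambda>i. x i + c *\<^sub>R y i"
  have z: "?z \<in> X" using assms by (rule lin)
  have "B ?z ?z = B x ?z + c * B y ?z" by (rule form_lin[OF assms z])
  also have "B x ?z = B x x + c * B x y"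
    using form_sym[OF assms(1) z] form_lin[OF assms assms(1)] form_sym[OF assms(2,1)] by simp
  also have "B y ?z = B x y + c * B y y"
    using form_sym[OF assms(2) z] form_lin[OF assms assms(2)] by simp
  finally show ?thesis by (simp add: algebra_simps power2_eq_square)
qed

lemma form_diff_expand:
  assumes "x \<in> X" "y \<in> X"
  shows "sqdist x y = B x x - 2 * B x y + B y y"
  using form_expand[OF assms, of "-1"] by simp

lemma cauchy_schwarz:
  assumes "x \<in> X" "y \<in> X"
  shows "(B x y)\<^sup>2 \<le> B x x * B y y"
proof -
  have *: "0 \<le> B x x + 2 * c * B x y + c\<^sup>2 * B y y" for c
    using form_nonneg[OF lin[OF assms, of c]] form_expand[OF assms, of c] by simp
  show ?thesis
  proof (cases "B y y = 0")
    case True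
    have "B x y = 0"
    proof (rule ccontr)
      assume "B x y \<noteq> 0"
      \<comment> \<open>With \<open>B y y = 0\<close> the quadratic is affine in \<open>c\<close>,
        and this \<open>c\<close> gives it the value -1.\<close>
      then show False
        using *[of "- (B x x + 1) / (2 * B x y)"] True by (simp add: field_simps)
    qed
    then show ?thesis using True by simp
  next
    case False
    then have "B y y > 0" using form_nonneg[OF assms(2)] by simp
    then show ?thesis
      using *[of "- B x y / B y y"] by (simp add: field_simps power2_eq_square)
  qed
qed

lemma form_tendsto:
  assumes s: "\<And>n. s n \<in> X" and p: "p \<in> X" and y: "y \<in> X"
    and lim: "(\<lambda>n. sqdist (s n) p) \<longlonglongrightarrow> 0"
  shows "(\<lambda>n. B (s n) y) \<longlonglongrightarrow> B p y"
proof -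
  let ?e = "\<lambda>n. sqdist (s n) p"
  have "(\<lambda>n. sqrt (?e n * B y y)) \<longlonglongrightarrow> sqrt (0 * B y y)"
    by (intro tendsto_intros lim)
  then have "(\<lambda>n. sqrt (?e n * B y y)) \<longlonglongrightarrow> 0" by simp
  moreover have "\<bar>B (s n) y - B p y\<bar> \<le> sqrt (?e n * B y y)" for n
  proof (rule real_le_rsqrt)
    show "\<bar>B (s n) y - B p y\<bar>\<^sup>2 \<le> ?e n * B y y"
      using cauchy_schwarz[OF diff_in[OF s p] y, of n] form_diff[OF s p y, of n] by simp
  qed
  ultimately have "(\<lambda>n. B (s n) y - B p y) \<longlonglongrightarrow> 0"
    by (intro Lim_null_comparison[of "\<lambda>n. B (s n) y - B p y"]) auto
  then show ?thesis by (simp add: LIM_zero_iff)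
qed

text \<open>\<open>M\<close> need not be closed: Cauchy sequences of \<open>M\<close> are only asked
  to converge in \<open>X\<close>, so this is projection onto the closure of \<open>M\<close>. The
  returned sequence is the witness that \<open>p\<close> lies in that closure. It minimises the
  distance to \<open>h\<close>.\<close>

proposition projection:
  assumes MX: "M \<subseteq> X" and ne: "M \<noteq> {}"
    and Mlin: "\<And>x y c. x \<in> M \<Longrightarrow> y \<in> M \<Longrightarrow> (\<lambda>i. x i + c *\<^sub>R y i) \<in> M"
    and complete: "\<And>s. (\<And>n. s n \<in> M) \<Longrightarrow>
      (\<And>e. e > 0 \<Longrightarrow> \<exists>N. \<forall>m\<ge>N. \<forall>n\<ge>N. sqdist (s m) (s n) < e) \<Longrightarrow>
      \<exists>p\<in>X. (\<lambda>n. sqdist (s n) p) \<longlonglongrightarrow> 0"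
    and h: "h \<in> X"
  obtains p s where "p \<in> X" "\<And>n. s n \<in> M"
    "(\<lambda>n. sqdist (s n) p) \<longlonglongrightarrow> 0"
    "\<And>m. m \<in> M \<Longrightarrow> B (\<lambda>i. h i - p i) m = 0"
proof -
  let ?Q = "\<lambda>m. sqdist h m"
  define \<delta> where "\<delta> = (INF m\<in>M. ?Q m)"
  have bdd: "bdd_below (?Q ` M)"
    using form_nonneg[OF diff_in[OF h]] MX by (intro bdd_belowI[of _ 0]) auto
  have \<delta>_le: "\<delta> \<le> ?Q m" if "m \<in> M" for m
    unfolding \<delta>_def using bdd that by (rule cINF_lower)
  have "\<exists>m\<in>M. ?Q m < \<delta> + 1 / real (Suc n)" for n
    using cINF_less_iff[OF ne bdd, of "\<delta> + 1 / real (Suc n)"] by (simp add: \<delta>_def)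
  then obtain s where sM: "\<And>n. s n \<in> M" and s: "\<And>n. ?Q (s n) < \<delta> + 1 / real (Suc n)"
    by metis
  have sX: "s n \<in> X" for n using sM MX by blast
  \<comment> \<open>Parallelogram law: the midpoint \<open>?w\<close> of \<open>s m\<close> and
    \<open>s n\<close> lies in \<open>M\<close>, so \<open>\<delta> \<le> ?Q ?w\<close>, and
    \<open>?Q ?w\<close> is the mean of \<open>?Q (s m)\<close> and \<open>?Q (s n)\<close> minus a
    quarter of their squared distance.\<close>
  have close: "sqdist (s m) (s n) \<le> 2 / real (Suc m) + 2 / real (Suc n)"
    for m n
  proof -
    let ?x = "\<lambda>i. h i - s m i" and ?y = "\<lambda>i. h i - s n i"
    have x: "?x \<in> X" and y: "?y \<in> X" by (intro diff_in h sX)+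
    have a: "(\<lambda>i. s m i + 1 *\<^sub>R (s n i - s m i)) = s n" by simp
    have nm: "(\<lambda>i. s n i - s m i) \<in> M"
      using Mlin[OF sM[of n] sM[of m], of "-1"] by simp
    let ?w = "\<lambda>i. s m i + (1/2) *\<^sub>R (s n i - s m i)"
    have wM: "?w \<in> M" by (rule Mlin[OF sM nm])
    have h1: "(\<lambda>i. h i - ?w i) = (\<lambda>i. ?x i + (1/2) *\<^sub>R (?y i - ?x i))"
      by (rule ext) (simp add: algebra_simps)
    have 1: "?Q ?w = ?Q (s m) + B ?x (\<lambda>i. ?y i - ?x i) + 1/4 * B (\<lambda>i. ?y i - ?x i) (\<lambda>i. ?y i - ?x i)"
      unfolding h1 using form_expand[OF x diff_in[OF y x], of "1/2"] by (simp add: power2_eq_square)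
    have 2: "B ?x (\<lambda>i. ?y i - ?x i) = B ?x ?y - B ?x ?x"
      using form_sym[OF x diff_in[OF y x]] form_diff[OF y x x] form_sym[OF x y] by simp
    have 3: "B (\<lambda>i. ?y i - ?x i) (\<lambda>i. ?y i - ?x i) = B ?y ?y - 2 * B ?x ?y + B ?x ?x"
      using form_diff_expand[OF y x] form_sym[OF x y] by simp
    have eq: "(\<lambda>i. ?y i - ?x i) = (\<lambda>i. s m i - s n i)" by auto
    have "2 / real (Suc m) = 2 * (1 / real (Suc m))" "2 / real (Suc n) = 2 * (1 / real (Suc n))"
      by simp_all
    then show ?thesis
      using \<delta>_le[OF wM] s[of m] s[of n] 1[unfolded eq] 2[unfolded eq] 3[unfolded eq] by linarith
  qed
  have "\<exists>N. \<forall>m\<ge>N. \<forall>n\<ge>N. sqdist (s m) (s n) < e" if "e > 0" for e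
  proof -
    obtain N where N: "1 / real (Suc N) < e / 4"
      using nat_approx_posE[of "e/4"] \<open>e > 0\<close> by auto
    have "sqdist (s m) (s n) < e" if "m \<ge> N" "n \<ge> N" for m n
    proof -
      have "1 / real (Suc m) \<le> 1 / real (Suc N)" "1 / real (Suc n) \<le> 1 / real (Suc N)"
        using that by (simp_all add: frac_le)
      then show ?thesis using close[of m n] N by simp
    qed
    then show ?thesis by blast
  qed
  from complete[OF sM this] obtain p where p: "p \<in> X"
    and lim: "(\<lambda>n. sqdist (s n) p) \<longlonglongrightarrow> 0" by blast
  have "B (\<lambda>i. h i - p i) m = 0" if m: "m \<in> M" for m
  proof -
    have mX: "m \<in> X" using m MX by blast
    have l: "(\<lambda>n. B (\<lambda>i. h i - s n i) m) \<longlonglongrightarrow> B (\<lambda>i. h i - p i) m"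
      using tendsto_diff[OF tendsto_const form_tendsto[OF sX p mX lim], of "B h m"]
      by (simp add: form_diff[OF h sX mX] form_diff[OF h p mX])
    \<comment> \<open>First variation: \<open>s n + c m\<close> is no better than
      \<open>\<delta>\<close>, while \<open>s n\<close> exceeds \<open>\<delta>\<close> by less than
      \<open>1 / Suc n\<close>. The inequality survives the limit.\<close>
    have q: "2 * c * B (\<lambda>i. h i - p i) m \<le> c\<^sup>2 * B m m" for c
    proof -
      have "2 * c * B (\<lambda>i. h i - s n i) m - 1 / real (Suc n) \<le> c\<^sup>2 * B m m" for n
      proof -
        have "(\<lambda>i. h i - (s n i + c *\<^sub>R m i)) = (\<lambda>i. (h i - s n i) + (- c) *\<^sub>R m i)"
          by (rule ext) (simp add: algebra_simps)
        then show ?thesis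
          using \<delta>_le[OF Mlin[OF sM m, of n c]] form_expand[OF diff_in[OF h sX] mX, of n "- c"] s[of n]
          by simp
      qed
      moreover have "(\<lambda>n. 2 * c * B (\<lambda>i. h i - s n i) m - 1 / real (Suc n))
          \<longlonglongrightarrow> 2 * c * B (\<lambda>i. h i - p i) m - 0"
        by (intro tendsto_intros l LIMSEQ_Suc[OF lim_1_over_n])
      ultimately show ?thesis
        using LIMSEQ_le_const2[of _ "2 * c * B (\<lambda>i. h i - p i) m - 0" "c\<^sup>2 * B m m"] by auto
    qed
    let ?b = "B (\<lambda>i. h i - p i) m"
    have mm: "B m m \<ge> 0" by (rule form_nonneg[OF mX])
    show ?thesis
    proof (rule ccontr)
      assume "?b \<noteq> 0"
      then have b: "?b\<^sup>2 > 0" by simp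
      \<comment> \<open>Inserting \<open>c = t * ?b\<close> into \<open>q\<close> gives
        \<open>2 \<le> t * B m m\<close>, whereas this \<open>t\<close> keeps
        \<open>t * B m m\<close> at most 1, also when \<open>B m m = 0\<close>.\<close>
      define t where "t = 1 / (B m m + 1)"
      have t: "t > 0" "t * B m m \<le> 1" using mm by (simp_all add: t_def)
      have "(t * ?b\<^sup>2) * 2 \<le> (t * ?b\<^sup>2) * (t * B m m)"
        using q[of "t * ?b"] by (simp add: power2_eq_square mult_ac)
      then have "2 \<le> t * B m m" using b t(1) by simp
      then show False using t(2) by simp
    qed
  qed
  with that p sM lim show ?thesis by blast
qed

end

section \<open>Projection onto closed subspaces and representation of functionals\<close>

lemma orthogonal_projection_exists:
  fixes G :: "'e::{real_inner, complete_space} set"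
  assumes G: "subspace G" "closed G"
  shows "\<exists>p\<in>G. \<forall>y\<in>G. (h - p) \<bullet> y = 0"
proof -
  \<comment> \<open>A vector is regarded as a function on the one-point type, so that the projection
    theorem for function spaces applies. Closedness of \<open>G\<close> afterwards puts the limit
    point into \<open>G\<close>.\<close>
  interpret function_form "UNIV :: (unit \<Rightarrow> 'e) set" "\<lambda>x y. x () \<bullet> y ()"
    by standard (auto simp: inner_add_left intro: inner_commute)
  let ?M = "{x. x () \<in> G}"
  obtain p s where p: "\<And>n. s n \<in> ?M" 
    "(\<lambda>n. (s n () - p ()) \<bullet> (s n () - p ())) \<longlonglongrightarrow> 0"
    "\<And>m. m \<in> ?M \<Longrightarrow> (h - p ()) \<bullet> m () = 0"
  proof (rule projection[of ?M "\<lambda>_. h"])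
    show "?M \<noteq> {}" using subspace_0[OF G(1)] by (auto intro!: exI[of _ "\<lambda>_. 0"])
    show "(\<lambda>i. x i + c *\<^sub>R y i) \<in> ?M" if "x \<in> ?M" "y \<in> ?M" for x y c
      using that G(1) by (auto intro: subspace_add subspace_scale)
    show "\<exists>p\<in>UNIV. (\<lambda>n. (s n () - p ()) \<bullet> (s n () - p ())) \<longlonglongrightarrow> 0"
      if C: "\<And>e. e > 0 \<Longrightarrow> \<exists>N. \<forall>m\<ge>N. \<forall>n\<ge>N. (s m () - s n ()) \<bullet> (s m () - s n ()) < e"
      for s :: "nat \<Rightarrow> unit \<Rightarrow> 'e"
    proof -
      have "Cauchy (\<lambda>n. s n ())"
        unfolding Cauchy_def dist_norm
      proof (intro allI impI)
        fix e :: real assume "e > 0"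
        then have "e\<^sup>2 > 0" by simp
        from C[OF this] obtain N where N: "\<And>m n. m \<ge> N \<Longrightarrow> n \<ge> N \<Longrightarrow> (norm (s m () - s n ()))\<^sup>2 < e\<^sup>2"
          by (auto simp: power2_norm_eq_inner)
        then show "\<exists>N. \<forall>m\<ge>N. \<forall>n\<ge>N. norm (s m () - s n ()) < e"
          using \<open>e > 0\<close> by (meson power2_less_imp_less less_imp_le)
      qed
      then obtain L where L: "(\<lambda>n. s n ()) \<longlonglongrightarrow> L" by (metis Cauchy_convergent convergent_def)
      have "(\<lambda>n. (s n () - L) \<bullet> (s n () - L)) \<longlonglongrightarrow> (L - L) \<bullet> (L - L)"
        by (intro tendsto_intros L)
      then show ?thesis by (auto intro!: bexI[of _ "\<lambda>_. L"])
    qed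
  qed auto
  have "(\<lambda>n. sqrt ((s n () - p ()) \<bullet> (s n () - p ()))) \<longlonglongrightarrow> sqrt 0"
    by (intro tendsto_intros p)
  then have "(\<lambda>n. s n () - p ()) \<longlonglongrightarrow> 0"
    by (simp add: tendsto_norm_zero_iff flip: norm_eq_sqrt_inner)
  then have "(\<lambda>n. s n ()) \<longlonglongrightarrow> p ()" by (simp add: LIM_zero_iff)
  then have "p () \<in> G" using closed_sequentially[OF G(2), of "\<lambda>n. s n ()"] p(1) by auto
  moreover have "\<forall>y\<in>G. (h - p ()) \<bullet> y = 0"
    using p(3)[of "\<lambda>_. y" for y] by auto
  ultimately show ?thesis by blast
qed

text \<open>Defined on the whole ambient space, so that composing with it turns a bounded linear map
  of the full type into one with values in \<open>G\<close>.\<close>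

definition proj_on :: "'e::{real_inner, complete_space} set \<Rightarrow> 'e \<Rightarrow> 'e"
  where "proj_on G h = (SOME p. p \<in> G \<and> (\<forall>y\<in>G. (h - p) \<bullet> y = 0))"

context
  fixes G :: "'e::{real_inner, complete_space} set"
  assumes G: "subspace G" "closed G"
begin

lemma proj_on_in: "proj_on G h \<in> G"
  and inner_proj_on: "y \<in> G \<Longrightarrow> proj_on G h \<bullet> y = h \<bullet> y"
proof -
  have "proj_on G h \<in> G \<and> (\<forall>y\<in>G. (h - proj_on G h) \<bullet> y = 0)"
    unfolding proj_on_def
    by (rule someI_ex[of "\<lambda>p. p \<in> G \<and> (\<forall>y\<in>G. (h - p) \<bullet> y = 0)"])
       (use orthogonal_projection_exists[OF G, of h] in blast)
  then have *: "proj_on G h \<in> G" "\<And>y. y \<in> G \<Longrightarrow> h \<bullet> y - proj_on G h \<bullet> y = 0"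
    by (simp_all flip: inner_diff_left)
  show "proj_on G h \<in> G" by (rule *)
  show "y \<in> G \<Longrightarrow> proj_on G h \<bullet> y = h \<bullet> y" using *(2)[of y] by simp
qed

lemma eq_if_inner_eq:
  assumes "x \<in> G" "y \<in> G" "\<And>z. z \<in> G \<Longrightarrow> x \<bullet> z = y \<bullet> z"
  shows "x = y"
proof -
  have "(x - y) \<bullet> (x - y) = 0"
    using assms(3)[OF subspace_diff[OF G(1) assms(1,2)]] by (simp add: inner_diff_left)
  then show ?thesis by simp
qed

lemma norm_proj_on_le: "norm (proj_on G h) \<le> norm h"
proof (cases "proj_on G h = 0")
  case False
  have "(norm (proj_on G h))\<^sup>2 = h \<bullet> proj_on G h"
    by (simp add: power2_norm_eq_inner inner_proj_on proj_on_in)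
  also have "\<dots> \<le> norm h * norm (proj_on G h)" by (rule norm_cauchy_schwarz)
  finally show ?thesis using False by (simp add: power2_eq_square)
qed simp

lemma bounded_linear_proj_on: "bounded_linear (proj_on G)"
proof (rule bounded_linear_intro[where K = 1])
  show "proj_on G (x + y) = proj_on G x + proj_on G y" for x y
    by (rule eq_if_inner_eq)
       (auto simp: inner_proj_on inner_add_left proj_on_in intro!: subspace_add[OF G(1)])
  show "proj_on G (r *\<^sub>R x) = r *\<^sub>R proj_on G x" for r x
    by (rule eq_if_inner_eq)
       (auto simp: inner_proj_on proj_on_in intro!: subspace_scale[OF G(1)])
qed (simp add: norm_proj_on_le)

text \<open>The classical argument: \<open>F\<close> is determined by its value at a vector
  \<open>z\<close> orthogonal to its kernel. All hypotheses are restricted to \<open>G\<close>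
  because the functionals to be represented are known to be linear and bounded only there.\<close>

lemma riesz_representation:
  assumes add: "\<And>x y. x \<in> G \<Longrightarrow> y \<in> G \<Longrightarrow> F (x + y) = F x + F y"
    and scale: "\<And>c x. x \<in> G \<Longrightarrow> F (c *\<^sub>R x) = c * F x"
    and bound: "\<And>x. x \<in> G \<Longrightarrow> \<bar>F x\<bar> \<le> C * norm x"
  obtains x where "x \<in> G" "\<And>y. y \<in> G \<Longrightarrow> F y = x \<bullet> y"
proof -
  let ?K = "{x\<in>G. F x = 0}"
  have F0: "F 0 = 0" using scale[of 0 0] subspace_0[OF G(1)] by simp
  have diff: "F (x - y) = F x - F y" if "x \<in> G" "y \<in> G" for x y
    using add[OF that(1) subspace_scale[OF G(1) that(2), of "-1"]] scale[OF that(2), of "-1"] by simp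
  have subK: "subspace ?K"
    using G(1) F0 by (auto simp: subspace_def add scale)
  have "closed ?K"
    unfolding closed_sequential_limits
  proof (intro allI impI, elim conjE)
    fix s l assume s: "\<forall>n. s n \<in> ?K" and l: "s \<longlonglongrightarrow> l"
    then have lG: "l \<in> G" using G(2) by (auto intro: closed_sequentially)
    have "(\<lambda>n. C * norm (s n - l)) \<longlonglongrightarrow> C * norm (l - l)" by (intro tendsto_intros l)
    moreover have "\<bar>F l\<bar> \<le> C * norm (s n - l)" for n
      using bound[of "s n - l"] diff[of "s n" l] s lG subspace_diff[OF G(1), of "s n" l] by auto
    ultimately have "\<bar>F l\<bar> \<le> C * norm (l - l)" by (intro LIMSEQ_le_const) auto
    then show "l \<in> ?K" using lG by simp
  qed
  show ?thesis
  proof (cases "\<forall>x\<in>G. F x = 0")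
    case True
    then show ?thesis using that[of 0] subspace_0[OF G(1)] by simp
  next
    case False
    then obtain h where h: "h \<in> G" "F h \<noteq> 0" by blast
    obtain p where p: "p \<in> ?K" "\<And>y. y \<in> ?K \<Longrightarrow> (h - p) \<bullet> y = 0"
      using orthogonal_projection_exists[OF subK \<open>closed ?K\<close>, of h] by blast
    define z where "z = h - p"
    have z: "z \<in> G" "F z = F h" using h p subspace_diff[OF G(1)] diff by (auto simp: z_def)
    have "z \<noteq> 0" using z(2) h(2) F0 by auto
    show ?thesis
    proof (rule that[of "(F z / (z \<bullet> z)) *\<^sub>R z"])
      show "(F z / (z \<bullet> z)) *\<^sub>R z \<in> G" using z G(1) by (simp add: subspace_scale)
      fix y assume y: "y \<in> G"
      have "F (y - (F y / F z) *\<^sub>R z) = 0"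
        using diff[OF y subspace_scale[OF G(1) z(1)]] scale[OF z(1)] z(2) h(2) by simp
      then have "z \<bullet> (y - (F y / F z) *\<^sub>R z) = 0"
        unfolding z_def[symmetric]
        using p(2)[of "y - (F y / F z) *\<^sub>R z", folded z_def] y z(1) G(1)
        by (auto intro: subspace_diff subspace_scale)
      then have "z \<bullet> y = F y / F z * (z \<bullet> z)" by (simp add: inner_diff_right)
      then show "F y = ((F z / (z \<bullet> z)) *\<^sub>R z) \<bullet> y"
        using z(2) h(2) \<open>z \<noteq> 0\<close> by (simp add: field_simps)
    qed
  qed
qed

end

text \<open>Subsets of separable metric spaces are separable: points of \<open>C\<close> need not
  lie in \<open>G\<close>, so for every \<open>c\<close> in \<open>C\<close> and every radius
  \<open>1 / Suc n\<close> one point of \<open>G\<close> that close to \<open>c\<close> is selected,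
  if there is one.\<close>

lemma countable_dense_subset:
  fixes S G :: "'e::metric_space set"
  assumes "countable C" "S \<subseteq> closure C" "G \<subseteq> S"
  obtains D where "countable D" "D \<subseteq> G" "G \<subseteq> closure D"
proof -
  let ?P = "\<lambda>c n x. x \<in> G \<and> dist c x < 1 / real (Suc n)"
  define D where "D = (\<lambda>(c, n). SOME x. ?P c n x) ` {(c, n) \<in> C \<times> UNIV. \<exists>x. ?P c n x}"
  have D: "?P c n (SOME x. ?P c n x)" if "?P c n x" for c n x
    using someI[of "?P c n" x] that by blast
  show ?thesis
  proof
    have "countable {(c, n) \<in> C \<times> (UNIV :: nat set). \<exists>x. ?P c n x}"
      by (rule countable_subset[of _ "C \<times> UNIV"]) (auto simp: assms(1))
    then show "countable D" unfolding D_def by (rule countable_image)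
    show "D \<subseteq> G"
    proof
      fix y assume "y \<in> D"
      then obtain c n x where "y = (SOME x. ?P c n x)" "?P c n x" unfolding D_def by auto
      with D[of x c n] show "y \<in> G" by blast
    qed
    show "G \<subseteq> closure D"
    proof
      fix x assume x: "x \<in> G"
      show "x \<in> closure D" unfolding closure_approachable
      proof (intro allI impI)
        fix e :: real assume "e > 0"
        then obtain n where n: "1 / real (Suc n) < e / 2" using nat_approx_posE[of "e/2"] by auto
        obtain c where c: "c \<in> C" "dist c x < 1 / real (Suc n)"
          using x assms(2,3) closure_approachable[of x C] by (meson of_nat_0_less_iff subsetD zero_less_Suc zero_less_divide_1_iff)
        let ?y = "SOME x. ?P c n x"
        have "?P c n ?y" using D[of x c n] x c by blast
        then have "dist ?y x < e" using n c(2) dist_triangle[of ?y x c] by (simp add: dist_commute)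
        moreover have "?y \<in> D" unfolding D_def using c x by (auto intro!: image_eqI[of _ _ "(c, n)"])
        ultimately show "\<exists>y\<in>D. dist y x < e" by blast
      qed
    qed
  qed
qed

section \<open>Square-integrable functions with values in a separable Hilbert space\<close>

text \<open>The ambient type is not assumed separable, hence measurability is asked of the scalar
  functions \<open>h t \<bullet> x\<close>. Values lie in \<open>G\<close> at every point, not just
  almost everywhere, so that \<open>G\<close>-only identities can be used under integrals.\<close>

definition L2_fun :: "'i measure \<Rightarrow> 'e::real_inner set \<Rightarrow> ('i \<Rightarrow> 'e) set"
  where "L2_fun M G = {h. (\<forall>t\<in>space M. h t \<in> G) \<and>
    (\<forall>x\<in>G. (\<lambda>t. h t \<bullet> x) \<in> borel_measurable M) \<and> integrable M (\<lambda>t. (norm (h t))\<^sup>2)}"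

definition L2_inner :: "'i measure \<Rightarrow> ('i \<Rightarrow> 'e::real_inner) \<Rightarrow> ('i \<Rightarrow> 'e) \<Rightarrow> real"
  where "L2_inner M x y = (\<integral>t. x t \<bullet> y t \<partial>M)"

lemma Cauchy_if_summable_steps:
  fixes x :: "nat \<Rightarrow> 'e::real_normed_vector"
  assumes a: "summable a" and step: "\<And>n. norm (x (Suc n) - x n) \<le> a n"
  shows "Cauchy x"
proof -
  have a0: "a n \<ge> 0" for n using step[of n] norm_ge_zero order_trans by blast
  have le: "norm (x (m + k) - x m) \<le> sum a {m..<m + k}" for m k
  proof (induction k)
    case (Suc k)
    have "norm (x (m + Suc k) - x m) \<le> norm (x (Suc (m + k)) - x (m + k)) + norm (x (m + k) - x m)"
      using norm_triangle_ineq[of "x (Suc (m + k)) - x (m + k)" "x (m + k) - x m"] by simp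
    then show ?case using Suc step[of "m + k"] by simp
  qed simp
  show ?thesis
  proof (rule CauchyI')
    fix e :: real assume "e > 0"
    then obtain N where N: "\<And>m n. m \<ge> N \<Longrightarrow> norm (sum a {m..<n}) < e"
      using a unfolding summable_Cauchy by blast
    have "dist (x m) (x n) < e" if "m \<ge> N" "n > m" for m n
    proof -
      have "dist (x m) (x n) \<le> sum a {m..<n}"
        using le[of m "n - m"] that by (simp add: dist_norm norm_minus_commute)
      also have "\<dots> \<le> norm (sum a {m..<n})" by simp
      also have "\<dots> < e" using N that by blast
      finally show ?thesis .
    qed
    then show "\<exists>N. \<forall>m\<ge>N. \<forall>n>m. dist (x m) (x n) < e" by blast
  qed
qed

lemma norm_add_squared_le:
  fixes x y :: "'e::real_inner"
  shows "(norm (x + y))\<^sup>2 \<le> 2 * (norm x)\<^sup>2 + 2 * (norm y)\<^sup>2"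
proof -
  have "(norm (x + y))\<^sup>2 + (norm (x - y))\<^sup>2 = 2 * (norm x)\<^sup>2 + 2 * (norm y)\<^sup>2"
    unfolding power2_norm_eq_inner by (simp add: inner_add_left inner_add_right inner_diff_left inner_diff_right)
  then show ?thesis using zero_le_power2[of "norm (x - y)"] by linarith
qed

lemma abs_inner_le_norm_squares:
  fixes x y :: "'e::real_inner"
  shows "\<bar>x \<bullet> y\<bar> \<le> (norm x)\<^sup>2 + (norm y)\<^sup>2"
proof -
  have "0 \<le> (norm x - norm y)\<^sup>2" by simp
  then have "2 * (norm x * norm y) \<le> (norm x)\<^sup>2 + (norm y)\<^sup>2" by (simp add: power2_diff)
  moreover have "0 \<le> norm x * norm y" by simp
  ultimately show ?thesis using Cauchy_Schwarz_ineq2[of x y] by linarith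
qed

locale L2_setting = finite_measure M for M :: "'i measure" +
  fixes G :: "'e::{real_inner, complete_space} set"
  assumes subspace_G: "subspace G" and closed_G: "closed G"
    and separable_G: "\<exists>C. countable C \<and> C \<subseteq> G \<and> G \<subseteq> closure C"
begin

definition dense_seq :: "nat \<Rightarrow> 'e"
  where "dense_seq = from_nat_into (SOME C. countable C \<and> C \<subseteq> G \<and> G \<subseteq> closure C)"

lemma dense_seq_in: "dense_seq n \<in> G"
  and dense_seq_dense: "G \<subseteq> closure (range dense_seq)"
proof -
  define C where "C = (SOME C. countable C \<and> C \<subseteq> G \<and> G \<subseteq> closure C)"
  have C: "countable C \<and> C \<subseteq> G \<and> G \<subseteq> closure C"
    unfolding C_def using separable_G by (rule someI_ex)
  then have ne: "C \<noteq> {}" using subspace_0[OF subspace_G] by auto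
  have r: "range dense_seq = C"
    unfolding dense_seq_def C_def[symmetric] using ne C by (simp add: range_from_nat_into)
  then show "dense_seq n \<in> G" "G \<subseteq> closure (range dense_seq)" using C by auto
qed

lemma dense_seq_approx:
  assumes "x \<in> G" "e > 0"
  obtains n where "norm (x - dense_seq n) < e"
  using assms dense_seq_dense unfolding closure_approachable
  by (smt (verit, best) dist_norm imageE norm_minus_commute subsetD closure_approachable)

lemma L2_D:
  assumes "h \<in> L2_fun M G"
  shows "\<And>t. t \<in> space M \<Longrightarrow> h t \<in> G" "\<And>x. x \<in> G \<Longrightarrow> (\<lambda>t. h t \<bullet> x) \<in> borel_measurable M"
    "integrable M (\<lambda>t. (norm (h t))\<^sup>2)"
  using assms by (auto simp: L2_fun_def)

text \<open>
  Pettis: in a separable space \<open>(norm h)\<^sup>2\<close> is the supremum of \<open>2 * (h \<bullet> x) - x \<bullet> x\<close> over a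
  countable dense set, so weak measurability gives measurability of the norm.
\<close>

lemma norm_measurable:
  assumes hG: "\<And>t. t \<in> space M \<Longrightarrow> h t \<in> G"
    and meas: "\<And>x. x \<in> G \<Longrightarrow> (\<lambda>t. h t \<bullet> x) \<in> borel_measurable M"
  shows "(\<lambda>t. norm (h t)) \<in> borel_measurable M"
proof -
  let ?g = "\<lambda>n t. 2 * (h t \<bullet> dense_seq n) - dense_seq n \<bullet> dense_seq n"
  have sq: "norm (y - z) ^ 2 = y \<bullet> y - (2 * (y \<bullet> z) - z \<bullet> z)" for y z :: 'e
    by (simp add: power2_norm_eq_inner inner_diff_left inner_diff_right inner_commute)
  have up: "?g n t \<le> h t \<bullet> h t" for n t
    using sq[of "h t" "dense_seq n"] zero_le_power2[of "norm (h t - dense_seq n)"] by linarith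
  have sup: "(SUP n. ?g n t) = h t \<bullet> h t" if t: "t \<in> space M" for t
  proof (rule antisym)
    show "(SUP n. ?g n t) \<le> h t \<bullet> h t" by (rule cSUP_least) (use up in auto)
    show "h t \<bullet> h t \<le> (SUP n. ?g n t)"
    proof (rule field_le_epsilon)
      fix e :: real assume e: "e > 0"
      obtain n where n: "norm (h t - dense_seq n) < sqrt e"
        using dense_seq_approx[OF hG[OF t], of "sqrt e"] e by auto
      then have "(norm (h t - dense_seq n))\<^sup>2 < e"
        using e by (metis norm_ge_zero real_less_rsqrt real_sqrt_less_iff real_sqrt_abs abs_norm_cancel)
      then have "h t \<bullet> h t \<le> ?g n t + e" using sq[of "h t" "dense_seq n"] by linarith
      also have "?g n t \<le> (SUP n. ?g n t)"
        by (rule cSUP_upper) (use up in \<open>auto intro!: bdd_aboveI[of _ "h t \<bullet> h t"]\<close>)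
      finally show "h t \<bullet> h t \<le> (SUP n. ?g n t) + e" by simp
    qed
  qed
  have "(\<lambda>t. SUP n. ?g n t) \<in> borel_measurable M"
  proof (rule borel_measurable_cSUP)
    show "?g n \<in> borel_measurable M" for n
      by (intro borel_measurable_diff borel_measurable_times borel_measurable_const meas dense_seq_in)
    show "bdd_above ((\<lambda>n. ?g n t) ` UNIV)" for t
      using up by (auto intro!: bdd_aboveI[of _ "h t \<bullet> h t"])
  qed simp
  then have "(\<lambda>t. h t \<bullet> h t) \<in> borel_measurable M"
    using sup by (simp cong: measurable_cong)
  then have "(\<lambda>t. sqrt (h t \<bullet> h t)) \<in> borel_measurable M" by simp
  then show ?thesis by (simp flip: norm_eq_sqrt_inner)
qed

text \<open>\<open>s n t\<close> is a point nearest to \<open>h t\<close> among the first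
  \<open>n + 1\<close> points of the dense sequence, found by keeping the current candidate until a
  strictly better one appears.\<close>

lemma simple_approximation:
  assumes hG: "\<And>t. t \<in> space M \<Longrightarrow> h t \<in> G"
    and meas: "\<And>x. x \<in> G \<Longrightarrow> (\<lambda>t. h t \<bullet> x) \<in> borel_measurable M"
  obtains s where "\<And>n. simple_function M (s n)" "\<And>n t. s n t \<in> G"
    "\<And>t. t \<in> space M \<Longrightarrow> (\<lambda>n. norm (s n t - h t)) \<longlonglongrightarrow> 0"
proof -
  define s where "s = rec_nat (\<lambda>t. dense_seq 0)
    (\<lambda>n f t. if norm (h t - dense_seq (Suc n)) < norm (h t - f t) then dense_seq (Suc n) else f t)"
  have s0: "s 0 = (\<lambda>t. dense_seq 0)" by (simp add: s_def)
  have sS: "s (Suc n) = (\<lambda>t. if norm (h t - dense_seq (Suc n)) < norm (h t - s n t)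
      then dense_seq (Suc n) else s n t)" for n
    unfolding s_def by simp
  have d: "(\<lambda>t. norm (h t - dense_seq n)) \<in> borel_measurable M" for n
  proof (rule norm_measurable)
    show "h t - dense_seq n \<in> G" if "t \<in> space M" for t
      using subspace_diff[OF subspace_G hG[OF that] dense_seq_in] .
    show "(\<lambda>t. (h t - dense_seq n) \<bullet> x) \<in> borel_measurable M" if "x \<in> G" for x
      unfolding inner_diff_left
      by (intro borel_measurable_diff meas that borel_measurable_const)
  qed
  \<comment> \<open>This identity makes the distance to \<open>s n\<close> measurable by induction,
    without first knowing that \<open>s n\<close> is measurable; that distance is what decides the
    case distinction in the recursion.\<close>
  have min: "norm (h t - s (Suc n) t) = min (norm (h t - dense_seq (Suc n))) (norm (h t - s n t))" for n t
    by (simp add: sS)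
  have m: "(\<lambda>t. norm (h t - s n t)) \<in> borel_measurable M" for n
  proof (induction n)
    case 0
    then show ?case using d[of 0] by (simp add: s0)
  next
    case (Suc n)
    then show ?case unfolding min by (intro borel_measurable_min d)
  qed
  have simp: "simple_function M (s n)" for n
  proof (induction n)
    case (Suc n)
    have "{t \<in> space M. norm (h t - dense_seq (Suc n)) < norm (h t - s n t)} \<in> sets M"
      using d m by (rule borel_measurable_less)
    then show ?case unfolding sS by (intro simple_function_If Suc simple_function_const) auto
  qed (simp add: s0)
  have G: "s n t \<in> G" for n t
    by (induction n) (auto simp: s0 sS dense_seq_in)
  have le: "i \<le> n \<Longrightarrow> norm (h t - s n t) \<le> norm (h t - dense_seq i)" for i n t
  proof (induction n)
    case 0
    then show ?case by (simp add: s0)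
  next
    case (Suc n)
    then show ?case unfolding min by (cases "i = Suc n") auto
  qed
  have "(\<lambda>n. norm (s n t - h t)) \<longlonglongrightarrow> 0" if t: "t \<in> space M" for t
  proof (rule LIMSEQ_I)
    fix e :: real assume "e > 0"
    then obtain i where i: "norm (h t - dense_seq i) < e"
      using dense_seq_approx[OF hG[OF t], of e] by auto
    have "norm (norm (s n t - h t) - 0) < e" if "n \<ge> i" for n
      using le[OF that, of t] i by (simp add: norm_minus_commute)
    then show "\<exists>no. \<forall>n\<ge>no. norm (norm (s n t - h t) - 0) < e" by blast
  qed
  with that simp G show ?thesis by blast
qed

lemma L2_norm_measurable: "h \<in> L2_fun M G \<Longrightarrow> (\<lambda>t. norm (h t)) \<in> borel_measurable M"
  by (rule norm_measurable) (auto dest: L2_D)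

lemma L2_lin:
  assumes x: "x \<in> L2_fun M G" and y: "y \<in> L2_fun M G"
  shows "(\<lambda>t. x t + c *\<^sub>R y t) \<in> L2_fun M G"
proof -
  let ?z = "\<lambda>t. x t + c *\<^sub>R y t"
  have 1: "?z t \<in> G" if "t \<in> space M" for t
    using that x y subspace_G by (auto dest: L2_D intro: subspace_add subspace_scale)
  have 2: "(\<lambda>t. ?z t \<bullet> v) \<in> borel_measurable M" if "v \<in> G" for v
    unfolding inner_add_left inner_scaleR_left
    by (intro borel_measurable_add borel_measurable_times borel_measurable_const L2_D that x y)
  have "integrable M (\<lambda>t. (norm (?z t))\<^sup>2)"
  proof (rule Bochner_Integration.integrable_bound)
    show "integrable M (\<lambda>t. 2 * (norm (x t))\<^sup>2 + 2 * (c\<^sup>2 * (norm (y t))\<^sup>2))"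
      by (intro Bochner_Integration.integrable_add integrable_mult_right L2_D x y)
    show "(\<lambda>t. (norm (?z t))\<^sup>2) \<in> borel_measurable M"
      by (intro borel_measurable_power norm_measurable 1 2)
    show "AE t in M. norm ((norm (?z t))\<^sup>2) \<le> norm (2 * (norm (x t))\<^sup>2 + 2 * (c\<^sup>2 * (norm (y t))\<^sup>2))"
    proof (rule AE_I2)
      fix t
      have "(norm (?z t))\<^sup>2 \<le> 2 * (norm (x t))\<^sup>2 + 2 * (norm (c *\<^sub>R y t))\<^sup>2"
        by (rule norm_add_squared_le)
      then show "norm ((norm (?z t))\<^sup>2) \<le> norm (2 * (norm (x t))\<^sup>2 + 2 * (c\<^sup>2 * (norm (y t))\<^sup>2))"
        by (simp add: power_mult_distrib)
    qed
  qed
  with 1 2 show ?thesis by (auto simp: L2_fun_def)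
qed

lemma L2_inner_integrable:
  assumes x: "x \<in> L2_fun M G" and y: "y \<in> L2_fun M G"
  shows "integrable M (\<lambda>t. x t \<bullet> y t)"
proof (rule Bochner_Integration.integrable_bound)
  \<comment> \<open>Polarization reduces measurability of the inner product to measurability of
    norms, which is known from Pettis' argument.\<close>
  have eq: "x t \<bullet> y t = ((norm (x t + 1 *\<^sub>R y t))\<^sup>2 - (norm (x t))\<^sup>2 - (norm (y t))\<^sup>2) / 2" for t
    by (simp add: power2_norm_eq_inner inner_add_left inner_add_right inner_commute)
  show "(\<lambda>t. x t \<bullet> y t) \<in> borel_measurable M"
    unfolding eq
    by (intro borel_measurable_divide borel_measurable_diff borel_measurable_power
        borel_measurable_const L2_norm_measurable L2_lin x y)
  show "integrable M (\<lambda>t. (norm (x t))\<^sup>2 + (norm (y t))\<^sup>2)"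
    by (intro Bochner_Integration.integrable_add L2_D x y)
  show "AE t in M. norm (x t \<bullet> y t) \<le> norm ((norm (x t))\<^sup>2 + (norm (y t))\<^sup>2)"
    using abs_inner_le_norm_squares[of "x t" "y t" for t] by simp
qed

sublocale function_form "L2_fun M G" "L2_inner M"
proof
  fix x y z :: "'i \<Rightarrow> 'e" and c
  assume x: "x \<in> L2_fun M G" and y: "y \<in> L2_fun M G"
  show "(\<lambda>t. x t + c *\<^sub>R y t) \<in> L2_fun M G" by (rule L2_lin[OF x y])
  show "L2_inner M x y = L2_inner M y x" by (simp add: L2_inner_def inner_commute)
  assume z: "z \<in> L2_fun M G"
  show "L2_inner M (\<lambda>t. x t + c *\<^sub>R y t) z = L2_inner M x z + c * L2_inner M y z"
    using L2_inner_integrable[OF x z] L2_inner_integrable[OF y z]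
    by (simp add: L2_inner_def inner_add_left)
qed (simp add: L2_inner_def)

lemma L2_inner_self: "L2_inner M x x = (\<integral>t. (norm (x t))\<^sup>2 \<partial>M)"
  by (simp add: L2_inner_def power2_norm_eq_inner)

lemma L2_norm_integrable: "x \<in> L2_fun M G \<Longrightarrow> integrable M (\<lambda>t. norm (x t))"
proof (rule Bochner_Integration.integrable_bound)
  assume x: "x \<in> L2_fun M G"
  show "integrable M (\<lambda>t. 1 + (norm (x t))\<^sup>2)"
    by (intro Bochner_Integration.integrable_add L2_D x) simp
  show "(\<lambda>t. norm (x t)) \<in> borel_measurable M" by (rule L2_norm_measurable[OF x])
  show "AE t in M. norm (norm (x t)) \<le> norm (1 + (norm (x t))\<^sup>2)"
  proof (rule AE_I2)
    fix t
    have "0 \<le> (norm (x t) - 1)\<^sup>2" by simp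
    then have "2 * norm (x t) \<le> 1 + (norm (x t))\<^sup>2" by (simp add: power2_diff)
    then show "norm (norm (x t)) \<le> norm (1 + (norm (x t))\<^sup>2)"
      using norm_ge_zero[of "x t"] unfolding real_norm_def abs_norm_cancel by linarith
  qed
qed

text \<open>The exceptional null set in the hypothesis depends on \<open>v\<close>. Restricting
  \<open>v\<close> to a countable dense set leaves a single null set, off which \<open>x t\<close>
  is orthogonal to all of \<open>G\<close> by continuity.\<close>

lemma L2_AE_zero:
  assumes x: "\<And>t. t \<in> space M \<Longrightarrow> x t \<in> G" and 0: "\<And>v. v \<in> G \<Longrightarrow> AE t in M. x t \<bullet> v = 0"
  shows "AE t in M. x t = 0"
proof -
  have "AE t in M. \<forall>n. x t \<bullet> dense_seq n = 0"
    by (simp add: AE_all_countable 0 dense_seq_in)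
  then show ?thesis
  proof (rule AE_mp, intro AE_I2 impI)
    fix t assume t: "t \<in> space M" and z: "\<forall>n. x t \<bullet> dense_seq n = 0"
    have "closed {v. x t \<bullet> v = 0}" by (rule closed_hyperplane)
    moreover have "range dense_seq \<subseteq> {v. x t \<bullet> v = 0}" using z by auto
    ultimately have "closure (range dense_seq) \<subseteq> {v. x t \<bullet> v = 0}" by (rule closure_minimal[rotated])
    then have "x t \<bullet> x t = 0" using x[OF t] dense_seq_dense by blast
    then show "x t = 0" by simp
  qed
qed

text \<open>Riesz-Fischer. The almost everywhere convergent subsequence is part of the conclusion
  because it later identifies an L^2 limit with a uniform limit.\<close>

theorem L2_complete:
  assumes s: "\<And>n. s n \<in> L2_fun M G"
    and cauchy: "\<And>e. e > 0 \<Longrightarrow>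
      \<exists>N. \<forall>m\<ge>N. \<forall>n\<ge>N. sqdist (s m) (s n) < e"
  obtains p r where "p \<in> L2_fun M G"
    "(\<lambda>n. sqdist (s n) p) \<longlonglongrightarrow> 0"
    "strict_mono r" "AE t in M. (\<lambda>n. s (r n) t) \<longlonglongrightarrow> p t"
proof -
  let ?d = "\<lambda>m n. sqdist (s m) (s n)"
  have "\<exists>N. \<forall>m\<ge>N. \<forall>n\<ge>N. ?d m n < (1/4)^k" for k :: nat
    by (rule cauchy) simp
  then obtain N where N: "\<And>k m n. m \<ge> N k \<Longrightarrow> n \<ge> N k \<Longrightarrow> ?d m n < (1/4)^k" by metis
  \<comment> \<open>Adding \<open>k\<close> makes \<open>r\<close> strictly increasing, and summing
    all \<open>N i\<close> up to \<open>k\<close> makes \<open>r k \<ge> N k\<close>.\<close>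
  define r where "r k = k + (\<Sum>i\<le>k. N i)" for k
  have r: "strict_mono r" unfolding strict_mono_Suc_iff r_def by simp
  have rN: "r k \<ge> N k" for k
  proof -
    have "N k \<le> (\<Sum>i\<le>k. N i)" by (rule member_le_sum) auto
    then show ?thesis by (simp add: r_def)
  qed
  define a where "a k t = norm (s (r (Suc k)) t - s (r k) t)" for k t
  have dL: "(\<lambda>t. s m t - s n t) \<in> L2_fun M G" for m n by (intro diff_in s)
  have a_int: "integrable M (a k)" for k
    unfolding a_def by (rule L2_norm_integrable[OF dL])
  let ?K = "1 + measure M (space M)"
  \<comment> \<open>The inequality \<open>2 * x \<le> 2^k * x\<^sup>2 + (1/2)^k\<close> converts the
    L^2 bound into an L^1 bound. Distances below \<open>(1/4)^k\<close> were chosen so that both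
    terms on the right are of order \<open>(1/2)^k\<close>.\<close>
  have a_le: "integral\<^sup>L M (a k) \<le> (1/2)^k * ?K" for k
  proof -
    have "integral\<^sup>L M (a k) \<le> (\<integral>t. 2^k * (a k t)\<^sup>2 + (1/2)^k \<partial>M)"
    proof (rule integral_mono[OF a_int])
      show "integrable M (\<lambda>t. 2^k * (a k t)\<^sup>2 + (1/2)^k)"
        unfolding a_def using L2_D(3)[OF dL] by (intro Bochner_Integration.integrable_add) auto
      fix t
      have a0: "a k t \<ge> 0" by (simp add: a_def)
      have "0 \<le> (1/2)^k * ((2^k * a k t - 1)\<^sup>2 :: real)" by simp
      also have "\<dots> = 2^k * (a k t)\<^sup>2 + (1/2)^k - 2 * a k t"
        by (simp add: power2_diff power2_eq_square field_simps power_divide)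
      finally show "a k t \<le> 2^k * (a k t)\<^sup>2 + (1/2)^k" using a0 by linarith
    qed
    also have "\<dots> = 2^k * ?d (r (Suc k)) (r k) + (1/2)^k * measure M (space M)"
      unfolding a_def L2_inner_self using L2_D(3)[OF dL] by (subst Bochner_Integration.integral_add) auto
    also have "\<dots> \<le> 2^k * (1/4)^k + (1/2)^k * measure M (space M)"
    proof -
      have "r (Suc k) \<ge> N k" using rN[of k] strict_mono_less_eq[OF r, of k "Suc k"] by simp
      then have "?d (r (Suc k)) (r k) \<le> (1/4)^k" using N rN less_imp_le by blast
      then show ?thesis by simp
    qed
    also have "2^k * (1/4)^k = ((1/2)^k :: real)" by (simp flip: power_mult_distrib)
    finally show ?thesis by (simp add: algebra_simps)
  qed
  have "AE t in M. summable (\<lambda>k. a k t)"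
  proof -
    have sm: "summable (\<lambda>k. integral\<^sup>L M (a k))"
    proof (rule summable_comparison_test')
      show "summable (\<lambda>k. (1/2)^k * ?K)" by (intro summable_mult2 summable_geometric) simp
      show "norm (integral\<^sup>L M (a k)) \<le> (1/2)^k * ?K" if "k \<ge> 0" for k
        using a_le[of k] by (simp add: a_def)
    qed
    have "(\<integral>\<^sup>+t. (\<Sum>k. ennreal (a k t)) \<partial>M) = (\<Sum>k. \<integral>\<^sup>+t. ennreal (a k t) \<partial>M)"
      using a_int by (intro nn_integral_suminf) auto
    also have "\<dots> = (\<Sum>k. ennreal (integral\<^sup>L M (a k)))"
      by (intro suminf_cong nn_integral_eq_integral a_int) (simp add: a_def)
    also have "\<dots> \<noteq> \<infinity>"
      unfolding infinity_ennreal_def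
      by (rule ennreal_suminf_neq_top[OF sm]) (simp add: a_def)
    finally have fin: "(\<integral>\<^sup>+t. (\<Sum>k. ennreal (a k t)) \<partial>M) \<noteq> \<infinity>" .
    have "AE t in M. (\<Sum>k. ennreal (a k t)) \<noteq> \<infinity>"
      by (rule nn_integral_noteq_infinite[OF _ fin]) (use a_int in auto)
    then show ?thesis
      by (rule AE_mp) (auto intro!: summable_suminf_not_top simp: a_def)
  qed
  then have "AE t in M. convergent (\<lambda>n. s (r n) t)"
  proof (rule AE_mp, intro AE_I2 impI)
    fix t assume "summable (\<lambda>k. a k t)"
    then have "Cauchy (\<lambda>n. s (r n) t)"
      by (rule Cauchy_if_summable_steps) (simp add: a_def)
    then show "convergent (\<lambda>n. s (r n) t)" by (metis Cauchy_convergent)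
  qed
  then obtain Z where Z: "{t\<in>space M. \<not> convergent (\<lambda>n. s (r n) t)} \<subseteq> Z" "emeasure M Z = 0" "Z \<in> sets M"
    by (rule AE_E)
  \<comment> \<open>The default value 0 on the null set \<open>Z\<close> keeps \<open>p t\<close> in
    \<open>G\<close> at every point.\<close>
  define p where "p t = (if t \<in> Z then 0 else lim (\<lambda>n. s (r n) t))" for t
  have conv: "(\<lambda>n. s (r n) t) \<longlonglongrightarrow> p t" if "t \<in> space M" "t \<notin> Z" for t
    using Z(1) that by (auto simp: p_def convergent_LIMSEQ_iff)
  have AEZ: "AE t in M. t \<notin> Z" using Z by (intro AE_not_in) auto
  have AEconv: "AE t in M. (\<lambda>n. s (r n) t) \<longlonglongrightarrow> p t"
    using AEZ by (rule AE_mp) (use conv in auto)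
  have pG: "p t \<in> G" if t: "t \<in> space M" for t
  proof (cases "t \<in> Z")
    case True
    then show ?thesis using subspace_0[OF subspace_G] by (simp add: p_def)
  next
    case False
    show ?thesis
      by (rule closed_sequentially[OF closed_G _ conv[OF t False]]) (use L2_D(1)[OF s t] in auto)
  qed
  have pm: "(\<lambda>t. p t \<bullet> x) \<in> borel_measurable M" if x: "x \<in> G" for x
  proof (rule borel_measurable_LIMSEQ_real)
    show "(\<lambda>t. if t \<in> Z then 0 else s (r n) t \<bullet> x) \<in> borel_measurable M" for n
    proof (rule measurable_If_set)
      show "(\<lambda>t. s (r n) t \<bullet> x) \<in> borel_measurable M" by (intro L2_D s x)
      show "Z \<inter> space M \<in> sets M" using Z(3) by auto
    qed simp
    show "(\<lambda>n. if t \<in> Z then 0 else s (r n) t \<bullet> x) \<longlonglongrightarrow> p t \<bullet> x" if "t \<in> space M" for t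
    proof (cases "t \<in> Z")
      case True
      then show ?thesis by (simp add: p_def)
    next
      case False
      then show ?thesis using tendsto_inner[OF conv[OF that False] tendsto_const] by simp
    qed
  qed
  let ?e = "\<lambda>n t. (norm (s n t - p t))\<^sup>2"
  have dmeas: "(\<lambda>t. norm (s n t - p t)) \<in> borel_measurable M" for n
  proof (rule norm_measurable)
    show "s n t - p t \<in> G" if "t \<in> space M" for t
      by (rule subspace_diff[OF subspace_G L2_D(1)[OF s that] pG[OF that]])
    show "(\<lambda>t. (s n t - p t) \<bullet> x) \<in> borel_measurable M" if "x \<in> G" for x
      unfolding inner_diff_left by (intro borel_measurable_diff L2_D s that pm)
  qed
  \<comment> \<open>Letting the second index tend to infinity along \<open>r\<close> bounds the
    distance to \<open>p\<close> by any eventual bound on the mutual distances. It serves twice: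
    with \<open>c = 1\<close> for square integrability, and with \<open>c = e/2\<close> for
    convergence.\<close>
  have fatou: "(\<integral>\<^sup>+t. ennreal (?e n t) \<partial>M) \<le> ennreal c"
    if c: "\<And>m. m \<ge> n0 \<Longrightarrow> ?d n m \<le> c" for n n0 c
  proof -
    have lim: "AE t in M. ennreal (?e n t) = liminf (\<lambda>k. ennreal ((norm (s n t - s (r k) t))\<^sup>2))"
      using AEconv
    proof (rule AE_mp, intro AE_I2 impI)
      fix t assume "(\<lambda>k. s (r k) t) \<longlonglongrightarrow> p t"
      then have "(\<lambda>k. ennreal ((norm (s n t - s (r k) t))\<^sup>2)) \<longlonglongrightarrow> ennreal (?e n t)"
        by (intro tendsto_intros)
      then show "ennreal (?e n t) = liminf (\<lambda>k. ennreal ((norm (s n t - s (r k) t))\<^sup>2))"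
        by (rule lim_imp_Liminf[symmetric, rotated]) simp
    qed
    have "(\<integral>\<^sup>+t. ennreal (?e n t) \<partial>M)
        = (\<integral>\<^sup>+t. liminf (\<lambda>k. ennreal ((norm (s n t - s (r k) t))\<^sup>2)) \<partial>M)"
      by (rule nn_integral_cong_AE[OF lim])
    also have "\<dots> \<le> liminf (\<lambda>k. \<integral>\<^sup>+t. ennreal ((norm (s n t - s (r k) t))\<^sup>2) \<partial>M)"
      by (rule nn_integral_liminf) (use L2_norm_measurable[OF dL] in \<open>auto intro!: borel_measurable_power\<close>)
    also have "\<dots> = liminf (\<lambda>k. ennreal (?d n (r k)))"
      unfolding L2_inner_self using L2_D(3)[OF dL] by (simp add: nn_integral_eq_integral)
    also have "\<dots> \<le> limsup (\<lambda>k. ennreal (?d n (r k)))" by (rule Liminf_le_Limsup) simp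
    also have "\<dots> \<le> ennreal c"
    proof (rule Limsup_bounded)
      show "\<forall>\<^sub>F k in sequentially. ennreal (?d n (r k)) \<le> ennreal c"
        using eventually_ge_at_top[of n0]
      proof (eventually_elim)
        case (elim k)
        then have "r k \<ge> n0" using seq_suble[OF r, of k] by linarith
        then show ?case by (intro ennreal_leI c)
      qed
    qed
    finally show ?thesis .
  qed
  have eint: "integrable M (?e n)" if "n \<ge> N 0" for n
  proof (rule integrableI_bounded)
    show "?e n \<in> borel_measurable M" by (intro borel_measurable_power dmeas)
    have "(\<integral>\<^sup>+t. ennreal (?e n t) \<partial>M) \<le> ennreal 1"
      by (rule fatou[of "N 0"]) (use N[of 0 n] that less_imp_le in force)
    then show "(\<integral>\<^sup>+t. ennreal (norm (?e n t)) \<partial>M) < \<infinity>"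
      by (simp add: le_less_trans)
  qed
  have dL2: "(\<lambda>t. s n t - p t) \<in> L2_fun M G" if "n \<ge> N 0" for n
    unfolding L2_fun_def
    using eint[OF that] subspace_diff[OF subspace_G L2_D(1)[OF s] pG] pm L2_D(2)[OF s]
    by (auto simp: inner_diff_left intro!: borel_measurable_diff)
  \<comment> \<open>\<open>p\<close> is the difference of \<open>s (N 0)\<close> and
    \<open>s (N 0) - p\<close>, which are both in L^2.\<close>
  have p: "p \<in> L2_fun M G"
    using diff_in[OF s dL2[of "N 0"], of "N 0"] by simp
  have "(\<lambda>n. sqdist (s n) p) \<longlonglongrightarrow> 0"
  proof (rule LIMSEQ_I)
    fix e :: real assume e: "e > 0"
    then obtain n0 where n0: "\<And>m n. m \<ge> n0 \<Longrightarrow> n \<ge> n0 \<Longrightarrow> ?d m n < e/2"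
      using cauchy[of "e/2"] by auto
    have "norm (sqdist (s n) p - 0) < e" if "n \<ge> max n0 (N 0)" for n
    proof -
      have "ennreal (sqdist (s n) p) = (\<integral>\<^sup>+t. ennreal (?e n t) \<partial>M)"
        unfolding L2_inner_self using eint[of n] that by (simp add: nn_integral_eq_integral)
      also have "\<dots> \<le> ennreal (e/2)"
        by (rule fatou[of n0]) (use n0[of n] that less_imp_le in force)
      finally have "sqdist (s n) p \<le> e/2"
        using e by (simp add: ennreal_le_iff)
      moreover have "0 \<le> sqdist (s n) p"
        by (rule form_nonneg[OF diff_in[OF s p]])
      ultimately show ?thesis using e by simp
    qed
    then show "\<exists>no. \<forall>n\<ge>no. norm (sqdist (s n) p - 0) < e" by blast
  qed
  with that p r AEconv show ?thesis by blast
qed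

end

section \<open>Ramp functions\<close>

text \<open>Derivatives are one-sided at the ends of the interval and \<open>s\<close>,
  \<open>t\<close> come in either order. The bound on \<open>\<xi> - t\<close> is what lets the
  intermediate point converge to \<open>t\<close> as \<open>s\<close> does.\<close>

lemma mvt_within_interval:
  fixes f :: "real \<Rightarrow> real"
  assumes d: "\<And>x. x \<in> {a..b} \<Longrightarrow> (f has_real_derivative f' x) (at x within {a..b})"
    and st: "s \<in> {a..b}" "t \<in> {a..b}"
  obtains \<xi> where "\<xi> \<in> {a..b}" "\<bar>\<xi> - t\<bar> \<le> \<bar>s - t\<bar>" "f s - f t = f' \<xi> * (s - t)"
proof -
  have main: "\<exists>\<xi>\<in>{x..y}. f y - f x = f' \<xi> * (y - x)" if "x \<in> {a..b}" "y \<in> {a..b}" "x \<le> y" for x y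
  proof (rule mvt_very_simple)
    show "(f has_derivative (*) (f' z)) (at z within {x..y})" if "x \<le> z" "z \<le> y" for z
    proof -
      have "z \<in> {a..b}" "{x..y} \<subseteq> {a..b}" using \<open>x \<in> _\<close> \<open>y \<in> _\<close> that by auto
      then show ?thesis using d[of z] unfolding has_field_derivative_def
        by (meson has_derivative_subset)
    qed
  qed (use that in auto)
  show ?thesis
  proof (cases "t \<le> s")
    case True
    then obtain \<xi> where "\<xi> \<in> {t..s}" "f s - f t = f' \<xi> * (s - t)" using main[of t s] st by blast
    with that[of \<xi>] st show ?thesis by auto
  next
    case False
    then obtain \<xi> where "\<xi> \<in> {s..t}" "f t - f s = f' \<xi> * (t - s)" using main[of s t] st by auto
    with that[of \<xi>] st show ?thesis by (auto simp: algebra_simps)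
  qed
qed

lemma integrable_on_if_lebesgue_on:
  fixes f :: "real \<Rightarrow> real"
  assumes "integrable (lebesgue_on {a..b}) f"
  shows "f integrable_on {a..b}"
  using has_integral_integral_lebesgue_on[OF assms] by auto

definition ramp :: "real \<Rightarrow> real \<Rightarrow> real"
  where "ramp c s = max 0 (s - c)"

text \<open>The primitive of \<open>ramp c\<close> that vanishes up to \<open>c\<close>. As it
  depends on \<open>s - c\<close> only, its derivative in \<open>c\<close> is
  \<open>- ramp c s\<close>.\<close>

definition ramp2 :: "real \<Rightarrow> real \<Rightarrow> real"
  where "ramp2 c s = (ramp c s)\<^sup>2 / 2"

text \<open>Taylor's formula of first order in \<open>c\<close>: half the squared positive part has
  a derivative with Lipschitz constant 1. The remainder is uniform in \<open>s\<close>, which is the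
  point for differentiation under an integral.\<close>

lemma ramp2_remainder: "\<bar>ramp2 c' s - ramp2 c s + (c' - c) * ramp c s\<bar> \<le> (c' - c)\<^sup>2 / 2"
proof -
  define x where "x = s - c"
  define y where "y = s - c'"
  have xy: "c' - c = x - y" by (simp add: x_def y_def)
  have "0 \<le> (x - y)\<^sup>2" by simp
  have 1: "x \<ge> 0 \<Longrightarrow> y < 0 \<Longrightarrow> \<bar>- (x\<^sup>2 / 2) + (x - y) * x\<bar> \<le> (x - y)\<^sup>2 / 2"
  proof -
    assume a: "x \<ge> 0" "y < 0"
    have "x * y \<le> 0" using a by (simp add: mult_nonneg_nonpos)
    moreover have "- (x\<^sup>2 / 2) + (x - y) * x = x\<^sup>2 / 2 - x * y" by (simp add: power2_eq_square algebra_simps)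
    moreover have "\<bar>x\<^sup>2 / 2 - x * y\<bar> = x\<^sup>2 / 2 - x * y"
      using \<open>x * y \<le> 0\<close> zero_le_power2[of x] by (intro abs_of_nonneg) linarith
    ultimately show ?thesis using zero_le_power2[of y] unfolding power2_diff by (simp only:) simp
  qed
  have 2: "x < 0 \<Longrightarrow> y \<ge> 0 \<Longrightarrow> \<bar>y\<^sup>2 / 2\<bar> \<le> (x - y)\<^sup>2 / 2"
  proof -
    assume a: "x < 0" "y \<ge> 0"
    have "x * y \<le> 0" using a by (simp add: mult_nonpos_nonneg)
    then have "2 * x * y \<le> x\<^sup>2" using zero_le_power2[of x] by linarith
    then show ?thesis unfolding power2_diff by simp
  qed
  have 3: "\<bar>y\<^sup>2 / 2 - x\<^sup>2 / 2 + (x - y) * x\<bar> \<le> (x - y)\<^sup>2 / 2"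
  proof -
    have "y\<^sup>2 / 2 - x\<^sup>2 / 2 + (x - y) * x = (x - y)\<^sup>2 / 2"
      by (simp add: power2_eq_square field_simps)
    then show ?thesis by (simp only:) simp
  qed
  show ?thesis
    unfolding ramp2_def ramp_def xy x_def[symmetric] y_def[symmetric]
    using 1 2 3 by (cases "x \<ge> 0"; cases "y \<ge> 0") (auto simp: max_def)
qed

lemma power2_div_abs: "x\<^sup>2 / \<bar>x\<bar> = \<bar>x\<bar>" for x :: real
  by (cases "x = 0") (auto simp: power2_eq_square abs_if)

lemma has_derivative_ramp2: "(ramp2 c has_real_derivative ramp c s) (at s)"
proof -
  have "((\<lambda>t. (ramp2 c t - ramp2 c s) / (t - s)) \<longlongrightarrow> ramp c s) (at s)"
  proof (rule LIM_zero_cancel, rule Lim_null_comparison)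
    show "((\<lambda>t. \<bar>t - s\<bar> / 2) \<longlongrightarrow> 0) (at s)" by (auto intro!: tendsto_eq_intros)
    have "norm ((ramp2 c t - ramp2 c s) / (t - s) - ramp c s) \<le> \<bar>t - s\<bar> / 2" if "t \<noteq> s" for t
    proof -
      \<comment> \<open>Moving \<open>s\<close> to \<open>t\<close> is the same as shifting the
        corner by \<open>s - t\<close>, so the remainder in \<open>c\<close> also yields the
        derivative in \<open>s\<close>.\<close>
      have sh: "ramp2 c t = ramp2 (c + s - t) s" "ramp c s = ramp c s"
        by (simp_all add: ramp2_def ramp_def algebra_simps)
      have "\<bar>ramp2 c t - ramp2 c s - (t - s) * ramp c s\<bar> \<le> (t - s)\<^sup>2 / 2"
        using ramp2_remainder[of "c + s - t" s c] unfolding sh(1)[symmetric]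
        by (simp add: algebra_simps power2_commute)
      then have "\<bar>ramp2 c t - ramp2 c s - (t - s) * ramp c s\<bar> / \<bar>t - s\<bar> \<le> (t - s)\<^sup>2 / 2 / \<bar>t - s\<bar>"
        by (rule divide_right_mono) simp
      also have "(t - s)\<^sup>2 / 2 / \<bar>t - s\<bar> = \<bar>t - s\<bar> / 2"
        using power2_div_abs[of "t - s"] by simp
      also have "\<bar>ramp2 c t - ramp2 c s - (t - s) * ramp c s\<bar> / \<bar>t - s\<bar>
          = \<bar>(ramp2 c t - ramp2 c s) / (t - s) - ramp c s\<bar>"
        using that by (simp add: field_simps flip: abs_divide)
      finally show ?thesis by simp
    qed
    then show "\<forall>\<^sub>F t in at s. norm ((ramp2 c t - ramp2 c s) / (t - s) - ramp c s) \<le> \<bar>t - s\<bar> / 2"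
      by (auto simp: eventually_at_filter)
  qed
  then show ?thesis by (simp add: has_field_derivative_iff)
qed

lemma continuous_on_ramp: "continuous_on S (ramp c)" "continuous_on S (ramp2 c)"
  unfolding ramp_def[abs_def] ramp2_def[abs_def] by (intro continuous_intros; simp)+

lemma ramp_bounds:
  assumes "c \<in> {0..T}" "s \<in> {0..T}"
  shows "0 \<le> ramp c s" "ramp c s \<le> T" "0 \<le> ramp2 c s" "ramp2 c s \<le> T\<^sup>2"
proof -
  show 1: "0 \<le> ramp c s" "ramp c s \<le> T" using assms by (auto simp: ramp_def)
  have "(ramp c s)\<^sup>2 \<le> T\<^sup>2" by (rule power_mono) (use 1 in auto)
  then show "0 \<le> ramp2 c s" "ramp2 c s \<le> T\<^sup>2"
    using zero_le_power2[of T] zero_le_power2[of "ramp c s"] unfolding ramp2_def by linarith+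
qed

lemma ramp2_lipschitz:
  assumes "c \<in> {0..T}" "c' \<in> {0..T}" "s \<in> {0..T}"
  shows "\<bar>ramp2 c' s - ramp2 c s\<bar> \<le> T * \<bar>c' - c\<bar>"
proof -
  have "ramp2 c' s - ramp2 c s = (ramp c' s - ramp c s) * ((ramp c' s + ramp c s) / 2)"
    by (simp add: ramp2_def power2_eq_square algebra_simps)
  also have "\<bar>\<dots>\<bar> \<le> \<bar>c' - c\<bar> * T"
    unfolding abs_mult
  proof (rule mult_mono)
    show "\<bar>ramp c' s - ramp c s\<bar> \<le> \<bar>c' - c\<bar>" by (auto simp: ramp_def)
    show "\<bar>(ramp c' s + ramp c s) / 2\<bar> \<le> T" 
      using ramp_bounds(1,2)[OF assms(1,3)] ramp_bounds(1,2)[OF assms(2,3)] by auto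
  qed auto
  finally show ?thesis by (simp add: mult.commute)
qed

section \<open>Integration against ramps and functions that vanish almost everywhere\<close>

lemma integrable_continuous_mult:
  fixes f g :: "real \<Rightarrow> real"
  assumes f: "continuous_on {a..b} f" and g: "integrable (lebesgue_on {a..b}) g"
  shows "integrable (lebesgue_on {a..b}) (\<lambda>s. f s * g s)"
proof -
  obtain K where K: "\<And>s. s \<in> {a..b} \<Longrightarrow> norm (f s) \<le> K"
    using compact_imp_bounded[OF compact_continuous_image[OF f compact_Icc]]
    unfolding bounded_iff by (metis imageI)
  show ?thesis
  proof (rule Bochner_Integration.integrable_bound)
    show "integrable (lebesgue_on {a..b}) (\<lambda>s. K * norm (g s))"
      by (intro integrable_mult_right integrable_norm g)
    show "(\<lambda>s. f s * g s) \<in> borel_measurable (lebesgue_on {a..b})"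
      using continuous_imp_measurable_on_sets_lebesgue[OF f] borel_measurable_integrable[OF g]
      by (intro borel_measurable_times) auto
    show "AE s in lebesgue_on {a..b}. norm (f s * g s) \<le> norm (K * norm (g s))"
    proof (rule AE_I2)
      fix s assume "s \<in> space (lebesgue_on {a..b})"
      then have "norm (f s) \<le> K" using K by simp
      then have "norm (f s) * norm (g s) \<le> K * norm (g s)" by (rule mult_right_mono) simp
      then show "norm (f s * g s) \<le> norm (K * norm (g s))"
        by (metis norm_mult real_norm_def abs_ge_self order_trans)
    qed
  qed
qed

text \<open>The difference quotient deviates by at most \<open>\<bar>c' - c\<bar> / 2\<close> times
  the L^1 norm of \<open>\<gamma>\<close>, so integrability of \<open>\<gamma>\<close>
  suffices.\<close>

lemma has_derivative_integral_ramp2: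
  fixes \<gamma> :: "real \<Rightarrow> real"
  assumes g: "integrable (lebesgue_on {0..T}) \<gamma>"
  shows "((\<lambda>c. \<integral>s. ramp2 c s * \<gamma> s \<partial>lebesgue_on {0..T})
    has_real_derivative - (\<integral>s. ramp c s * \<gamma> s \<partial>lebesgue_on {0..T})) (at c)"
proof -
  let ?M = "lebesgue_on {0..T}"
  let ?F = "\<lambda>c. \<integral>s. ramp2 c s * \<gamma> s \<partial>?M"
  let ?G = "\<integral>s. ramp c s * \<gamma> s \<partial>?M"
  let ?N = "\<integral>s. \<bar>\<gamma> s\<bar> \<partial>?M"
  have i2: "integrable ?M (\<lambda>s. ramp2 c s * \<gamma> s)" and i1: "integrable ?M (\<lambda>s. ramp c s * \<gamma> s)" for c
    by (intro integrable_continuous_mult continuous_on_ramp g)+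
  have "((\<lambda>c'. (?F c' - ?F c) / (c' - c)) \<longlongrightarrow> - ?G) (at c)"
  proof (rule LIM_zero_cancel, rule Lim_null_comparison)
    show "((\<lambda>c'. \<bar>c' - c\<bar> / 2 * ?N) \<longlongrightarrow> 0) (at c)" by (auto intro!: tendsto_eq_intros)
    have "norm ((?F c' - ?F c) / (c' - c) - - ?G) \<le> \<bar>c' - c\<bar> / 2 * ?N" if ne: "c' \<noteq> c" for c'
    proof -
      have "?F c' - ?F c + (c' - c) * ?G = (\<integral>s. (ramp2 c' s - ramp2 c s + (c' - c) * ramp c s) * \<gamma> s \<partial>?M)"
        using i2 i1 by (simp add: algebra_simps)
      also have "\<bar>\<dots>\<bar> \<le> (\<integral>s. (c' - c)\<^sup>2 / 2 * \<bar>\<gamma> s\<bar> \<partial>?M)"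
      proof (rule integral_abs_bound_integral)
        show "integrable ?M (\<lambda>s. (ramp2 c' s - ramp2 c s + (c' - c) * ramp c s) * \<gamma> s)"
          by (intro integrable_continuous_mult continuous_intros continuous_on_ramp g)
        show "integrable ?M (\<lambda>s. (c' - c)\<^sup>2 / 2 * \<bar>\<gamma> s\<bar>)" using g by simp
        show "\<bar>(ramp2 c' s - ramp2 c s + (c' - c) * ramp c s) * \<gamma> s\<bar> \<le> (c' - c)\<^sup>2 / 2 * \<bar>\<gamma> s\<bar>" for s
          unfolding abs_mult by (rule mult_right_mono[OF ramp2_remainder]) simp
      qed
      finally have le: "\<bar>?F c' - ?F c + (c' - c) * ?G\<bar> \<le> (c' - c)\<^sup>2 / 2 * ?N" using g by simp
      have "norm ((?F c' - ?F c) / (c' - c) - - ?G) = \<bar>?F c' - ?F c + (c' - c) * ?G\<bar> / \<bar>c' - c\<bar>"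
        using ne by (simp add: field_simps flip: abs_divide)
      also have "\<dots> \<le> (c' - c)\<^sup>2 / 2 * ?N / \<bar>c' - c\<bar>" by (rule divide_right_mono[OF le]) simp
      also have "\<dots> = \<bar>c' - c\<bar> / 2 * ?N"
        using power2_div_abs[of "c' - c"] by (metis times_divide_eq_left divide_divide_eq_left mult.commute)
      finally show ?thesis .
    qed
    then show "\<forall>\<^sub>F c' in at c. norm ((?F c' - ?F c) / (c' - c) - - ?G) \<le> \<bar>c' - c\<bar> / 2 * ?N"
      by (auto simp: eventually_at_filter)
  qed
  then show ?thesis by (simp add: has_field_derivative_iff)
qed

text \<open>Differences of tails are the integrals over small intervals to the right of
  \<open>x\<close>. They vanish, and by Lebesgue's differentiation theorem their means converge to
  \<open>\<gamma> x\<close> outside a null set.\<close>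

lemma AE_zero_if_tail_integrals_zero:
  fixes \<gamma> :: "real \<Rightarrow> real"
  assumes g: "integrable (lebesgue_on {0..T}) \<gamma>"
    and z: "\<And>c. c \<in> {0<..<T} \<Longrightarrow> integral {c..T} \<gamma> = 0"
  shows "AE s in lebesgue_on {0..T}. \<gamma> s = 0"
proof -
  let ?f = "\<lambda>s. if s \<in> {0..T} then \<gamma> s else 0"
  have gi: "\<gamma> integrable_on {0..T}" by (rule integrable_on_if_lebesgue_on[OF g])
  have "?f integrable_on UNIV" using gi by (simp only: integrable_restrict_UNIV)
  then have fi: "?f integrable_on cbox a b" for a b
    using integrable_on_subcbox[of ?f UNIV a b] by auto
  obtain N where N: "negligible N"
    "\<And>x e. \<lbrakk>x \<notin> N; 0 < e\<rbrakk> \<Longrightarrow> \<exists>d>0. \<forall>h. 0 < h \<and> h < d \<longrightarrow>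
       norm (integral (cbox x (x + h *\<^sub>R One)) ?f /\<^sub>R h ^ DIM(real) - ?f x) < e"
    by (rule integrable_ccontinuous_explicit[OF fi]) (rule that)
  have zero: "\<gamma> x = 0" if x: "x \<in> {0<..<T}" "x \<notin> N" for x
  proof (rule ccontr)
    assume "\<gamma> x \<noteq> 0"
    then have "\<bar>\<gamma> x\<bar> > 0" by simp
    from N(2)[OF x(2) this] obtain d where d: "d > 0"
      "\<And>h. 0 < h \<Longrightarrow> h < d \<Longrightarrow> norm (integral (cbox x (x + h *\<^sub>R One)) ?f /\<^sub>R h ^ DIM(real) - ?f x) < \<bar>\<gamma> x\<bar>"
      by blast
    define h where "h = min (d/2) ((T - x)/2)"
    have h: "0 < h" "h < d" "x + h \<in> {0<..<T}" using d(1) x(1) by (auto simp: h_def min_def field_simps)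
    have "integral {x..x+h} ?f = integral {x..x+h} \<gamma>"
      by (rule integral_cong) (use x h in auto)
    also have "\<dots> + integral {x+h..T} \<gamma> = integral {x..T} \<gamma>"
      by (rule Henstock_Kurzweil_Integration.integral_combine)
         (use x h in \<open>auto intro: integrable_subinterval_real[OF gi]\<close>)
    then have "integral {x..x+h} \<gamma> = 0" using z[OF x(1)] z[OF h(3)] by simp
    finally have "integral {x..x+h} ?f = 0" .
    then show False using d(2)[OF h(1,2)] x(1) by simp
  qed
  have neg: "negligible (N \<union> {0, T})" using N(1) by (simp add: negligible_Un)
  have "AE s in lebesgue_on {0..T}. s \<notin> N \<union> {0, T}"
  proof -
    have "AE s in lebesgue. s \<notin> N \<union> {0, T}"
      using neg by (intro AE_not_in) (simp add: negligible_iff_null_sets)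
    then have "AE s in lebesgue. s \<in> {0..T} \<longrightarrow> s \<notin> N \<union> {0, T}"
      by (rule AE_mp) auto
    then show ?thesis by (subst AE_restrict_space_iff) auto
  qed
  then show ?thesis by (rule AE_mp) (use zero in auto)
qed

text \<open>Differentiating in \<open>c\<close> twice strips the weight from \<open>ramp2\<close> to
  \<open>ramp\<close> and then to the indicator of the tail. The second derivative is taken by
  dominated convergence along a sequence, since \<open>ramp\<close> has a corner.\<close>

lemma AE_zero_if_ramp2_integrals_zero:
  fixes \<gamma> :: "real \<Rightarrow> real"
  assumes g: "integrable (lebesgue_on {0..T}) \<gamma>"
    and z: "\<And>c. c \<in> {0..T} \<Longrightarrow> (\<integral>s. ramp2 c s * \<gamma> s \<partial>lebesgue_on {0..T}) = 0"
  shows "AE s in lebesgue_on {0..T}. \<gamma> s = 0"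
proof (rule AE_zero_if_tail_integrals_zero[OF g])
  let ?M = "lebesgue_on {0..T}"
  have z1: "(\<integral>s. ramp c s * \<gamma> s \<partial>?M) = 0" if c: "c \<in> {0<..<T}" for c
  proof -
    have "((\<lambda>c. 0) has_real_derivative - (\<integral>s. ramp c s * \<gamma> s \<partial>?M)) (at c)"
    proof (rule has_field_derivative_transform_within_open[OF has_derivative_integral_ramp2[OF g]])
      show "open {0<..<T}" by simp
    qed (use c z in auto)
    then have "- (\<integral>s. ramp c s * \<gamma> s \<partial>?M) = 0" using DERIV_unique DERIV_const by blast
    then show ?thesis by simp
  qed
  fix c assume c: "c \<in> {0<..<T}"
  \<comment> \<open>The factor \<open>c / 2\<close> keeps \<open>c - \<delta> n\<close> inside the
    open interval, where \<open>z1\<close> is available.\<close>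
  define \<delta> where "\<delta> n = c / 2 * (1 / real (Suc n))" for n
  have \<delta>: "\<delta> n > 0" "c - \<delta> n \<in> {0<..<T}" for n
  proof -
    have u: "0 < 1 / real (Suc n)" "1 / real (Suc n) \<le> 1" by simp_all
    have c0: "0 < c / 2" using c by simp
    have "0 < \<delta> n" unfolding \<delta>_def by (rule mult_pos_pos[OF c0 u(1)])
    moreover have "\<delta> n \<le> c / 2 * 1"
      unfolding \<delta>_def by (rule mult_left_mono[OF u(2)]) (use c0 in simp)
    ultimately have "0 < \<delta> n" "\<delta> n \<le> c / 2 * 1" .
    then show "\<delta> n > 0" "c - \<delta> n \<in> {0<..<T}" using c by auto
  qed
  have "\<delta> \<longlonglongrightarrow> c / 2 * 0"
    unfolding \<delta>_def by (intro tendsto_mult tendsto_const LIMSEQ_Suc[OF lim_1_over_n])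
  then have \<delta>0: "\<delta> \<longlonglongrightarrow> 0" by simp
  \<comment> \<open>Difference quotients from the left: they equal 1 exactly on the closed tail
    \<open>s \<ge> c\<close>, including \<open>s = c\<close>, and are bounded by 1
    everywhere.\<close>
  let ?w = "\<lambda>n s. (ramp (c - \<delta> n) s - ramp c s) / \<delta> n"
  have w_int: "(\<integral>s. ?w n s * \<gamma> s \<partial>?M) = 0" for n
  proof -
    have "(\<integral>s. ?w n s * \<gamma> s \<partial>?M)
        = ((\<integral>s. ramp (c - \<delta> n) s * \<gamma> s \<partial>?M) - (\<integral>s. ramp c s * \<gamma> s \<partial>?M)) / \<delta> n"
      by (subst Bochner_Integration.integral_diff[symmetric])
         (auto intro!: integrable_continuous_mult continuous_on_ramp g simp: left_diff_distrib
            simp flip: integral_divide_zero)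
    then show ?thesis using z1[OF \<delta>(2)] z1[OF c] by simp
  qed
  have w_lim: "(\<lambda>n. ?w n s) \<longlonglongrightarrow> (if s \<in> {c..T} then 1 else 0)" if "s \<in> {0..T}" for s
  proof (cases "c \<le> s")
    case True
    then have "?w n s = 1" for n using \<delta>(1)[of n] by (simp add: ramp_def)
    then show ?thesis using True that by simp
  next
    case False
    then have "\<forall>\<^sub>F n in sequentially. \<delta> n < c - s" using \<delta>0 by (intro order_tendstoD(2)) auto
    then have "\<forall>\<^sub>F n in sequentially. ?w n s = 0"
      by eventually_elim (use False in \<open>simp add: ramp_def\<close>)
    then show ?thesis using False by (simp add: tendsto_eventually)
  qed
  have w_le: "\<bar>?w n s\<bar> \<le> 1" for n s
    using \<delta>(1)[of n] by (auto simp: ramp_def field_simps max_def)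
  have "(\<lambda>n. \<integral>s. ?w n s * \<gamma> s \<partial>?M) \<longlonglongrightarrow> (\<integral>s. (if s \<in> {c..T} then 1 else 0) * \<gamma> s \<partial>?M)"
  proof (rule integral_dominated_convergence[where w = "\<lambda>s. \<bar>\<gamma> s\<bar>"])
    show "(\<lambda>s. (if s \<in> {c..T} then 1 else 0) * \<gamma> s) \<in> borel_measurable ?M"
      using borel_measurable_integrable[OF g]
      by (intro borel_measurable_times measurable_If) (auto simp: sets_restrict_space)
    show "(\<lambda>s. ?w n s * \<gamma> s) \<in> borel_measurable ?M" for n
      by (intro borel_measurable_integrable integrable_continuous_mult g continuous_intros continuous_on_ramp)
         (use \<delta>(1)[of n] in auto)
    show "AE s in ?M. (\<lambda>n. ?w n s * \<gamma> s) \<longlonglongrightarrow> (if s \<in> {c..T} then 1 else 0) * \<gamma> s"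
      by (intro AE_I2 tendsto_mult_right w_lim) simp
    show "AE s in ?M. norm (?w n s * \<gamma> s) \<le> \<bar>\<gamma> s\<bar>" for n
      unfolding norm_mult real_norm_def using mult_right_mono[OF w_le abs_ge_zero, of _ _ "\<gamma> _"]
      by (intro AE_I2) (simp add: abs_mult)
  qed (use g in simp)
  then have 0: "(\<integral>s. (if s \<in> {c..T} then 1 else 0) * \<gamma> s \<partial>?M) = 0"
    unfolding w_int by (simp add: LIMSEQ_const_iff)
  have "integral {c..T} \<gamma> = integral ({c..T} \<inter> {0..T}) \<gamma>"
    using c by (simp add: Int_absorb2)
  also have "\<dots> = integral {0..T} (\<lambda>s. if s \<in> {c..T} then \<gamma> s else 0)"
    by (rule integral_restrict_Int[symmetric])
  also have "(\<lambda>s. if s \<in> {c..T} then \<gamma> s else 0) = (\<lambda>s. (if s \<in> {c..T} then 1 else 0) * \<gamma> s)" by auto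
  also have "integral {0..T} \<dots> = (\<integral>s. (if s \<in> {c..T} then 1 else 0) * \<gamma> s \<partial>?M)"
  proof (rule lebesgue_integral_eq_integral[symmetric])
    show "integrable ?M (\<lambda>s. (if s \<in> {c..T} then 1 else 0) * \<gamma> s)"
    proof (rule Bochner_Integration.integrable_bound[OF g])
      show "(\<lambda>s. (if s \<in> {c..T} then 1 else 0) * \<gamma> s) \<in> borel_measurable ?M"
        using borel_measurable_integrable[OF g]
        by (intro borel_measurable_times measurable_If) (auto simp: sets_restrict_space)
    qed auto
  qed simp
  finally show "integral {c..T} \<gamma> = 0" using 0 by simp
qed

section \<open>Abstract parabolic problems\<close>

text \<open>\<open>G\<close> stands for Y with its graph norm and \<open>J\<close> for the embedding
  into H. The operators map the whole type into \<open>G\<close>, as they end with the projection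
  onto \<open>G\<close>. The adjoint \<open>A'\<close> allows \<open>A\<close> to be moved onto a
  fixed test element before a limit or an integral is taken. In \<open>garding\<close> the shift
  \<open>\<mu>\<close> replaces the missing coercivity.\<close>

locale parabolic = L2_setting "lebesgue_on {0..T}" G
  for T :: real and G :: "'e::{real_inner, complete_space} set" +
  fixes J :: "'e \<Rightarrow> 'f::{real_inner, complete_space}"
    and R A A' :: "'e \<Rightarrow> 'e"
    and \<alpha> \<mu> :: real
  assumes T_pos: "0 < T"
    and J: "bounded_linear J" and R: "bounded_linear R"
    and A: "bounded_linear A" and A': "bounded_linear A'"
    and R_in: "R x \<in> G" and A_in: "A x \<in> G" and A'_in: "A' x \<in> G"
    and R_inner: "x \<in> G \<Longrightarrow> y \<in> G \<Longrightarrow> R x \<bullet> y = J x \<bullet> J y"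
    and A_adjoint: "x \<in> G \<Longrightarrow> y \<in> G \<Longrightarrow> A x \<bullet> y = x \<bullet> A' y"
    and J_inj: "x \<in> G \<Longrightarrow> J x = 0 \<Longrightarrow> x = 0"
    and \<alpha>_pos: "0 < \<alpha>" and \<mu>_nonneg: "0 \<le> \<mu>"
    and garding: "x \<in> G \<Longrightarrow> \<alpha> * (norm x)\<^sup>2 \<le> A x \<bullet> x + \<mu> * (norm (J x))\<^sup>2"
begin

abbreviation "M \<equiv> lebesgue_on {0..T}"

interpretation J: bounded_linear J by (rule J)
interpretation R: bounded_linear R by (rule R)
interpretation A: bounded_linear A by (rule A)
interpretation A': bounded_linear A' by (rule A')

lemmas G_simps = subspace_add[OF subspace_G] subspace_diff[OF subspace_G]
  subspace_scale[OF subspace_G] subspace_0[OF subspace_G]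

lemma R_inner': "x \<in> G \<Longrightarrow> y \<in> G \<Longrightarrow> x \<bullet> R y = J x \<bullet> J y"
  using R_inner[of y x] by (simp add: inner_commute)

text \<open>
  Since \<open>R\<close> is symmetric, \<open>\<langle>R p, p\<rangle>\<close> is differentiable although \<open>p\<close> is only continuous: its increment
  is \<open>\<langle>p s - p t, R (p s + p t)\<rangle>\<close>, to which the mean value theorem applies.
\<close>

lemma weak_ode_zero:
  assumes pG: "\<And>t. t \<in> {0..T} \<Longrightarrow> p t \<in> G"
    and cont: "continuous_on {0..T} p"
    and C: "bounded_linear C"
    and deriv: "\<And>v t. v \<in> G \<Longrightarrow> t \<in> {0..T} \<Longrightarrow>
      ((\<lambda>t. p t \<bullet> R v) has_real_derivative p t \<bullet> C v) (at t within {0..T})"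
    and C_le: "\<And>x. x \<in> G \<Longrightarrow> x \<bullet> C x \<le> \<mu> * (norm (J x))\<^sup>2"
    and p0: "p 0 = 0"
    and t: "t \<in> {0..T}"
  shows "p t = 0"
proof -
  interpret C: bounded_linear C by (rule C)
  define q where "q s = (norm (J (p s)))\<^sup>2" for s
  have q': "(q has_real_derivative 2 * (p t \<bullet> C (p t))) (at t within {0..T})" if t: "t \<in> {0..T}" for t
  proof -
    have "\<exists>\<xi>. \<xi> \<in> {0..T} \<and> \<bar>\<xi> - t\<bar> \<le> \<bar>s - t\<bar> \<and> q s - q t = (p \<xi> \<bullet> C (p s + p t)) * (s - t)"
      if s: "s \<in> {0..T}" for s
    proof -
      define v where "v = p s + p t"
      have v: "v \<in> G" using pG s t by (simp add: v_def G_simps)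
      obtain \<xi> where \<xi>: "\<xi> \<in> {0..T}" "\<bar>\<xi> - t\<bar> \<le> \<bar>s - t\<bar>"
        "p s \<bullet> R v - p t \<bullet> R v = (p \<xi> \<bullet> C v) * (s - t)"
        by (rule mvt_within_interval[OF deriv[OF v] s t])
      have "p s \<bullet> R v - p t \<bullet> R v = q s - q t"
        using pG s t v
        by (simp add: R_inner' v_def J.add q_def power2_norm_eq_inner inner_add_right inner_commute)
      with \<xi> show ?thesis by (auto simp: v_def)
    qed
    then obtain \<xi> where \<xi>: "\<And>s. s \<in> {0..T} \<Longrightarrow> \<xi> s \<in> {0..T}"
      "\<And>s. s \<in> {0..T} \<Longrightarrow> \<bar>\<xi> s - t\<bar> \<le> \<bar>s - t\<bar>"
      "\<And>s. s \<in> {0..T} \<Longrightarrow> q s - q t = (p (\<xi> s) \<bullet> C (p s + p t)) * (s - t)"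
      by metis
    have ev: "\<forall>\<^sub>F s in at t within {0..T}. s \<in> {0..T}" by (simp add: eventually_at_filter)
    have "(\<xi> \<longlongrightarrow> t) (at t within {0..T})"
    proof (rule LIM_zero_cancel, rule Lim_null_comparison)
      show "\<forall>\<^sub>F s in at t within {0..T}. norm (\<xi> s - t) \<le> \<bar>s - t\<bar>"
        using ev by eventually_elim (simp add: \<xi>)
      show "((\<lambda>s. \<bar>s - t\<bar>) \<longlongrightarrow> 0) (at t within {0..T})"
        by (auto intro!: tendsto_eq_intros)
    qed
    then have "((\<lambda>s. p (\<xi> s)) \<longlongrightarrow> p t) (at t within {0..T})"
      by (rule continuous_on_tendsto_compose[OF cont _ t]) (use ev in eventually_elim, rule \<xi>(1))
    moreover have "(p \<longlongrightarrow> p t) (at t within {0..T})"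
      using cont t by (simp add: continuous_on_def)
    ultimately have "((\<lambda>s. p (\<xi> s) \<bullet> C (p s + p t)) \<longlongrightarrow> p t \<bullet> C (p t + p t)) (at t within {0..T})"
      by (intro tendsto_intros C.tendsto)
    moreover have "\<forall>\<^sub>F s in at t within {0..T}. p (\<xi> s) \<bullet> C (p s + p t) = (q s - q t) / (s - t)"
      using ev by (simp add: eventually_at_filter \<xi>)
    ultimately have "((\<lambda>s. (q s - q t) / (s - t)) \<longlongrightarrow> p t \<bullet> C (p t + p t)) (at t within {0..T})"
      by (rule Lim_transform_eventually)
    then show ?thesis by (simp add: has_field_derivative_iff C.add inner_add_right)
  qed
  \<comment> \<open>Gronwall: the factor absorbs the growth rate \<open>2 * \<mu>\<close> permitted
    by \<open>C_le\<close>, so \<open>w\<close> has nonpositive derivative and starts at 0.\<close>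
  define w where "w s = exp (- (2 * \<mu> * s)) * q s" for s
  have w': "(w has_real_derivative exp (- (2 * \<mu> * s)) * (2 * (p s \<bullet> C (p s)) - 2 * \<mu> * q s))
      (at s within {0..T})" if "s \<in> {0..T}" for s
    unfolding w_def[abs_def]
    by (rule derivative_eq_intros q'[OF that] refl)+ (simp add: algebra_simps)
  obtain \<xi> where \<xi>: "\<xi> \<in> {0..T}"
    "w t - w 0 = exp (- (2 * \<mu> * \<xi>)) * (2 * (p \<xi> \<bullet> C (p \<xi>)) - 2 * \<mu> * q \<xi>) * (t - 0)"
    using mvt_within_interval[OF w' t, of 0] T_pos by auto
  have "2 * (p \<xi> \<bullet> C (p \<xi>)) - 2 * \<mu> * q \<xi> \<le> 0"
    using C_le[OF pG[OF \<xi>(1)]] by (simp add: q_def)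
  then have "exp (- (2 * \<mu> * \<xi>)) * (2 * (p \<xi> \<bullet> C (p \<xi>)) - 2 * \<mu> * q \<xi>) * (t - 0) \<le> 0"
    using t by (intro mult_nonpos_nonneg mult_nonneg_nonpos) auto
  moreover have "w 0 = 0" by (simp add: w_def q_def p0 J.zero)
  ultimately have "exp (- (2 * \<mu> * t)) * q t \<le> 0" using \<xi>(2) by (simp add: w_def)
  then have "q t \<le> 0" by (simp add: mult_le_0_iff)
  then have "J (p t) = 0" by (simp add: q_def)
  then show ?thesis using J_inj pG t by blast
qed

section \<open>Functions of class C^1 with values in \<open>G\<close> and the energy
  estimate\<close>

lemma continuous_L2:
  assumes cont: "continuous_on {0..T} x" and G: "\<And>t. t \<in> {0..T} \<Longrightarrow> x t \<in> G"
  shows "x \<in> L2_fun M G"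
  unfolding L2_fun_def
proof (intro CollectI conjI ballI)
  show "(\<lambda>t. x t \<bullet> v) \<in> borel_measurable M" for v
    by (intro continuous_imp_measurable_on_sets_lebesgue continuous_intros cont) simp
  show "integrable M (\<lambda>t. (norm (x t))\<^sup>2)"
    by (intro continuous_imp_integrable_real continuous_intros cont)
qed (use G in simp)

lemma continuous_L2_inner:
  assumes "continuous_on {0..T} x"
  shows "L2_inner M x x = integral {0..T} (\<lambda>t. (norm (x t))\<^sup>2)"
  unfolding L2_inner_self
  by (intro lebesgue_integral_eq_integral continuous_imp_integrable_real continuous_intros assms) simp

definition C1_pair :: "(real \<Rightarrow> 'e) \<Rightarrow> (real \<Rightarrow> 'e) \<Rightarrow> bool"
  where "C1_pair u u' \<longleftrightarrow> continuous_on {0..T} u' \<and>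
    (\<forall>t\<in>{0..T}. u t \<in> G \<and> u' t \<in> G \<and> (u has_vector_derivative u' t) (at t within {0..T}))"

definition heat_op :: "(real \<Rightarrow> 'e) \<Rightarrow> (real \<Rightarrow> 'e) \<Rightarrow> real \<Rightarrow> 'e"
  where "heat_op u u' t = R (u' t) + A (u t)"

lemma C1_pair_continuous: "C1_pair u u' \<Longrightarrow> continuous_on {0..T} u"
  unfolding C1_pair_def using continuous_on_vector_derivative by blast

lemma C1_pair_lin:
  assumes "C1_pair u u'" "C1_pair v v'"
  shows "C1_pair (\<lambda>t. u t + c *\<^sub>R v t) (\<lambda>t. u' t + c *\<^sub>R v' t)"
  using assms unfolding C1_pair_def
  by (auto intro!: continuous_intros G_simps derivative_eq_intros)

lemma C1_pair_const: "v \<in> G \<Longrightarrow> C1_pair (\<lambda>_. v) (\<lambda>_. 0)"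
  unfolding C1_pair_def by (auto simp: G_simps intro!: derivative_eq_intros)

lemma heat_op_lin:
  "heat_op (\<lambda>t. u t + c *\<^sub>R v t) (\<lambda>t. u' t + c *\<^sub>R v' t) = (\<lambda>t. heat_op u u' t + c *\<^sub>R heat_op v v' t)"
  by (rule ext) (simp add: heat_op_def R.add A.add R.scaleR A.scaleR algebra_simps)

lemma heat_op_continuous: "C1_pair u u' \<Longrightarrow> continuous_on {0..T} (heat_op u u')"
  unfolding heat_op_def[abs_def] using C1_pair_continuous[of u u']
  by (intro continuous_intros R.continuous_on A.continuous_on) (auto simp: C1_pair_def)

lemma heat_op_L2: "C1_pair u u' \<Longrightarrow> heat_op u u' \<in> L2_fun M G"
  by (intro continuous_L2 heat_op_continuous) (auto simp: heat_op_def R_in A_in G_simps)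

lemma C1_pair_L2: "C1_pair u u' \<Longrightarrow> u \<in> L2_fun M G"
  by (intro continuous_L2 C1_pair_continuous) (auto simp: C1_pair_def)

text \<open>Pair the equation with \<open>u\<close> and weight by
  \<open>exp (- (2 * \<mu> * t))\<close>. Garding's inequality supplies \<open>2 * \<alpha>\<close>
  times the squared norm of \<open>u\<close>; Young's inequality for the right-hand side consumes
  half of it, and the other half gives the L^2 bound.\<close>

lemma energy:
  assumes u: "C1_pair u u'"
  defines "E \<equiv> exp (2 * \<mu> * T) * ((norm (J (u 0)))\<^sup>2 + L2_inner M (heat_op u u') (heat_op u u') / \<alpha>)"
  shows "t \<in> {0..T} \<Longrightarrow> (norm (J (u t)))\<^sup>2 \<le> E" and "\<alpha> * L2_inner M u u \<le> E"
proof -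
  let ?F = "heat_op u u'"
  define S where "S t = exp (- (2 * \<mu> * t)) * (J (u t) \<bullet> J (u t))" for t
  define S' where "S' t = exp (- (2 * \<mu> * t)) * (2 * (J (u t) \<bullet> J (u' t)) - 2 * \<mu> * (J (u t) \<bullet> J (u t)))" for t
  \<comment> \<open>The least value of the weight on the interval; multiplying by its inverse
    \<open>exp (2 * \<mu> * T)\<close> at the end produces the constant in \<open>E\<close>.\<close>
  define \<kappa> where "\<kappa> = exp (- (2 * \<mu> * T))"
  have uG: "u t \<in> G" "u' t \<in> G" "(u has_vector_derivative u' t) (at t within {0..T})"
    if "t \<in> {0..T}" for t
    using u that by (auto simp: C1_pair_def)
  have cu: "continuous_on {0..T} u" by (rule C1_pair_continuous[OF u])
  have cu': "continuous_on {0..T} u'" using u by (simp add: C1_pair_def)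
  have cF: "continuous_on {0..T} ?F" by (rule heat_op_continuous[OF u])
  have deriv: "(S has_vector_derivative S' t) (at t within {0..T})" if t: "t \<in> {0..T}" for t
  proof -
    have d: "((\<lambda>t. J (u t)) has_vector_derivative J (u' t)) (at t within {0..T})"
      by (rule J.has_vector_derivative[OF uG(3)[OF t]])
    have "((\<lambda>t. J (u t) \<bullet> J (u t)) has_vector_derivative J (u t) \<bullet> J (u' t) + J (u' t) \<bullet> J (u t))
        (at t within {0..T})"
      by (rule bounded_bilinear.has_vector_derivative[OF bounded_bilinear_inner d d])
    then have d2: "((\<lambda>t. J (u t) \<bullet> J (u t)) has_real_derivative 2 * (J (u t) \<bullet> J (u' t)))
        (at t within {0..T})"
      by (simp add: has_real_derivative_iff_has_vector_derivative inner_commute)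
    have "(S has_real_derivative S' t) (at t within {0..T})"
      unfolding S_def[abs_def] S'_def
      by (rule derivative_eq_intros d2 refl)+ (simp add: algebra_simps)
    then show ?thesis by (simp add: has_real_derivative_iff_has_vector_derivative)
  qed
  have le: "S' t \<le> (norm (?F t))\<^sup>2 / \<alpha> - \<alpha> * \<kappa> * (norm (u t))\<^sup>2" if t: "t \<in> {0..T}" for t
  proof -
    define e where "e = exp (- (2 * \<mu> * t))"
    have e: "0 \<le> e" "e \<le> 1" "\<kappa> \<le> e"
      using t \<mu>_nonneg by (auto simp: e_def \<kappa>_def mult_left_mono)
    have 1: "J (u t) \<bullet> J (u' t) = ?F t \<bullet> u t - A (u t) \<bullet> u t"
      using uG[OF t] by (simp add: heat_op_def inner_add_left R_inner inner_commute[of "J (u t)"])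
    have 2: "J (u t) \<bullet> J (u t) = (norm (J (u t)))\<^sup>2" by (simp add: power2_norm_eq_inner)
    \<comment> \<open>Young's inequality with weight \<open>\<alpha>\<close>, so that exactly half
      of the coercive term is spent.\<close>
    have 3: "2 * (?F t \<bullet> u t) \<le> (norm (?F t))\<^sup>2 / \<alpha> + \<alpha> * (norm (u t))\<^sup>2"
    proof -
      have "0 \<le> (norm (?F t) - \<alpha> * norm (u t))\<^sup>2 / \<alpha>" using \<alpha>_pos by simp
      also have "\<dots> = (norm (?F t))\<^sup>2 / \<alpha> + \<alpha> * (norm (u t))\<^sup>2 - 2 * (norm (?F t) * norm (u t))"
        using \<alpha>_pos by (simp add: power2_diff field_simps power2_eq_square)
      finally show ?thesis using norm_cauchy_schwarz[of "?F t" "u t"] by linarith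
    qed
    have "2 * (J (u t) \<bullet> J (u' t)) - 2 * \<mu> * (J (u t) \<bullet> J (u t))
        \<le> (norm (?F t))\<^sup>2 / \<alpha> - \<alpha> * (norm (u t))\<^sup>2"
      using garding[OF uG(1)[OF t]] 3 unfolding 1 2 by (simp only: mult.assoc) argo
    then have "S' t \<le> e * ((norm (?F t))\<^sup>2 / \<alpha> - \<alpha> * (norm (u t))\<^sup>2)"
      unfolding S'_def e_def[symmetric] using e(1) by (rule mult_left_mono)
    also have "\<dots> = e * ((norm (?F t))\<^sup>2 / \<alpha>) - e * (\<alpha> * (norm (u t))\<^sup>2)" by (rule right_diff_distrib)
    also have "\<dots> \<le> 1 * ((norm (?F t))\<^sup>2 / \<alpha>) - \<kappa> * (\<alpha> * (norm (u t))\<^sup>2)"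
      using e \<alpha>_pos by (intro diff_mono mult_right_mono) auto
    finally show ?thesis by (simp add: mult_ac)
  qed
  have main: "\<kappa> * (norm (J (u t)))\<^sup>2 + \<alpha> * \<kappa> * integral {0..t} (\<lambda>s. (norm (u s))\<^sup>2)
      \<le> (norm (J (u 0)))\<^sup>2 + L2_inner M ?F ?F / \<alpha>" if t: "t \<in> {0..T}" for t
  proof -
    have sub: "{0..t} \<subseteq> {0..T}" using t by auto
    have iF: "(\<lambda>s. (norm (?F s))\<^sup>2) integrable_on {0..t}"
      by (intro integrable_continuous_real continuous_intros continuous_on_subset[OF cF sub])
    have iu: "(\<lambda>s. (norm (u s))\<^sup>2) integrable_on {0..t}"
      by (intro integrable_continuous_real continuous_intros continuous_on_subset[OF cu sub])
    have h1: "(S' has_integral S t - S 0) {0..t}"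
    proof (rule fundamental_theorem_of_calculus)
      show "(S has_vector_derivative S' s) (at s within {0..t})" if "s \<in> {0..t}" for s
        using deriv[of s] that sub by (auto intro: has_vector_derivative_within_subset)
    qed (use t in simp)
    have h2: "((\<lambda>s. (norm (?F s))\<^sup>2 / \<alpha> - \<alpha> * \<kappa> * (norm (u s))\<^sup>2) has_integral
        integral {0..t} (\<lambda>s. (norm (?F s))\<^sup>2) / \<alpha> - \<alpha> * \<kappa> * integral {0..t} (\<lambda>s. (norm (u s))\<^sup>2)) {0..t}"
      by (intro has_integral_diff has_integral_mult_right has_integral_divide integrable_integral iF iu)
    have "S t - S 0 \<le> integral {0..t} (\<lambda>s. (norm (?F s))\<^sup>2) / \<alpha> - \<alpha> * \<kappa> * integral {0..t} (\<lambda>s. (norm (u s))\<^sup>2)"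
      by (rule has_integral_le[OF h1 h2]) (use le sub in auto)
    moreover have "integral {0..t} (\<lambda>s. (norm (?F s))\<^sup>2) \<le> L2_inner M ?F ?F"
      unfolding continuous_L2_inner[OF cF]
      by (rule integral_subset_le[OF sub iF])
         (auto intro!: integrable_continuous_real continuous_intros cF)
    then have "integral {0..t} (\<lambda>s. (norm (?F s))\<^sup>2) / \<alpha> \<le> L2_inner M ?F ?F / \<alpha>"
      using \<alpha>_pos by (simp add: divide_right_mono)
    moreover have "S 0 = (norm (J (u 0)))\<^sup>2" by (simp add: S_def power2_norm_eq_inner)
    moreover have "\<kappa> * (norm (J (u t)))\<^sup>2 \<le> S t"
      unfolding S_def \<kappa>_def power2_norm_eq_inner
      by (rule mult_right_mono) (use t \<mu>_nonneg in \<open>auto simp: mult_left_mono\<close>)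
    ultimately show ?thesis by linarith
  qed
  have \<kappa>: "\<kappa> > 0" "exp (2 * \<mu> * T) * \<kappa> = 1" by (simp_all add: \<kappa>_def flip: exp_add)
  have K: "x \<le> exp (2 * \<mu> * T) * y" if "\<kappa> * x \<le> y" for x y
    using mult_left_mono[OF that, of "exp (2 * \<mu> * T)"] \<kappa>(2)
    by (simp flip: mult.assoc)
  \<comment> \<open>No bound on \<open>t\<close> is assumed: where the function is not integrable,
    the integral has the default value 0.\<close>
  have nn: "0 \<le> integral {0..t} (\<lambda>s. (norm (u s))\<^sup>2)" for t
    by (cases "(\<lambda>s. (norm (u s))\<^sup>2) integrable_on {0..t}")
       (auto intro: Henstock_Kurzweil_Integration.integral_nonneg simp: not_integrable_integral)
  show "(norm (J (u t)))\<^sup>2 \<le> E" if "t \<in> {0..T}"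
  proof -
    have "0 \<le> \<alpha> * \<kappa> * integral {0..t} (\<lambda>s. (norm (u s))\<^sup>2)" using nn \<alpha>_pos \<kappa>(1) by simp
    then show ?thesis unfolding E_def using main[OF that] by (intro K) linarith
  qed
  show "\<alpha> * L2_inner M u u \<le> E"
    unfolding E_def
  proof (rule K)
    have "0 \<le> \<kappa> * (norm (J (u T)))\<^sup>2" using \<kappa>(1) by simp
    then show "\<kappa> * (\<alpha> * L2_inner M u u) \<le> (norm (J (u 0)))\<^sup>2 + L2_inner M ?F ?F / \<alpha>"
      unfolding continuous_L2_inner[OF cu] using main[of T] T_pos by (simp add: mult_ac)
  qed
qed

section \<open>Density of the range of the heat operator\<close>

lemma const_L2: "v \<in> G \<Longrightarrow> (\<lambda>_. v) \<in> L2_fun M G"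
  by (rule continuous_L2) auto

lemma inner_integrable: "x \<in> L2_fun M G \<Longrightarrow> v \<in> G \<Longrightarrow> integrable M (\<lambda>t. x t \<bullet> v)"
  using L2_inner_integrable[OF _ const_L2] by blast

text \<open>
  Testing with \<open>ramp2 c *\<^sub>R v\<close>, whose derivative is \<open>ramp c *\<^sub>R v\<close>, makes the weight of \<open>g\<close> in the
  orthogonality relation differentiable in \<open>c\<close>, so that no regularity of \<open>g\<close> is needed.
\<close>

lemma orthogonal_heat_op_zero:
  assumes g: "g \<in> L2_fun M G"
    and orth: "\<And>u u'. C1_pair u u' \<Longrightarrow> u 0 = 0 \<Longrightarrow> L2_inner M (heat_op u u') g = 0"
  shows "AE t in M. g t = 0"
proof -
  \<comment> \<open>The Riesz representative \<open>p c\<close> of \<open>I2 c\<close> is the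
    threefold tail integral of \<open>g\<close>: up to sign, \<open>g\<close> is its third
    derivative in \<open>c\<close>. It exists as an element of \<open>G\<close> through scalar
    integrals alone.\<close>
  define I2 where "I2 c v = (\<integral>s. ramp2 c s * (g s \<bullet> v) \<partial>M)" for c v
  define I1 where "I1 c v = (\<integral>s. ramp c s * (g s \<bullet> v) \<partial>M)" for c v
  have gi: "integrable M (\<lambda>s. g s \<bullet> v)" if "v \<in> G" for v by (rule inner_integrable[OF g that])
  have i2: "integrable M (\<lambda>s. ramp2 c s * (g s \<bullet> v))" and i1: "integrable M (\<lambda>s. ramp c s * (g s \<bullet> v))"
    if "v \<in> G" for c v
    by (intro integrable_continuous_mult continuous_on_ramp gi that)+
  have bound: "\<bar>\<integral>s. \<phi> s * (g s \<bullet> v) \<partial>M\<bar> \<le> B * (\<integral>s. norm (g s) \<partial>M) * norm v"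
    if "v \<in> G" "continuous_on {0..T} \<phi>" "\<And>s. s \<in> {0..T} \<Longrightarrow> \<bar>\<phi> s\<bar> \<le> B" for \<phi> v B
  proof -
    have "\<bar>\<integral>s. \<phi> s * (g s \<bullet> v) \<partial>M\<bar> \<le> (\<integral>s. B * norm v * norm (g s) \<partial>M)"
    proof (rule integral_abs_bound_integral)
      show "integrable M (\<lambda>s. \<phi> s * (g s \<bullet> v))" by (intro integrable_continuous_mult gi that)
      show "integrable M (\<lambda>s. B * norm v * norm (g s))" using L2_norm_integrable[OF g] by simp
      fix s assume "s \<in> space M"
      then have "\<bar>\<phi> s\<bar> \<le> B" using that(3) by simp
      then have "\<bar>\<phi> s\<bar> * \<bar>g s \<bullet> v\<bar> \<le> B * (norm (g s) * norm v)"
        using Cauchy_Schwarz_ineq2[of "g s" v] by (intro mult_mono) auto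
      then show "\<bar>\<phi> s * (g s \<bullet> v)\<bar> \<le> B * norm v * norm (g s)" by (simp add: abs_mult mult_ac)
    qed
    then show ?thesis by (simp add: mult_ac)
  qed
  have "\<exists>x\<in>G. \<forall>v\<in>G. I2 c v = x \<bullet> v" if c: "c \<in> {0..T}" for c
  proof -
    obtain x where "x \<in> G" "\<And>v. v \<in> G \<Longrightarrow> I2 c v = x \<bullet> v"
    proof (rule riesz_representation[OF subspace_G closed_G])
      show "I2 c (v + w) = I2 c v + I2 c w" if "v \<in> G" "w \<in> G" for v w
        using i2[OF that(1), of c] i2[OF that(2), of c] by (simp add: I2_def inner_add_right distrib_left)
      show "I2 c (r *\<^sub>R v) = r * I2 c v" if "v \<in> G" for v r
        by (simp add: I2_def mult.left_commute)
      show "\<bar>I2 c v\<bar> \<le> T\<^sup>2 * (\<integral>s. norm (g s) \<partial>M) * norm v" if "v \<in> G" for v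
        unfolding I2_def by (rule bound[OF that continuous_on_ramp(2)]) (use ramp_bounds[OF c] in auto)
    qed blast
    then show ?thesis by blast
  qed
  then obtain p where p: "\<And>c. c \<in> {0..T} \<Longrightarrow> p c \<in> G" "\<And>c v. c \<in> {0..T} \<Longrightarrow> v \<in> G \<Longrightarrow> I2 c v = p c \<bullet> v"
    by metis
  let ?N = "\<integral>s. norm (g s) \<partial>M"
  \<comment> \<open>Continuity of \<open>p\<close> in norm, obtained by testing with the increment
    \<open>w\<close> itself and the Lipschitz bound for \<open>ramp2\<close> in
    \<open>c\<close>.\<close>
  have lip: "norm (p c' - p c) \<le> T * \<bar>c' - c\<bar> * ?N" if c: "c \<in> {0..T}" "c' \<in> {0..T}" for c c'
  proof (cases "p c' - p c = 0")
    case False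
    define w where "w = p c' - p c"
    have w: "w \<in> G" using p c by (simp add: w_def G_simps)
    have "(norm w)\<^sup>2 = I2 c' w - I2 c w"
      using p c w by (simp add: power2_norm_eq_inner inner_diff_left[of "p c'" "p c" w, folded w_def])
    also have "\<dots> = (\<integral>s. (ramp2 c' s - ramp2 c s) * (g s \<bullet> w) \<partial>M)"
      using i2[OF w] by (simp add: I2_def left_diff_distrib)
    also have "\<dots> \<le> T * \<bar>c' - c\<bar> * ?N * norm w"
      by (rule order_trans[OF abs_ge_self bound[OF w]])
         (use ramp2_lipschitz[OF c] in \<open>auto intro!: continuous_intros continuous_on_ramp\<close>)
    finally show ?thesis using False by (simp add: power2_eq_square w_def)
  next
    case True
    then show ?thesis using T_pos by simp
  qed
  have cont: "continuous_on {0..T} p"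
  proof (rule continuous_onI)
    fix c e :: real assume c: "c \<in> {0..T}" and e: "e > 0"
    have N: "?N \<ge> 0" by simp
    let ?d = "e / (T * ?N + 1)"
    have pos: "T * ?N + 1 > 0" using T_pos N by (simp add: add_nonneg_pos)
    have "dist (p c') (p c) \<le> e" if c': "c' \<in> {0..T}" "dist c' c < ?d" for c'
    proof -
      have "T * \<bar>c' - c\<bar> * ?N \<le> \<bar>c' - c\<bar> * (T * ?N + 1)" by (simp add: algebra_simps)
      also have "\<dots> \<le> e" using c'(2) pos by (simp add: dist_real_def field_simps)
      finally show ?thesis using lip[OF c c'(1)] by (simp add: dist_norm)
    qed
    then show "\<exists>d>0. \<forall>x'\<in>{0..T}. dist x' c < d \<longrightarrow> dist (p x') (p c) \<le> e"
      using e pos by (auto intro!: exI[of _ ?d])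
  qed
  \<comment> \<open>Orthogonality for the special function \<open>ramp2 c s *\<^sub>R v\<close>,
    which starts at 0 because \<open>c \<ge> 0\<close>. Since \<open>- I1\<close> is the derivative
    of \<open>I2\<close> in \<open>c\<close>, this is a differential equation for
    \<open>p\<close>.\<close>
  have I1: "I1 c (R v) = - I2 c (A v)" if v: "v \<in> G" and c: "c \<in> {0..T}" for c v
  proof -
    let ?u = "\<lambda>s. ramp2 c s *\<^sub>R v" and ?u' = "\<lambda>s. ramp c s *\<^sub>R v"
    have "C1_pair ?u ?u'"
      unfolding C1_pair_def
    proof (intro conjI ballI)
      show "continuous_on {0..T} ?u'" by (intro continuous_intros continuous_on_ramp)
      show "(?u has_vector_derivative ?u' t) (at t within {0..T})" for t
        using has_vector_derivative_scaleR[OF has_field_derivative_at_within[OF has_derivative_ramp2]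
            has_vector_derivative_const[of v]] by simp
    qed (use v in \<open>auto simp: G_simps\<close>)
    moreover have "?u 0 = 0" using c by (simp add: ramp2_def ramp_def)
    ultimately have "L2_inner M (heat_op ?u ?u') g = 0" by (rule orth)
    moreover have "L2_inner M (heat_op ?u ?u') g = I1 c (R v) + I2 c (A v)"
      unfolding I1_def I2_def
      using i1[OF R_in, of c v] i2[OF A_in, of c v]
      by (simp add: L2_inner_def heat_op_def inner_add_left R.scaleR A.scaleR inner_commute[of "R v"] inner_commute[of "A v"])
    ultimately show ?thesis by simp
  qed
  have deriv: "((\<lambda>c. p c \<bullet> R v) has_real_derivative p c \<bullet> A v) (at c within {0..T})"
    if v: "v \<in> G" and c: "c \<in> {0..T}" for c v
  proof -
    have "((\<lambda>c. I2 c (R v)) has_real_derivative - I1 c (R v)) (at c within {0..T})"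
      unfolding I1_def I2_def
      by (rule has_field_derivative_at_within, rule has_derivative_integral_ramp2, rule gi, rule R_in)
    then have "((\<lambda>c. I2 c (R v)) has_real_derivative p c \<bullet> A v) (at c within {0..T})"
      by (simp only: I1[OF v c] p(2)[OF c A_in] minus_minus)
    then show ?thesis
      by (rule has_field_derivative_transform_within[where d = 1]) (use c p(2)[OF _ R_in] in simp_all)
  qed
  have pz: "p c = 0" if c: "c \<in> {0..T}" for c
  proof -
    \<comment> \<open>\<open>p\<close> vanishes at the end \<open>T\<close>, as
      \<open>ramp2 T\<close> is zero on the interval. Reversing time makes this an initial condition
      and changes the sign of \<open>A\<close>, which is the sign for which Garding's inequality
      gives the upper bound.\<close>
    have "p (T - (T - c)) = 0"
    proof (rule weak_ode_zero[where p = "\<lambda>s. p (T - s)" and C = "\<lambda>x. - A x"])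
      show "p (T - t) \<in> G" if "t \<in> {0..T}" for t using p(1) that by auto
      show "continuous_on {0..T} (\<lambda>s. p (T - s))"
        by (rule continuous_on_compose2[OF cont]) (auto intro!: continuous_intros)
      show "bounded_linear (\<lambda>x. - A x)" by (rule bounded_linear_minus[OF A])
      show "((\<lambda>t. p (T - t) \<bullet> R v) has_real_derivative p (T - t) \<bullet> - A v) (at t within {0..T})"
        if "v \<in> G" "t \<in> {0..T}" for v t
      proof -
        have im: "(\<lambda>t. T - t) ` {0..T} = {0..T}" by auto
        have d: "((\<lambda>t. T - t) has_real_derivative - 1) (at t within {0..T})"
          by (auto intro!: derivative_eq_intros)
        have "((\<lambda>c. p c \<bullet> R v) has_real_derivative p (T - t) \<bullet> A v) (at (T - t) within (\<lambda>t. T - t) ` {0..T})"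
          unfolding im by (rule deriv) (use that in auto)
        from DERIV_image_chain[OF this d] show ?thesis by (simp add: o_def)
      qed
      show "x \<bullet> - A x \<le> \<mu> * (norm (J x))\<^sup>2" if "x \<in> G" for x
      proof -
        have "0 \<le> \<alpha> * (norm x)\<^sup>2" using \<alpha>_pos by simp
        then show ?thesis using garding[OF that] by (simp add: inner_commute)
      qed
      have "norm (p T) * norm (p T) = 0"
      proof -
        have "I2 T (p T) = (\<integral>s. 0 \<partial>M)"
          unfolding I2_def
          by (rule Bochner_Integration.integral_cong) (auto simp: ramp2_def ramp_def)
        then show ?thesis
          using p(2)[of T "p T"] p(1)[of T] T_pos by (simp add: power2_norm_eq_inner flip: power2_eq_square)
      qed
      then show "p (T - 0) = 0" by simp
      show "T - c \<in> {0..T}" using c by auto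
    qed
    then show ?thesis by simp
  qed
  show ?thesis
  proof (rule L2_AE_zero)
    show "g t \<in> G" if "t \<in> space M" for t by (rule L2_D(1)[OF g that])
    show "AE t in M. g t \<bullet> v = 0" if v: "v \<in> G" for v
      by (rule AE_zero_if_ramp2_integrals_zero[OF gi[OF v]])
         (use p(2)[OF _ v] pz in \<open>auto simp: I2_def\<close>)
  qed
qed

text \<open>\<open>h\<close> is projected onto the closure of the range. The defect
  \<open>h - p\<close> is orthogonal to the range, hence zero almost everywhere, and the sequence
  from the projection approximates \<open>h\<close>.\<close>

lemma heat_op_dense:
  assumes h: "h \<in> L2_fun M G" and e: "e > 0"
  obtains u u' where "C1_pair u u'" "u 0 = 0"
    "L2_inner M (\<lambda>t. heat_op u u' t - h t) (\<lambda>t. heat_op u u' t - h t) < e"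
proof -
  let ?R = "{heat_op u u' |u u'. C1_pair u u' \<and> u 0 = 0}"
  obtain p s where p: "p \<in> L2_fun M G" and s: "\<And>n. s n \<in> ?R"
    and lim: "(\<lambda>n. sqdist (s n) p) \<longlonglongrightarrow> 0"
    and orth: "\<And>m. m \<in> ?R \<Longrightarrow> L2_inner M (\<lambda>t. h t - p t) m = 0"
  proof (rule projection[of ?R h])
    show sub: "?R \<subseteq> L2_fun M G" by (auto intro: heat_op_L2)
    have "C1_pair (\<lambda>_. 0) (\<lambda>_. 0)" by (rule C1_pair_const) (simp add: G_simps)
    then show "?R \<noteq> {}" by blast
    show "(\<lambda>t. x t + c *\<^sub>R y t) \<in> ?R" if "x \<in> ?R" "y \<in> ?R" for x y c
    proof -
      from that obtain u u' v v' where "x = heat_op u u'" "C1_pair u u'" "u 0 = 0"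
        "y = heat_op v v'" "C1_pair v v'" "v 0 = 0" by auto
      then show ?thesis using C1_pair_lin[of u u' v v' c] heat_op_lin[of u c v u' v', symmetric]
        by fastforce
    qed
    show "\<exists>p\<in>L2_fun M G. (\<lambda>n. sqdist (s n) p) \<longlonglongrightarrow> 0"
      if sR: "\<And>n. s n \<in> ?R"
        and C: "\<And>e. e > 0 \<Longrightarrow> \<exists>N. \<forall>m\<ge>N. \<forall>n\<ge>N. sqdist (s m) (s n) < e"
      for s
    proof -
      have "s n \<in> L2_fun M G" for n using sR sub by blast
      from L2_complete[OF this C] show ?thesis by blast
    qed
  qed (use h in auto)
  have hp: "(\<lambda>t. h t - p t) \<in> L2_fun M G" by (rule diff_in[OF h p])
  have sL: "s n \<in> L2_fun M G" for n using s[of n] heat_op_L2 by auto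
  have "AE t in M. h t - p t = 0"
  proof (rule orthogonal_heat_op_zero[OF hp])
    fix u u' assume u: "C1_pair u u'" "u 0 = 0"
    then have "L2_inner M (\<lambda>t. h t - p t) (heat_op u u') = 0" using orth by blast
    then show "L2_inner M (heat_op u u') (\<lambda>t. h t - p t) = 0"
      using form_sym[OF heat_op_L2[OF u(1)] hp] by simp
  qed
  then have "sqdist h p = (\<integral>t. 0 \<partial>M)"
    unfolding L2_inner_self
    by (intro integral_cong_AE borel_measurable_integrable L2_D(3)[OF hp]) auto
  \<comment> \<open>Distance zero does not make \<open>h\<close> and \<open>p\<close> equal as
    functions. Cauchy-Schwarz kills the mixed term, which lets \<open>h\<close> replace
    \<open>p\<close> as the limit.\<close>
  then have zero: "sqdist h p = 0" by simp
  have "\<forall>\<^sub>F n in sequentially. sqdist (s n) p < e"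
    using lim e by (rule order_tendstoD(2))
  then obtain n where n: "sqdist (s n) p < e"
    by (auto simp: eventually_sequentially)
  have sp: "(\<lambda>t. s n t - p t) \<in> L2_fun M G" by (rule diff_in[OF sL p])
  have "L2_inner M (\<lambda>t. s n t - p t) (\<lambda>t. h t - p t) = 0"
    using cauchy_schwarz[OF sp hp] zero by simp
  then have "sqdist (s n) h < e"
    using form_diff_expand[OF sp hp] zero n by simp
  then show ?thesis using s[of n] that by auto
qed

section \<open>Existence and uniqueness for the abstract problem\<close>

lemma form_diff_le:
  assumes "x \<in> L2_fun M G" "y \<in> L2_fun M G"
  shows "sqdist x y \<le> 2 * L2_inner M x x + 2 * L2_inner M y y"
  using form_diff_expand[OF assms] form_expand[OF assms, of 1] form_nonneg[OF lin[OF assms, of 1]]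
  by simp

lemma C1_weak_identity:
  assumes u: "C1_pair u u'" and v: "v \<in> G"
    and \<psi>: "\<And>t. (\<psi> has_real_derivative \<psi>' t) (at t)" and \<psi>': "continuous_on {0..T} \<psi>'"
    and z: "\<psi> 0 = 0" "\<psi> T = 0"
  shows "(\<integral>t. \<psi>' t * (J (u t) \<bullet> J v) \<partial>M) = - (\<integral>t. \<psi> t * (J (u' t) \<bullet> J v) \<partial>M)"
proof -
  have c\<psi>: "continuous_on {0..T} \<psi>"
    using \<psi> by (intro DERIV_atLeastAtMost_imp_continuous_on) blast
  have cu: "continuous_on {0..T} u" by (rule C1_pair_continuous[OF u])
  have cu': "continuous_on {0..T} u'" using u by (simp add: C1_pair_def)
  have i1: "integrable M (\<lambda>t. \<psi>' t * (J (u t) \<bullet> J v))" and i2: "integrable M (\<lambda>t. \<psi> t * (J (u' t) \<bullet> J v))"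
    by (intro continuous_imp_integrable_real continuous_intros J.continuous_on cu cu' c\<psi> \<psi>')+
  have "((\<lambda>t. \<psi> t * (J (u' t) \<bullet> J v) + \<psi>' t * (J (u t) \<bullet> J v)) has_integral
      \<psi> T * (J (u T) \<bullet> J v) - \<psi> 0 * (J (u 0) \<bullet> J v)) {0..T}"
  proof (rule fundamental_theorem_of_calculus)
    fix t assume t: "t \<in> {0..T}"
    then have "(u has_vector_derivative u' t) (at t within {0..T})" using u by (simp add: C1_pair_def)
    from J.has_vector_derivative[OF this]
    have "((\<lambda>t. J (u t) \<bullet> J v) has_real_derivative J (u' t) \<bullet> J v) (at t within {0..T})"
      using bounded_linear.has_vector_derivative[OF bounded_linear_inner_left]
      by (simp add: has_real_derivative_iff_has_vector_derivative)
    from DERIV_mult'[OF has_field_derivative_at_within[OF \<psi>] this]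
    show "((\<lambda>t. \<psi> t * (J (u t) \<bullet> J v)) has_vector_derivative
        \<psi> t * (J (u' t) \<bullet> J v) + \<psi>' t * (J (u t) \<bullet> J v)) (at t within {0..T})"
      by (simp add: has_real_derivative_iff_has_vector_derivative)
  qed (use T_pos in simp)
  then have "integral {0..T} (\<lambda>t. \<psi> t * (J (u' t) \<bullet> J v) + \<psi>' t * (J (u t) \<bullet> J v)) = 0"
    using z by (simp add: integral_unique)
  moreover have "integral {0..T} (\<lambda>t. \<psi> t * (J (u' t) \<bullet> J v) + \<psi>' t * (J (u t) \<bullet> J v))
      = (\<integral>t. \<psi> t * (J (u' t) \<bullet> J v) + \<psi>' t * (J (u t) \<bullet> J v) \<partial>M)"
    by (rule lebesgue_integral_eq_integral[symmetric]) (use i1 i2 in auto)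
  ultimately show ?thesis using i1 i2 by simp
qed

text \<open>The energy estimate for differences of approximate solutions makes them Cauchy in two
  ways, giving a continuous H-valued limit \<open>U\<close> and an L^2 limit \<open>uh\<close> with
  values in \<open>G\<close>. The derivative is stated only in weak form, since the derivatives of
  the approximations are not shown to converge in \<open>G\<close>.\<close>

theorem solution_exists:
  assumes h: "h \<in> L2_fun M G" and g: "g \<in> closure (J ` G)"
  obtains U uh where "continuous_on {0..T} U" "U 0 = g"
    "\<And>t. t \<in> {0..T} \<Longrightarrow> U t \<in> closure (J ` G)"
    "uh \<in> L2_fun M G" "AE t in M. J (uh t) = U t"
    "\<And>v \<psi> \<psi>'. v \<in> G \<Longrightarrow> (\<And>t. (\<psi> has_real_derivative \<psi>' t) (at t)) \<Longrightarrow>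
      continuous_on {0..T} \<psi>' \<Longrightarrow> \<psi> 0 = 0 \<Longrightarrow> \<psi> T = 0 \<Longrightarrow>
      (\<integral>t. \<psi>' t * (U t \<bullet> J v) \<partial>M) = - (\<integral>t. \<psi> t * ((h t - A (uh t)) \<bullet> v) \<partial>M)"
proof -
  let ?\<epsilon> = "\<lambda>n. 1 / real (Suc n)"
  have \<epsilon>: "?\<epsilon> n > 0" "?\<epsilon> n \<le> 1" for n by simp_all
  have small: "\<exists>N. \<forall>m\<ge>N. \<forall>n\<ge>N. C * (?\<epsilon> m + ?\<epsilon> n) < e" if e: "e > 0" and C: "C \<ge> 0" for C e :: real
  proof -
    have "e / (2 * (C + 1)) > 0" using e C by simp
    then obtain N where N: "?\<epsilon> N < e / (2 * (C + 1))" using nat_approx_posE by blast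
    have "C * (?\<epsilon> m + ?\<epsilon> n) < e" if "m \<ge> N" "n \<ge> N" for m n
    proof -
      have "?\<epsilon> m \<le> ?\<epsilon> N" "?\<epsilon> n \<le> ?\<epsilon> N" using that by (simp_all add: frac_le)
      then have "C * (?\<epsilon> m + ?\<epsilon> n) \<le> (C + 1) * (2 * ?\<epsilon> N)" using C by (intro mult_mono) auto
      also have "\<dots> < e" using N C by (simp add: field_simps)
      finally show ?thesis .
    qed
    then show ?thesis by blast
  qed
  have "\<exists>v\<in>G. norm (J v - g) < ?\<epsilon> n" for n
  proof -
    obtain y where "y \<in> J ` G" "dist y g < ?\<epsilon> n"
      using g \<epsilon>(1)[of n] unfolding closure_approachable by blast
    then show ?thesis by (auto simp: dist_norm)
  qed
  then have "\<forall>n. \<exists>v. v \<in> G \<and> norm (J v - g) < ?\<epsilon> n" by blast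
  from choice[OF this] obtain v where v: "\<And>n. v n \<in> G" and vg: "\<And>n. norm (J (v n) - g) < ?\<epsilon> n"
    by blast
  have Av: "(\<lambda>t. h t - A (v n)) \<in> L2_fun M G" for n by (rule diff_in[OF h const_L2[OF A_in]])
  have "\<exists>w w'. C1_pair w w' \<and> w 0 = 0 \<and>
    L2_inner M (\<lambda>t. heat_op w w' t - (h t - A (v n))) (\<lambda>t. heat_op w w' t - (h t - A (v n))) < ?\<epsilon> n" for n
    by (rule heat_op_dense[OF Av[of n] \<epsilon>(1)[of n]]) blast
  then have "\<forall>n. \<exists>p. C1_pair (fst p) (snd p) \<and> fst p 0 = 0 \<and>
    L2_inner M (\<lambda>t. heat_op (fst p) (snd p) t - (h t - A (v n)))
      (\<lambda>t. heat_op (fst p) (snd p) t - (h t - A (v n))) < ?\<epsilon> n"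
    by (simp only: split_paired_Ex fst_conv snd_conv) blast
  from choice[OF this] obtain p where p: "\<forall>n. C1_pair (fst (p n)) (snd (p n)) \<and> fst (p n) 0 = 0 \<and>
    L2_inner M (\<lambda>t. heat_op (fst (p n)) (snd (p n)) t - (h t - A (v n)))
      (\<lambda>t. heat_op (fst (p n)) (snd (p n)) t - (h t - A (v n))) < ?\<epsilon> n"
    by (rule exE)
  define w where "w n = fst (p n)" for n
  define w' where "w' n = snd (p n)" for n
  have w: "C1_pair (w n) (w' n)" "w n 0 = 0"
    and wh: "L2_inner M (\<lambda>t. heat_op (w n) (w' n) t - (h t - A (v n)))
      (\<lambda>t. heat_op (w n) (w' n) t - (h t - A (v n))) < ?\<epsilon> n" for n
    using spec[OF p, of n] by (simp_all only: w_def w'_def)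
  \<comment> \<open>Adding the constant \<open>v n\<close> to a function that starts at 0 and nearly
    solves with right-hand side \<open>h - A (v n)\<close> gives one that starts at
    \<open>v n\<close> with right-hand side near \<open>h\<close>. The trivial \<open>0 +\<close>
    and \<open>1 *\<^sub>R\<close> keep the shape of \<open>C1_pair_lin\<close>.\<close>
  define u where "u n t = v n + 1 *\<^sub>R w n t" for n t
  define u' where "u' n t = 0 + 1 *\<^sub>R w' n t" for n t
  have u: "C1_pair (u n) (u' n)" for n
    unfolding u_def[abs_def] u'_def[abs_def] by (rule C1_pair_lin[OF C1_pair_const[OF v] w(1)])
  have u0: "u n 0 = v n" for n by (simp add: u_def w)
  define F where "F n = heat_op (u n) (u' n)" for n
  have F: "F n \<in> L2_fun M G" for n unfolding F_def by (rule heat_op_L2[OF u])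
  have uL: "u n \<in> L2_fun M G" for n by (rule C1_pair_L2[OF u])
  have Fh: "sqdist (F n) h < ?\<epsilon> n" for n
  proof -
    have "(\<lambda>t. F n t - h t) = (\<lambda>t. heat_op (w n) (w' n) t - (h t - A (v n)))"
      by (rule ext) (simp add: F_def heat_op_def u_def u'_def A.add)
    then show ?thesis using wh[of n] by simp
  qed
  let ?D = "\<lambda>x m n. sqdist (x m) (x n)"
  have DF: "?D F m n \<le> 2 * (?\<epsilon> m + ?\<epsilon> n)" for m n
  proof -
    have "?D F m n \<le> 2 * sqdist (F m) h
        + 2 * sqdist (F n) h"
      using form_diff_le[OF diff_in[OF F h] diff_in[OF F h], of m n] by simp
    then show ?thesis using Fh[of m] Fh[of n] by simp
  qed
  have Dv: "(norm (J (v m) - J (v n)))\<^sup>2 \<le> 2 * (?\<epsilon> m + ?\<epsilon> n)" for m n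
  proof -
    \<comment> \<open>As \<open>?\<epsilon> k \<le> 1\<close>, the bound on the distance also bounds
      its square, so start values and right-hand sides have errors of the same order.\<close>
    have le: "(norm (J (v k) - g))\<^sup>2 \<le> ?\<epsilon> k" for k
    proof -
      have "(norm (J (v k) - g))\<^sup>2 \<le> norm (J (v k) - g) * 1"
        unfolding power2_eq_square using vg[of k] \<epsilon>(2)[of k] by (intro mult_left_mono) (linarith, simp)
      then show ?thesis using vg[of k] by linarith
    qed
    have "(norm (J (v m) - J (v n)))\<^sup>2 \<le> 2 * (norm (J (v m) - g))\<^sup>2 + 2 * (norm (g - J (v n)))\<^sup>2"
      using norm_add_squared_le[of "J (v m) - g" "g - J (v n)"] by simp
    then show ?thesis using le[of m] le[of n] by (simp add: norm_minus_commute)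
  qed
  \<comment> \<open>The energy constant times the two contributions: 2 from the start values
    (\<open>Dv\<close>) and \<open>2 / \<alpha>\<close> from the right-hand sides
    (\<open>DF\<close>).\<close>
  define K where "K = exp (2 * \<mu> * T) * (2 + 2 / \<alpha>)"
  have K: "K \<ge> 0" using \<alpha>_pos by (simp add: K_def)
  have en: "exp (2 * \<mu> * T) * ((norm (J (v m) - J (v n)))\<^sup>2 + ?D F m n / \<alpha>) \<le> K * (?\<epsilon> m + ?\<epsilon> n)" for m n
  proof -
    have "?D F m n / \<alpha> \<le> 2 * (?\<epsilon> m + ?\<epsilon> n) / \<alpha>" by (rule divide_right_mono[OF DF]) (use \<alpha>_pos in simp)
    then have "(norm (J (v m) - J (v n)))\<^sup>2 + ?D F m n / \<alpha> \<le> (2 + 2 / \<alpha>) * (?\<epsilon> m + ?\<epsilon> n)"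
      using Dv[of m n] by (simp add: algebra_simps add_divide_distrib)
    then show ?thesis unfolding K_def mult.assoc by (intro mult_left_mono) auto
  qed
  have pair: "C1_pair (\<lambda>t. u m t - u n t) (\<lambda>t. u' m t - u' n t)" for m n
    using C1_pair_lin[OF u u, of m "-1" n] by simp
  have op: "heat_op (\<lambda>t. u m t - u n t) (\<lambda>t. u' m t - u' n t) = (\<lambda>t. F m t - F n t)" for m n
    using heat_op_lin[of "u m" "-1" "u n" "u' m" "u' n"] by (simp add: F_def)
  have sup: "(norm (J (u m t) - J (u n t)))\<^sup>2 \<le> K * (?\<epsilon> m + ?\<epsilon> n)" if "t \<in> {0..T}" for m n t
    using energy(1)[OF pair that, of m n] en[of m n] unfolding op u0 J.diff by linarith
  have Du: "\<alpha> * ?D u m n \<le> K * (?\<epsilon> m + ?\<epsilon> n)" for m n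
    using energy(2)[OF pair, of m n] en[of m n] unfolding op u0 J.diff by linarith
  have cauchy: "\<exists>N. \<forall>m\<ge>N. \<forall>n\<ge>N. ?D u m n < e" if e: "e > 0" for e
  proof -
    obtain N where N: "\<And>m n. m \<ge> N \<Longrightarrow> n \<ge> N \<Longrightarrow> K * (?\<epsilon> m + ?\<epsilon> n) < \<alpha> * e"
      using small[of "\<alpha> * e" K] e K \<alpha>_pos by auto
    have "?D u m n < e" if "m \<ge> N" "n \<ge> N" for m n
    proof -
      have "\<alpha> * ?D u m n < \<alpha> * e" using Du[of m n] N[OF that] by linarith
      then show ?thesis using \<alpha>_pos by simp
    qed
    then show ?thesis by blast
  qed
  obtain uh r where uh: "uh \<in> L2_fun M G"
    and lim: "(\<lambda>n. sqdist (u n) uh) \<longlonglongrightarrow> 0"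
    and r: "strict_mono r" and ae: "AE t in M. (\<lambda>n. u (r n) t) \<longlonglongrightarrow> uh t"
    by (rule L2_complete[OF uL cauchy])
  have "\<forall>e>0. \<exists>N. \<forall>m n t. N \<le> m \<and> N \<le> n \<and> t \<in> {0..T} \<longrightarrow> dist (J (u m t)) (J (u n t)) < e"
  proof (intro allI impI)
    fix e :: real assume e: "e > 0"
    then have "e\<^sup>2 > 0" by simp
    from small[OF this K] obtain N where N: "\<And>m n. m \<ge> N \<Longrightarrow> n \<ge> N \<Longrightarrow> K * (?\<epsilon> m + ?\<epsilon> n) < e\<^sup>2"
      by blast
    have "dist (J (u m t)) (J (u n t)) < e" if "N \<le> m" "N \<le> n" "t \<in> {0..T}" for m n t
      using sup[OF that(3), of m n] N[OF that(1,2)] e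
      by (intro power2_less_imp_less[of _ e]) (auto simp: dist_norm)
    then show "\<exists>N. \<forall>m n t. N \<le> m \<and> N \<le> n \<and> t \<in> {0..T} \<longrightarrow> dist (J (u m t)) (J (u n t)) < e"
      by blast
  qed
  then obtain U where U: "\<forall>e>0. \<exists>N. \<forall>n t. N \<le> n \<and> t \<in> {0..T} \<longrightarrow> dist (J (u n t)) (U t) < e"
    using uniformly_convergent_eq_cauchy[of "\<lambda>t. t \<in> {0..T}" "\<lambda>n t. J (u n t)"] by auto
  then have unif: "uniform_limit {0..T} (\<lambda>n t. J (u n t)) U sequentially"
    unfolding uniform_limit_sequentially_iff by blast
  have ptw: "(\<lambda>n. J (u n t)) \<longlonglongrightarrow> U t" if "t \<in> {0..T}" for t
    using tendsto_uniform_limitI[OF unif that] .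
  have contU: "continuous_on {0..T} U"
    by (rule uniform_limit_theorem[OF _ unif])
       (auto intro!: always_eventually J.continuous_on C1_pair_continuous[OF u])
  have U0: "U 0 = g"
  proof (rule LIMSEQ_unique)
    show "(\<lambda>n. J (u n 0)) \<longlonglongrightarrow> U 0" using ptw T_pos by simp
    have "(\<lambda>n. J (v n) - g) \<longlonglongrightarrow> 0"
      by (rule Lim_null_comparison[OF _ LIMSEQ_Suc[OF lim_1_over_n]])
         (use vg less_imp_le in \<open>auto intro!: always_eventually simp del: of_nat_Suc\<close>)
    then show "(\<lambda>n. J (u n 0)) \<longlonglongrightarrow> g" by (simp add: u0 LIM_zero_iff)
  qed
  have Ucl: "U t \<in> closure (J ` G)" if t: "t \<in> {0..T}" for t
    unfolding closure_sequential
    using ptw[OF t] u t by (intro exI[of _ "\<lambda>n. J (u n t)"]) (auto simp: C1_pair_def)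
  \<comment> \<open>The two limits are compared along the almost everywhere convergent subsequence,
    by continuity of \<open>J\<close>.\<close>
  have aeU: "AE t in M. J (uh t) = U t"
    using ae
  proof (rule AE_mp, intro AE_I2 impI)
    fix t assume t: "t \<in> space M" and "(\<lambda>n. u (r n) t) \<longlonglongrightarrow> uh t"
    then have "(\<lambda>n. J (u (r n) t)) \<longlonglongrightarrow> J (uh t)" by (intro J.tendsto)
    moreover have "(\<lambda>n. J (u (r n) t)) \<longlonglongrightarrow> U t"
      using LIMSEQ_subseq_LIMSEQ[OF ptw r, of t] t by (simp add: o_def)
    ultimately show "J (uh t) = U t" by (rule LIMSEQ_unique)
  qed
  have Flim: "(\<lambda>n. sqdist (F n) h) \<longlonglongrightarrow> 0"
  proof (rule Lim_null_comparison[OF _ LIMSEQ_Suc[OF lim_1_over_n]], intro always_eventually allI)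
    show "norm (sqdist (F n) h) \<le> ?\<epsilon> n" for n
      using Fh[of n] form_nonneg[OF diff_in[OF F h], of n] by simp
  qed
  \<comment> \<open>With the time derivative on \<open>\<psi>\<close> and the operators moved onto
    \<open>v\<close>, every term of the identity for \<open>u n\<close> is an L^2 inner product with
    a fixed function, so all terms pass to the limit.\<close>
  have weak: "(\<integral>t. \<psi>' t * (U t \<bullet> J v) \<partial>M) = - (\<integral>t. \<psi> t * ((h t - A (uh t)) \<bullet> v) \<partial>M)"
    if v: "v \<in> G" and \<psi>: "\<And>t. (\<psi> has_real_derivative \<psi>' t) (at t)" and \<psi>': "continuous_on {0..T} \<psi>'"
      and z: "\<psi> 0 = 0" "\<psi> T = 0" for v \<psi> \<psi>'
  proof -
    have c\<psi>: "continuous_on {0..T} \<psi>"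
      using \<psi> by (intro DERIV_atLeastAtMost_imp_continuous_on) blast
    have L: "(\<lambda>t. \<phi> t *\<^sub>R y) \<in> L2_fun M G" if "continuous_on {0..T} \<phi>" "y \<in> G" for \<phi> y
      by (intro continuous_L2 continuous_intros that) (use that in \<open>simp add: G_simps\<close>)
    have eq: "L2_inner M (u n) (\<lambda>t. \<psi>' t *\<^sub>R R v)
        = - (L2_inner M (F n) (\<lambda>t. \<psi> t *\<^sub>R v) - L2_inner M (u n) (\<lambda>t. \<psi> t *\<^sub>R A' v))" for n
    proof -
      have "L2_inner M (u n) (\<lambda>t. \<psi>' t *\<^sub>R R v) = (\<integral>t. \<psi>' t * (J (u n t) \<bullet> J v) \<partial>M)"
        unfolding L2_inner_def
        by (rule Bochner_Integration.integral_cong) (use u v in \<open>auto simp: C1_pair_def R_inner'\<close>)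
      also have "\<dots> = - (\<integral>t. \<psi> t * (J (u' n t) \<bullet> J v) \<partial>M)"
        by (rule C1_weak_identity[OF u v \<psi> \<psi>' z])
      also have "(\<integral>t. \<psi> t * (J (u' n t) \<bullet> J v) \<partial>M)
          = (\<integral>t. F n t \<bullet> (\<psi> t *\<^sub>R v) - u n t \<bullet> (\<psi> t *\<^sub>R A' v) \<partial>M)"
      proof (rule Bochner_Integration.integral_cong)
        fix t assume "t \<in> space M"
        then have "u n t \<in> G" "u' n t \<in> G" using u by (auto simp: C1_pair_def)
        then show "\<psi> t * (J (u' n t) \<bullet> J v) = F n t \<bullet> (\<psi> t *\<^sub>R v) - u n t \<bullet> (\<psi> t *\<^sub>R A' v)"
          using v by (simp add: F_def heat_op_def inner_add_left R_inner A_adjoint algebra_simps)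
      qed simp
      also have "\<dots> = L2_inner M (F n) (\<lambda>t. \<psi> t *\<^sub>R v) - L2_inner M (u n) (\<lambda>t. \<psi> t *\<^sub>R A' v)"
        unfolding L2_inner_def
        by (intro Bochner_Integration.integral_diff L2_inner_integrable F uL L c\<psi> v A'_in)
      finally show ?thesis .
    qed
    have "(\<lambda>n. L2_inner M (u n) (\<lambda>t. \<psi>' t *\<^sub>R R v)) \<longlonglongrightarrow> L2_inner M uh (\<lambda>t. \<psi>' t *\<^sub>R R v)"
      by (intro form_tendsto uL uh L \<psi>' R_in lim)
    moreover have "(\<lambda>n. L2_inner M (u n) (\<lambda>t. \<psi>' t *\<^sub>R R v))
        \<longlonglongrightarrow> - (L2_inner M h (\<lambda>t. \<psi> t *\<^sub>R v) - L2_inner M uh (\<lambda>t. \<psi> t *\<^sub>R A' v))"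
      unfolding eq
      by (intro tendsto_minus tendsto_diff form_tendsto uL uh L F h c\<psi> v A'_in lim Flim)
    ultimately have E: "L2_inner M uh (\<lambda>t. \<psi>' t *\<^sub>R R v)
        = - (L2_inner M h (\<lambda>t. \<psi> t *\<^sub>R v) - L2_inner M uh (\<lambda>t. \<psi> t *\<^sub>R A' v))"
      by (rule LIMSEQ_unique)
    have "(\<integral>t. \<psi>' t * (U t \<bullet> J v) \<partial>M) = L2_inner M uh (\<lambda>t. \<psi>' t *\<^sub>R R v)"
      unfolding L2_inner_def
    proof (rule integral_cong_AE)
      show "(\<lambda>t. \<psi>' t * (U t \<bullet> J v)) \<in> borel_measurable M"
        by (intro continuous_imp_measurable_on_sets_lebesgue continuous_intros contU \<psi>') simp
      show "(\<lambda>t. uh t \<bullet> (\<psi>' t *\<^sub>R R v)) \<in> borel_measurable M"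
        by (intro borel_measurable_integrable L2_inner_integrable uh L \<psi>' R_in)
      show "AE t in M. \<psi>' t * (U t \<bullet> J v) = uh t \<bullet> (\<psi>' t *\<^sub>R R v)"
        using aeU by (rule AE_mp) (use v L2_D(1)[OF uh] in \<open>auto simp: R_inner'\<close>)
    qed
    also note E
    also have "L2_inner M h (\<lambda>t. \<psi> t *\<^sub>R v) - L2_inner M uh (\<lambda>t. \<psi> t *\<^sub>R A' v)
        = (\<integral>t. h t \<bullet> (\<psi> t *\<^sub>R v) - uh t \<bullet> (\<psi> t *\<^sub>R A' v) \<partial>M)"
      unfolding L2_inner_def
      by (intro Bochner_Integration.integral_diff[symmetric] L2_inner_integrable h uh L c\<psi> v A'_in)
    also have "\<dots> = (\<integral>t. \<psi> t * ((h t - A (uh t)) \<bullet> v) \<partial>M)"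
      by (rule Bochner_Integration.integral_cong)
         (use L2_D(1)[OF uh] v in \<open>auto simp: inner_diff_left A_adjoint algebra_simps\<close>)
    finally show ?thesis .
  qed
  show ?thesis by (rule that[OF contU U0 Ucl uh aeU weak])
qed

text \<open>The integral \<open>p\<close> of \<open>uh\<close> takes values in \<open>G\<close> and
  satisfies \<open>\<langle>p, R v\<rangle>' = - \<langle>p, A' v\<rangle>\<close>, an equation to
  which the Gronwall argument applies although \<open>U\<close> itself has no derivative in
  \<open>G\<close>. From \<open>p = 0\<close> the hypothesis \<open>eq\<close> makes
  \<open>U t\<close> orthogonal to the range of \<open>J\<close>, whose closure contains
  \<open>U t\<close>.\<close>

theorem zero_if_homogeneous:
  assumes U: "continuous_on {0..T} U" "\<And>t. t \<in> {0..T} \<Longrightarrow> U t \<in> closure (J ` G)"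
    and uh: "uh \<in> L2_fun M G" and ae: "AE t in M. J (uh t) = U t"
    and eq: "\<And>v t. v \<in> G \<Longrightarrow> t \<in> {0..T} \<Longrightarrow> U t \<bullet> J v = - integral {0..t} (\<lambda>s. uh s \<bullet> A' v)"
    and t: "t \<in> {0..T}"
  shows "U t = 0"
proof -
  have int: "(\<lambda>s. uh s \<bullet> v) integrable_on {0..t}" if "v \<in> G" "t \<in> {0..T}" for v t
    by (rule integrable_subinterval_real[OF integrable_on_if_lebesgue_on[OF inner_integrable[OF uh that(1)]]])
       (use that in auto)
  have intN: "(\<lambda>s. norm (uh s)) integrable_on {a..b}" if "{a..b} \<subseteq> {0..T}" for a b
    by (rule integrable_subinterval_real[OF integrable_on_if_lebesgue_on[OF L2_norm_integrable[OF uh]] that])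
  \<comment> \<open>The indefinite integral of the norm is a continuous modulus for the increments
    of \<open>p\<close>.\<close>
  define N where "N t = integral {0..t} (\<lambda>s. norm (uh s))" for t
  have bound: "\<bar>integral {a..b} (\<lambda>s. uh s \<bullet> v)\<bar> \<le> integral {a..b} (\<lambda>s. norm (uh s)) * norm v"
    if v: "v \<in> G" and ab: "{a..b} \<subseteq> {0..T}" for v a b
  proof -
    have "norm (integral {a..b} (\<lambda>s. uh s \<bullet> v)) \<le> integral {a..b} (\<lambda>s. norm (uh s) * norm v)"
    proof (rule integral_norm_bound_integral)
      show "(\<lambda>s. uh s \<bullet> v) integrable_on {a..b}"
        by (rule integrable_subinterval_real[OF integrable_on_if_lebesgue_on[OF inner_integrable[OF uh v]] ab])
      show "(\<lambda>s. norm (uh s) * norm v) integrable_on {a..b}"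
        using intN[OF ab] by (rule integrable_on_mult_left)
      show "norm (uh s \<bullet> v) \<le> norm (uh s) * norm v" for s
        using Cauchy_Schwarz_ineq2[of "uh s" v] by simp
    qed
    then show ?thesis by simp
  qed
  have "\<exists>x\<in>G. \<forall>v\<in>G. integral {0..t} (\<lambda>s. uh s \<bullet> v) = x \<bullet> v" if t: "t \<in> {0..T}" for t
  proof -
    obtain x where "x \<in> G" "\<And>v. v \<in> G \<Longrightarrow> integral {0..t} (\<lambda>s. uh s \<bullet> v) = x \<bullet> v"
    proof (rule riesz_representation[OF subspace_G closed_G])
      show "integral {0..t} (\<lambda>s. uh s \<bullet> (v + w))
          = integral {0..t} (\<lambda>s. uh s \<bullet> v) + integral {0..t} (\<lambda>s. uh s \<bullet> w)" if "v \<in> G" "w \<in> G" for v w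
        unfolding inner_add_right by (intro Henstock_Kurzweil_Integration.integral_add int that t)
      show "integral {0..t} (\<lambda>s. uh s \<bullet> (c *\<^sub>R v)) = c * integral {0..t} (\<lambda>s. uh s \<bullet> v)" for c v
        by simp
      show "\<bar>integral {0..t} (\<lambda>s. uh s \<bullet> v)\<bar> \<le> N t * norm v" if "v \<in> G" for v
        unfolding N_def by (rule bound[OF that]) (use t in auto)
    qed blast
    then show ?thesis by blast
  qed
  then obtain p where p: "\<And>t. t \<in> {0..T} \<Longrightarrow> p t \<in> G"
    "\<And>t v. t \<in> {0..T} \<Longrightarrow> v \<in> G \<Longrightarrow> integral {0..t} (\<lambda>s. uh s \<bullet> v) = p t \<bullet> v"
    by metis
  have N: "norm (p t - p s) \<le> N t - N s" if st: "s \<in> {0..T}" "t \<in> {0..T}" "s \<le> t" for s t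
  proof -
    have sub: "{s..t} \<subseteq> {0..T}" using st by auto
    have split: "integral {0..s} f + integral {s..t} f = integral {0..t} f" if "f integrable_on {0..t}"
      for f :: "real \<Rightarrow> real"
      by (rule Henstock_Kurzweil_Integration.integral_combine) (use st that in auto)
    define w where "w = p t - p s"
    have w: "w \<in> G" using p st by (simp add: w_def G_simps)
    have "(norm w)\<^sup>2 = p t \<bullet> w - p s \<bullet> w"
      by (simp add: power2_norm_eq_inner inner_diff_left[of "p t" "p s" w, folded w_def])
    also have "\<dots> = integral {s..t} (\<lambda>s. uh s \<bullet> w)"
      using p(2)[OF st(1) w] p(2)[OF st(2) w] split[OF int[OF w st(2)]] by simp
    also have "\<dots> \<le> integral {s..t} (\<lambda>s. norm (uh s)) * norm w"
      using bound[OF w sub] by linarith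
    also have "integral {s..t} (\<lambda>s. norm (uh s)) = N t - N s"
      using split[OF intN[of 0 t]] st by (simp add: N_def)
    finally have le: "(norm w)\<^sup>2 \<le> (N t - N s) * norm w" .
    show ?thesis
    proof (cases "w = 0")
      case True
      have "0 \<le> integral {s..t} (\<lambda>s. norm (uh s))"
        by (rule Henstock_Kurzweil_Integration.integral_nonneg[OF intN[OF sub]]) simp
      then show ?thesis
        using True split[OF intN[of 0 t]] st by (simp add: N_def w_def)
    next
      case False
      then show ?thesis using le by (simp add: power2_eq_square w_def)
    qed
  qed
  have contN: "continuous_on {0..T} N"
    unfolding N_def[abs_def] by (rule indefinite_integral_continuous_1[OF intN]) simp
  have cont: "continuous_on {0..T} p"
    unfolding continuous_on_iff
  proof (intro ballI allI impI)
    fix t e :: real assume t: "t \<in> {0..T}" and "e > 0"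
    then obtain d where d: "d > 0" "\<And>s. s \<in> {0..T} \<Longrightarrow> dist s t < d \<Longrightarrow> dist (N s) (N t) < e"
      using contN unfolding continuous_on_iff by metis
    have "dist (p s) (p t) < e" if s: "s \<in> {0..T}" "dist s t < d" for s
      using d(2)[OF s] N[OF s(1) t] N[OF t s(1)]
      by (cases "s \<le> t") (auto simp: dist_norm norm_minus_commute)
    then show "\<exists>d>0. \<forall>s\<in>{0..T}. dist s t < d \<longrightarrow> dist (p s) (p t) < e" using d(1) by blast
  qed
  \<comment> \<open>Paired with \<open>R v\<close>, the merely integrable \<open>uh\<close> may be
    replaced by the continuous \<open>U\<close>; the fundamental theorem then holds at every point
    and not just almost everywhere.\<close>
  have pR: "p t \<bullet> R v = integral {0..t} (\<lambda>s. U s \<bullet> J v)" if v: "v \<in> G" and t: "t \<in> {0..T}" for v t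
  proof -
    have "AE s in M. uh s \<bullet> R v = U s \<bullet> J v"
      using ae by (rule AE_mp) (use v L2_D(1)[OF uh] in \<open>auto simp: R_inner'\<close>)
    then have "AE s in lebesgue. s \<in> {0..T} \<longrightarrow> uh s \<bullet> R v = U s \<bullet> J v"
      by (subst (asm) AE_restrict_space_iff) auto
    then obtain Z where Z: "Z \<in> null_sets lebesgue" "{s. \<not> (s \<in> {0..T} \<longrightarrow> uh s \<bullet> R v = U s \<bullet> J v)} \<subseteq> Z"
      by (auto simp: eventually_ae_filter)
    have "integral {0..t} (\<lambda>s. uh s \<bullet> R v) = integral {0..t} (\<lambda>s. U s \<bullet> J v)"
      by (rule integral_spike[of Z]) (use Z t in \<open>auto simp: negligible_iff_null_sets\<close>)
    then show ?thesis using p(2)[OF t R_in] by simp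
  qed
  have deriv: "((\<lambda>t. p t \<bullet> R v) has_real_derivative U t \<bullet> J v) (at t within {0..T})"
    if v: "v \<in> G" and t: "t \<in> {0..T}" for v t
  proof -
    have "((\<lambda>t. integral {0..t} (\<lambda>s. U s \<bullet> J v)) has_real_derivative U t \<bullet> J v) (at t within {0..T})"
      by (rule integral_has_real_derivative) (intro continuous_intros U, rule t)
    then show ?thesis
      by (rule has_field_derivative_transform_within[where d = 1]) (use t pR[OF v] in simp_all)
  qed
  have pz: "p t = 0" if "t \<in> {0..T}" for t
  proof (rule weak_ode_zero[OF p(1) cont bounded_linear_minus[OF A'] _ _ _ that])
    show "((\<lambda>t. p t \<bullet> R v) has_real_derivative p t \<bullet> - A' v) (at t within {0..T})"
      if "v \<in> G" "t \<in> {0..T}" for v t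
      using deriv[OF that] eq[OF that] p(2)[OF that(2) A'_in] by simp
    show "x \<bullet> - A' x \<le> \<mu> * (norm (J x))\<^sup>2" if "x \<in> G" for x
    proof -
      have "0 \<le> \<alpha> * (norm x)\<^sup>2" using \<alpha>_pos by simp
      then show ?thesis using garding[OF that] A_adjoint[OF that that] by simp
    qed
    have "p 0 \<bullet> p 0 = 0" using p(2)[of 0 "p 0"] p(1)[of 0] T_pos by simp
    then show "p 0 = 0" by simp
  qed
  have "U t \<bullet> J v = 0" if v: "v \<in> G" for v
    using eq[OF v t] p(2)[OF t A'_in[of v]] pz[OF t] by simp
  then have "J ` G \<subseteq> {x. U t \<bullet> x = 0}" by auto
  then have "closure (J ` G) \<subseteq> {x. U t \<bullet> x = 0}"
    by (rule closure_minimal) (rule closed_hyperplane)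
  then show "U t = 0" using U(2)[OF t] by auto
qed

end

section \<open>Test functions and weak derivatives\<close>

text \<open>Smoothness without formulas for higher derivatives: a class of functions in which every
  member has its derivative in the class contains all iterated derivatives.\<close>

lemma iterated_deriv_differentiable:
  assumes closed: "\<And>f. f \<in> \<S> \<Longrightarrow> \<exists>f'\<in>\<S>. \<forall>t. (f has_real_derivative f' t) (at t)" and f: "f \<in> \<S>"
  shows "((deriv ^^ n) f) differentiable_on UNIV"
proof -
  have "(deriv ^^ n) f \<in> \<S>"
  proof (induction n)
    case (Suc n)
    then obtain f' where "f' \<in> \<S>" "\<And>t. ((deriv ^^ n) f has_real_derivative f' t) (at t)"
      using closed by blast
    moreover from this have "deriv ((deriv ^^ n) f) = f'" by (auto intro: DERIV_imp_deriv)
    ultimately show ?case by simp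
  qed (simp add: f)
  then show ?thesis
    using closed by (fastforce simp: differentiable_on_def real_differentiable_def)
qed

definition bump_poly :: "real poly" where "bump_poly = [:0, 1, -1:]"

text \<open>
  The functions \<open>p t / s\<^sup>m * exp (- 1 / s)\<close> on the unit interval, where \<open>s = t * (1 - t)\<close> and \<open>p\<close> is
  a polynomial, form a class that is closed under differentiation.
\<close>

definition bump :: "nat \<Rightarrow> real poly \<Rightarrow> real \<Rightarrow> real"
  where "bump m p t = (if 0 < t \<and> t < 1
    then poly p t / poly bump_poly t ^ m * exp (- 1 / poly bump_poly t) else 0)"

text \<open>The numerator of the derivative over the common denominator \<open>s^(m + 2)\<close>:
  the terms come from \<open>p\<close>, from the power of \<open>s\<close> and from the
  exponential.\<close>

definition bump_deriv :: "nat \<Rightarrow> real poly \<Rightarrow> real poly"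
  where "bump_deriv m p = pderiv p * bump_poly\<^sup>2 - smult (real m) (p * pderiv bump_poly * bump_poly)
    + p * pderiv bump_poly"

lemma bump_poly_eq: "poly bump_poly t = t * (1 - t)"
  by (simp add: bump_poly_def algebra_simps)

text \<open>The exponential beats every power of \<open>s\<close>. The remaining second power is
  what makes the difference quotient at 0 and at 1 tend to zero.\<close>

lemma bump_bound:
  obtains C where "\<And>t. \<bar>bump m p t\<bar> \<le> C * (t * (1 - t))\<^sup>2"
proof -
  have "continuous_on {0..1} (poly p)" by (intro continuous_intros)
  from compact_imp_bounded[OF compact_continuous_image[OF this compact_Icc]]
  obtain K where K: "\<And>t. t \<in> {0..1} \<Longrightarrow> \<bar>poly p t\<bar> \<le> K"
    unfolding bounded_iff by (metis imageI real_norm_def)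
  have K0: "0 \<le> K" using K[of 0] by simp
  \<comment> \<open>In \<open>(1 + x / n)^n \<le> exp x\<close> with \<open>x = 1 / s\<close>, the
    exponent provides \<open>m\<close> powers of \<open>s\<close> to cancel the denominator and two
    to spare.\<close>
  define n where "n = m + 2"
  have "\<bar>bump m p t\<bar> \<le> K * real n ^ n * (t * (1 - t))\<^sup>2" for t
  proof (cases "0 < t \<and> t < 1")
    case True
    define s where "s = t * (1 - t)"
    have s: "0 < s" using True by (simp add: s_def)
    have "(1 / (s * real n)) ^ n \<le> (1 + (1 / s) / real n) ^ n"
      using s by (intro power_mono) auto
    also have "\<dots> \<le> exp (1 / s)"
      by (rule exp_ge_one_plus_x_over_n_power_n) (use s in \<open>auto simp: n_def intro: order_trans[of _ 0]\<close>)
    finally have "1 / exp (1 / s) \<le> 1 / (1 / (s * real n)) ^ n"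
      using s by (intro divide_left_mono) (auto simp: n_def)
    then have e: "exp (- 1 / s) \<le> (s * real n) ^ n"
      by (simp add: power_one_over exp_minus field_simps)
    have "\<bar>bump m p t\<bar> = \<bar>poly p t\<bar> / s ^ m * exp (- 1 / s)"
      using True s by (simp add: bump_def bump_poly_eq s_def[symmetric] abs_mult)
    also have "\<dots> \<le> K / s ^ m * (s * real n) ^ n"
      using K[of t] True s e K0 by (intro mult_mono divide_right_mono) auto
    also have "\<dots> = K * real n ^ n * s\<^sup>2"
    proof -
      have "s ^ n = s ^ m * s\<^sup>2" unfolding n_def by (rule power_add)
      then show ?thesis unfolding power_mult_distrib using s by (simp add: power2_eq_square)
    qed
    finally show ?thesis by (simp add: s_def)
  next
    case False
    then have "bump m p t = 0" unfolding bump_def by (rule if_not_P)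
    then show ?thesis using K0 by simp
  qed
  with that show ?thesis by blast
qed

lemma bump_has_derivative: "(bump m p has_real_derivative bump (m + 2) (bump_deriv m p) t) (at t)"
proof -
  consider "0 < t \<and> t < 1" | "t < 0 \<or> t > 1" | "t = 0 \<or> t = 1" by linarith
  then show ?thesis
  proof cases
    case 1
    let ?s = "poly bump_poly"
    have s: "?s t \<noteq> 0" using 1 by (simp add: bump_poly_eq)
    have d1: "((\<lambda>t. 1 / ?s t ^ m) has_real_derivative - real m * poly (pderiv bump_poly) t / ?s t ^ (m + 1)) (at t)"
    proof (cases m)
      case (Suc k)
      show ?thesis unfolding Suc
        by (rule derivative_eq_intros poly_DERIV refl s power_not_zero)+
           (use s in \<open>simp add: field_simps power2_eq_square\<close>)
    qed simp
    have d2: "((\<lambda>t. exp (- 1 / ?s t)) has_real_derivative exp (- 1 / ?s t) * (poly (pderiv bump_poly) t / (?s t)\<^sup>2)) (at t)"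
      by (rule derivative_eq_intros poly_DERIV refl s)+ (use s in \<open>simp add: field_simps power2_eq_square\<close>)
    have "((\<lambda>t. poly p t * (1 / ?s t ^ m) * exp (- 1 / ?s t)) has_real_derivative
        (poly (pderiv p) t * (1 / ?s t ^ m) + (- real m * poly (pderiv bump_poly) t / ?s t ^ (m + 1)) * poly p t)
          * exp (- 1 / ?s t)
        + exp (- 1 / ?s t) * (poly (pderiv bump_poly) t / (?s t)\<^sup>2) * (poly p t * (1 / ?s t ^ m))) (at t)"
      by (intro DERIV_mult d1 d2 poly_DERIV)
    also have "(poly (pderiv p) t * (1 / ?s t ^ m) + (- real m * poly (pderiv bump_poly) t / ?s t ^ (m + 1)) * poly p t)
          * exp (- 1 / ?s t)
        + exp (- 1 / ?s t) * (poly (pderiv bump_poly) t / (?s t)\<^sup>2) * (poly p t * (1 / ?s t ^ m))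
        = bump (m + 2) (bump_deriv m p) t"
      using 1 s by (simp add: bump_def bump_deriv_def field_simps power_add power2_eq_square)
    finally show ?thesis
      by (rule has_field_derivative_transform_within_open[of _ _ _ "{0<..<1}"]) (use 1 in \<open>auto simp: bump_def\<close>)
  next
    case 2
    have "((\<lambda>_. 0) has_real_derivative bump (m + 2) (bump_deriv m p) t) (at t)"
      using 2 by (auto simp: bump_def)
    then show ?thesis
      by (rule has_field_derivative_transform_within_open[of _ _ _ "- {0..1}"]) (use 2 in \<open>auto simp: bump_def\<close>)
  next
    case 3
    obtain C where C: "\<And>t. \<bar>bump m p t\<bar> \<le> C * (t * (1 - t))\<^sup>2" using bump_bound[of m p] by blast
    \<comment> \<open>One formula for both end points, so that \<open>t = 0\<close> and
      \<open>t = 1\<close> are treated together.\<close>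
    have eq: "(x * (1 - x))\<^sup>2 = (x - t)\<^sup>2 * (1 - t - x)\<^sup>2" for x
      using 3 by (auto simp: power2_eq_square algebra_simps)
    have "((\<lambda>x. (bump m p x - bump m p t) / (x - t)) \<longlongrightarrow> 0) (at t)"
    proof (rule Lim_null_comparison)
      show "((\<lambda>x. C * \<bar>x - t\<bar> * (1 - t - x)\<^sup>2) \<longlongrightarrow> 0) (at t)"
        by (auto intro!: tendsto_eq_intros)
      have "norm ((bump m p x - bump m p t) / (x - t)) \<le> C * \<bar>x - t\<bar> * (1 - t - x)\<^sup>2" if "x \<noteq> t" for x
      proof -
        have "norm ((bump m p x - bump m p t) / (x - t)) = \<bar>bump m p x\<bar> / \<bar>x - t\<bar>"
          using 3 by (auto simp: bump_def)
        also have "\<dots> \<le> C * (x * (1 - x))\<^sup>2 / \<bar>x - t\<bar>" by (rule divide_right_mono[OF C]) simp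
        also have "\<dots> = C * (1 - t - x)\<^sup>2 * ((x - t)\<^sup>2 / \<bar>x - t\<bar>)" by (simp add: eq)
        also have "\<dots> = C * \<bar>x - t\<bar> * (1 - t - x)\<^sup>2" unfolding power2_div_abs by simp
        finally show ?thesis .
      qed
      then show "\<forall>\<^sub>F x in at t. norm ((bump m p x - bump m p t) / (x - t)) \<le> C * \<bar>x - t\<bar> * (1 - t - x)\<^sup>2"
        by (auto simp: eventually_at_filter)
    qed
    then show ?thesis using 3 by (auto simp: has_field_derivative_iff bump_def)
  qed
qed

text \<open>The normalised primitive of a bump. That \<open>\<rho>\<close> is a multiple of some
  \<open>bump 0 p\<close> is recorded because it is the source of smoothness for test functions
  built from \<open>S\<close>.\<close>

lemma smooth_step_exists:
  obtains S \<rho> :: "real \<Rightarrow> real" where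
    "\<And>t. (S has_real_derivative \<rho> t) (at t)" "\<And>t. t \<le> 0 \<Longrightarrow> S t = 0" "\<And>t. t \<ge> 1 \<Longrightarrow> S t = 1"
    "\<And>t. 0 \<le> S t" "\<And>t. S t \<le> 1" "\<And>t. 0 \<le> \<rho> t" "\<And>t. t \<notin> {0..1} \<Longrightarrow> \<rho> t = 0"
    "\<exists>p c. \<rho> = (\<lambda>t. c * bump 0 p t)"
proof -
  let ?b = "bump 0 1"
  have cont: "continuous_on UNIV ?b"
    by (rule DERIV_continuous_on) (rule has_field_derivative_at_within[OF bump_has_derivative])
  have b0: "0 \<le> ?b t" "t \<notin> {0..1} \<Longrightarrow> ?b t = 0" "t \<le> 0 \<Longrightarrow> ?b t = 0" "t \<ge> 1 \<Longrightarrow> ?b t = 0" for t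
    by (auto simp: bump_def)
  \<comment> \<open>Starting at -1, left of the support, makes 0 an interior point of the interval
    of integration. For \<open>t < -1\<close> the interval is empty and the integral is 0.\<close>
  define B where "B t = integral {-1..t} ?b" for t
  have Bneg: "B t = 0" if "t \<le> 0" for t
  proof -
    have "B t = integral {-1..t} (\<lambda>_. 0)"
      unfolding B_def by (rule integral_cong) (use b0 that in auto)
    then show ?thesis by simp
  qed
  have B: "(B has_real_derivative ?b t) (at t)" for t
  proof (cases "t > -1")
    case True
    have "(B has_real_derivative ?b t) (at t within {-1..t + 1})"
      unfolding B_def[abs_def]
      by (rule integral_has_real_derivative) (use True in \<open>auto intro: continuous_on_subset[OF cont]\<close>)
    moreover have "at t within {-1..t + 1} = at t" by (rule at_within_interior) (use True in simp)
    ultimately show ?thesis by simp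
  next
    case False
    have "((\<lambda>_. 0) has_real_derivative ?b t) (at t)" using b0(3)[of t] False by simp
    then show ?thesis
      by (rule has_field_derivative_transform_within_open[of _ _ _ "{..<0}"]) (use False Bneg in auto)
  qed
  have Bpos: "B 1 > 0"
  proof -
    have "B 0 < B 1"
    proof (rule DERIV_pos_imp_increasing_open[of 0 1 B])
      show "\<exists>y. DERIV B x :> y \<and> 0 < y" if "0 < x" "x < 1" for x
        using B[of x] that by (intro exI[of _ "?b x"]) (auto simp: bump_def)
      show "continuous_on {0..1} B"
        using B by (intro DERIV_atLeastAtMost_imp_continuous_on) blast
    qed simp
    then show ?thesis using Bneg[of 0] by simp
  qed
  have mono: "B s \<le> B t" if "s \<le> t" for s t
    by (rule DERIV_nonneg_imp_nondecreasing[OF that]) (use B b0 in blast)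
  have B1: "B t = B 1" if t: "t \<ge> 1" for t
  proof (cases "t = 1")
    case False
    then obtain z where "B t - B 1 = (t - 1) * ?b z" "z > 1"
      using MVT2[of 1 t B ?b] B t by auto
    then show ?thesis using b0(4)[of z] by simp
  qed simp
  show ?thesis
  proof (rule that[of "\<lambda>t. B t / B 1" "\<lambda>t. ?b t / B 1"])
    show "((\<lambda>t. B t / B 1) has_real_derivative ?b t / B 1) (at t)" for t
      by (rule DERIV_cdivide[OF B])
    show "0 \<le> B t / B 1" for t
      using mono[of t 0] mono[of 0 t] Bneg[of t] Bneg[of 0] Bpos by (cases "t \<le> 0") auto
    show "B t / B 1 \<le> 1" for t
      using mono[of t 1] B1[of t] Bpos by (cases "t \<le> 1") auto
    show "\<exists>p c. (\<lambda>t. ?b t / B 1) = (\<lambda>t. c * bump 0 p t)"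
      by (intro exI[of _ 1] exI[of _ "1 / B 1"]) simp
    show "B t / B 1 = 0" if "t \<le> 0" for t using Bneg[OF that] by simp
    show "B t / B 1 = 1" if "t \<ge> 1" for t using B1[OF that] Bpos by simp
    show "0 \<le> ?b t / B 1" for t using b0(1)[of t] Bpos by simp
    show "?b t / B 1 = 0" if "t \<notin> {0..1}" for t using b0(2)[OF that] by simp
  qed
qed

text \<open>The kernel has mass 1 and lives on an interval of length \<open>1 / k\<close> touching
  \<open>c\<close>. The shift \<open>\<theta>\<close> selects the side: 0 puts it to the right of
  \<open>c\<close>, 1 to the left.\<close>

lemma approximate_identity:
  fixes P \<rho> S :: "real \<Rightarrow> real"
  assumes S: "\<And>t. (S has_real_derivative \<rho> t) (at t)" "\<And>t. t \<le> 0 \<Longrightarrow> S t = 0" "\<And>t. t \<ge> 1 \<Longrightarrow> S t = 1"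
    and \<rho>: "\<And>t. 0 \<le> \<rho> t" "\<And>t. t \<notin> {0..1} \<Longrightarrow> \<rho> t = 0" "continuous_on UNIV \<rho>"
    and P: "continuous_on {0..T} P" and c: "c \<in> {0<..<T}" and \<theta>: "\<theta> \<in> {0..1}"
  shows "(\<lambda>k. integral {0..T} (\<lambda>t. real k * \<rho> (real k * (t - c) + \<theta>) * P t)) \<longlonglongrightarrow> P c"
proof (rule LIMSEQ_I)
  fix e :: real assume e: "e > 0"
  then obtain d where d: "d > 0" "\<And>t. t \<in> {0..T} \<Longrightarrow> dist t c < d \<Longrightarrow> dist (P t) (P c) < e / 2"
    using P c unfolding continuous_on_iff by (metis greaterThanLessThan_iff atLeastAtMost_iff half_gt_zero less_imp_le)
  \<comment> \<open>A kernel of width below \<open>\<eta>\<close> stays inside the interval, so none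
    of its mass is lost, and stays within the continuity radius \<open>d\<close>.\<close>
  define \<eta> where "\<eta> = min d (min c (T - c))"
  have \<eta>: "\<eta> > 0" using d c by (simp add: \<eta>_def)
  obtain k0 :: nat where k0: "1 / \<eta> < real k0" using reals_Archimedean2 by blast
  have "norm (integral {0..T} (\<lambda>t. real k * \<rho> (real k * (t - c) + \<theta>) * P t) - P c) < e" if k: "k \<ge> k0" for k
  proof -
    let ?r = "\<lambda>t. real k * \<rho> (real k * (t - c) + \<theta>)"
    have k1: "1 / \<eta> < real k" using k0 k by linarith
    then have kpos: "real k > 0" using \<eta> by (smt (verit) divide_pos_pos)
    have k2: "1 < real k * \<eta>" using k1 \<eta> by (simp add: field_simps)
    have cr: "continuous_on X ?r" for X
      by (intro continuous_intros continuous_on_compose2[OF \<rho>(3)]) auto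
    have "(?r has_integral (S (real k * (T - c) + \<theta>) - S (real k * (0 - c) + \<theta>))) {0..T}"
    proof (rule fundamental_theorem_of_calculus)
      fix t
      have "((\<lambda>t. real k * (t - c) + \<theta>) has_real_derivative real k) (at t)"
        by (auto intro!: derivative_eq_intros)
      from DERIV_chain2[OF S(1) this]
      have "((\<lambda>t. S (real k * (t - c) + \<theta>)) has_real_derivative ?r t) (at t)"
        by (simp add: mult.commute)
      then show "((\<lambda>t. S (real k * (t - c) + \<theta>)) has_vector_derivative ?r t) (at t within {0..T})"
        by (simp add: has_real_derivative_iff_has_vector_derivative has_vector_derivative_at_within)
    qed (use c in auto)
    moreover have "S (real k * (T - c) + \<theta>) = 1"
    proof (rule S(3))
      have "real k * \<eta> \<le> real k * (T - c)" using kpos by (intro mult_left_mono) (auto simp: \<eta>_def)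
      then show "1 \<le> real k * (T - c) + \<theta>" using k2 \<theta> by auto
    qed
    moreover have "S (real k * (0 - c) + \<theta>) = 0"
    proof (rule S(2))
      have "real k * \<eta> \<le> real k * c" using kpos by (intro mult_left_mono) (auto simp: \<eta>_def)
      then show "real k * (0 - c) + \<theta> \<le> 0" using k2 \<theta> by auto
    qed
    ultimately have r1: "(?r has_integral 1) {0..T}" by simp
    have rP: "((\<lambda>t. ?r t * P t) has_integral integral {0..T} (\<lambda>t. ?r t * P t)) {0..T}"
      by (intro integrable_integral integrable_continuous_real continuous_intros cr P)
    have diff: "((\<lambda>t. ?r t * P t - ?r t * P c) has_integral (integral {0..T} (\<lambda>t. ?r t * P t) - 1 * P c)) {0..T}"
      by (intro has_integral_diff rP has_integral_mult_left r1)
    moreover have half: "((\<lambda>t. ?r t * (e / 2)) has_integral (1 * (e / 2))) {0..T}"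
      by (intro has_integral_mult_left r1)
    moreover have "norm (?r t * P t - ?r t * P c) \<le> ?r t * (e / 2)" if t: "t \<in> {0..T}" for t
    proof (cases "real k * (t - c) + \<theta> \<in> {0..1}")
      case True
      then have "\<bar>real k * (t - c)\<bar> \<le> 1" using \<theta> unfolding abs_le_iff atLeastAtMost_iff by linarith
      then have "real k * \<bar>t - c\<bar> \<le> 1" by (simp add: abs_mult)
      then have "real k * \<bar>t - c\<bar> < real k * \<eta>" using k2 by linarith
      then have "dist t c < d" using kpos by (simp add: dist_real_def \<eta>_def)
      then have "\<bar>P t - P c\<bar> \<le> e / 2" using d(2)[OF t] by (simp add: dist_real_def)
      moreover have "0 \<le> ?r t" using kpos \<rho>(1) by simp
      ultimately have "?r t * \<bar>P t - P c\<bar> \<le> ?r t * (e / 2)" by (intro mult_left_mono)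
      moreover have "norm (?r t * P t - ?r t * P c) = ?r t * \<bar>P t - P c\<bar>"
        by (simp add: abs_mult abs_of_nonneg[OF \<rho>(1)] flip: right_diff_distrib)
      ultimately show ?thesis by simp
    next
      case False
      then show ?thesis using \<rho>(2) by simp
    qed
    ultimately have "norm (integral {0..T} (\<lambda>t. ?r t * P t - ?r t * P c)) \<le> integral {0..T} (\<lambda>t. ?r t * (e / 2))"
      by (intro integral_norm_bound_integral has_integral_integrable)
    then have "norm (integral {0..T} (\<lambda>t. ?r t * P t) - 1 * P c) \<le> 1 * (e / 2)"
      using diff half by (simp only: integral_unique)
    then show ?thesis using e by simp
  qed
  then show "\<exists>no. \<forall>k\<ge>no. norm (integral {0..T} (\<lambda>t. real k * \<rho> (real k * (t - c) + \<theta>) * P t) - P c) < e"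
    by blast
qed
text \<open>Test with smooth plateaus that tend to the indicator of an open interval between
  \<open>a\<close> and \<open>b\<close>: their derivatives act on \<open>P\<close> in the limit as
  evaluation at \<open>a\<close> minus evaluation at \<open>b\<close>.\<close>

lemma integral_eq_if_weak_derivative:
  assumes T: "0 < T" and P: "continuous_on {0..T} P" and Q: "integrable (lebesgue_on {0..T}) Q"
    and weak: "\<And>\<phi>. test_function {0..T} \<phi> \<Longrightarrow>
      (\<integral>t. deriv \<phi> t * P t \<partial>lebesgue_on {0..T}) = - (\<integral>t. \<phi> t * Q t \<partial>lebesgue_on {0..T})"
    and t: "t \<in> {0..T}"
  shows "P t - P 0 = integral {0..t} Q"
proof -
  let ?M = "lebesgue_on {0..T}"
  obtain S \<rho> where S: "\<And>t. (S has_real_derivative \<rho> t) (at t)" "\<And>t. t \<le> 0 \<Longrightarrow> S t = 0" "\<And>t. t \<ge> 1 \<Longrightarrow> S t = 1"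
    "\<And>t. 0 \<le> S t" "\<And>t. S t \<le> 1"
    and \<rho>: "\<And>t. 0 \<le> \<rho> t" "\<And>t. t \<notin> {0..1} \<Longrightarrow> \<rho> t = 0" and "\<exists>p c. \<rho> = (\<lambda>t. c * bump 0 p t)"
    by (rule smooth_step_exists) (rule that; assumption)
  then obtain p0 c0 where \<rho>_eq: "\<rho> = (\<lambda>t. c0 * bump 0 p0 t)" by blast
  have c\<rho>: "continuous_on UNIV \<rho>"
    unfolding \<rho>_eq
    by (intro continuous_intros DERIV_continuous_on) (rule has_field_derivative_at_within[OF bump_has_derivative])
  have iQ: "Q integrable_on {0..T}" by (rule integrable_on_if_lebesgue_on[OF Q])
  have diff: "P b - P a = integral {a..b} Q" if ab: "0 < a" "a < b" "b < T" for a b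
  proof -
    \<comment> \<open>The rise starts at \<open>a\<close> and the fall is over at \<open>b\<close>;
      the summand 1 shifts the second step to the left so that the support stays in
      \<open>{a..b}\<close>.\<close>
    define \<phi> where "\<phi> k t = S (real k * (t - a)) - S (real k * (t - b) + 1)" for k t
    define \<phi>' where "\<phi>' k t = real k * \<rho> (real k * (t - a) + 0) - real k * \<rho> (real k * (t - b) + 1)" for k t
    have d\<phi>: "(\<phi> k has_real_derivative \<phi>' k t) (at t)" for k t
    proof -
      have "((\<lambda>t. real k * (t - c) + \<theta>) has_real_derivative real k) (at t)" for c \<theta>
        by (auto intro!: derivative_eq_intros)
      from DERIV_diff[OF DERIV_chain2[OF S(1) this[of a 0]] DERIV_chain2[OF S(1) this[of b 1]]]
      show ?thesis by (simp add: \<phi>_def[abs_def] \<phi>'_def mult.commute)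
    qed
    have test: "test_function {0..T} (\<phi> k)" if k: "1 \<le> real k * (b - a)" for k
      unfolding test_function_def
    proof (intro conjI allI)
      \<comment> \<open>The plateau is not itself a combination of bumps, but its derivative is one,
        and combinations of two bumps at these two positions are closed under
        differentiation.\<close>
      define \<S> where "\<S> = insert (\<phi> k) {(\<lambda>t. c1 * bump m1 p1 (real k * (t - a) + 0) + c2 * bump m2 p2 (real k * (t - b) + 1))
        |c1 m1 p1 c2 m2 p2. True}"
      show "((deriv ^^ n) (\<phi> k)) differentiable_on UNIV" for n
      proof (rule iterated_deriv_differentiable[of \<S>])
        fix f assume "f \<in> \<S>"
        then consider "f = \<phi> k" | c1 m1 p1 c2 m2 p2 where
          "f = (\<lambda>t. c1 * bump m1 p1 (real k * (t - a) + 0) + c2 * bump m2 p2 (real k * (t - b) + 1))"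
          unfolding \<S>_def by auto
        then show "\<exists>f'\<in>\<S>. \<forall>t. (f has_real_derivative f' t) (at t)"
        proof cases
          case 1
          have "\<phi>' k = (\<lambda>t. (real k * c0) * bump 0 p0 (real k * (t - a) + 0)
              + (- real k * c0) * bump 0 p0 (real k * (t - b) + 1))"
            by (simp add: \<phi>'_def[abs_def] \<rho>_eq mult_ac)
          then have "\<phi>' k \<in> \<S>" unfolding \<S>_def by blast
          then show ?thesis using 1 d\<phi> by blast
        next
          case 2
          let ?f' = "\<lambda>t. (c1 * real k) * bump (m1 + 2) (bump_deriv m1 p1) (real k * (t - a) + 0)
            + (c2 * real k) * bump (m2 + 2) (bump_deriv m2 p2) (real k * (t - b) + 1)"
          have "(f has_real_derivative ?f' t) (at t)" for t
          proof -
            have "((\<lambda>t. real k * (t - c) + \<theta>) has_real_derivative real k) (at t)" for c \<theta>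
              by (auto intro!: derivative_eq_intros)
            from DERIV_add[OF DERIV_cmult[OF DERIV_chain2[OF bump_has_derivative this[of a 0]], of c1 m1 p1]
                DERIV_cmult[OF DERIV_chain2[OF bump_has_derivative this[of b 1]], of c2 m2 p2]]
            show ?thesis unfolding 2 by (simp add: mult_ac)
          qed
          moreover have "?f' \<in> \<S>" unfolding \<S>_def by blast
          ultimately show ?thesis by (intro bexI[of _ ?f'] allI)
        qed
      qed (simp add: \<S>_def)
      have "\<phi> k t = 0" if "t \<notin> {a..b}" for t
      proof (cases "t < a")
        case True
        have "real k * (t - a) \<le> 0" using True by (simp add: mult_nonneg_nonpos)
        moreover have "real k * (t - b) + 1 \<le> 0"
        proof -
          have "real k * (t - b) \<le> real k * (a - b)" using True by (intro mult_left_mono) auto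
          then show ?thesis using k by (simp add: algebra_simps)
        qed
        ultimately show ?thesis by (simp add: \<phi>_def S(2))
      next
        case False
        then have "t > b" using that by auto
        then have "real k * (b - a) \<le> real k * (t - a)" "0 \<le> real k * (t - b)" by (auto intro: mult_left_mono)
        then show ?thesis using k S(3) by (simp add: \<phi>_def)
      qed
      then show "\<exists>K. compact K \<and> K \<subseteq> interior {0..T} \<and> (\<forall>t. t \<notin> K \<longrightarrow> \<phi> k t = 0)"
        using ab by (intro exI[of _ "{a..b}"]) auto
    qed
    \<comment> \<open>For such \<open>k\<close> the rise is complete before the fall begins.\<close>
    have ev: "\<forall>\<^sub>F k in sequentially. 1 \<le> real k * (b - a)"
    proof -
      obtain k0 :: nat where k0: "1 / (b - a) < real k0" using reals_Archimedean2 by blast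
      have "1 \<le> real k * (b - a)" if "k \<ge> k0" for k
      proof -
        have "1 / (b - a) \<le> real k" using k0 that by linarith
        then show ?thesis using ab by (simp add: field_simps)
      qed
      then show ?thesis by (auto simp: eventually_sequentially)
    qed
    have cr: "continuous_on X (\<lambda>t. real k * \<rho> (real k * (t - c) + \<theta>))" for X k c \<theta>
      by (intro continuous_intros continuous_on_compose2[OF c\<rho>]) auto
    have "(\<lambda>k. integral {0..T} (\<lambda>t. real k * \<rho> (real k * (t - a) + 0) * P t)
        - integral {0..T} (\<lambda>t. real k * \<rho> (real k * (t - b) + 1) * P t)) \<longlonglongrightarrow> P a - P b"
      using ab by (intro tendsto_diff approximate_identity[OF S(1-3) \<rho> c\<rho> P]) auto
    moreover have "integral {0..T} (\<lambda>t. real k * \<rho> (real k * (t - a) + 0) * P t)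
        - integral {0..T} (\<lambda>t. real k * \<rho> (real k * (t - b) + 1) * P t) = (\<integral>t. deriv (\<phi> k) t * P t \<partial>?M)" for k
    proof -
      have "deriv (\<phi> k) = \<phi>' k" by (rule ext) (rule DERIV_imp_deriv[OF d\<phi>])
      moreover have "(\<integral>t. \<phi>' k t * P t \<partial>?M) = integral {0..T} (\<lambda>t. \<phi>' k t * P t)"
        unfolding \<phi>'_def
        by (intro lebesgue_integral_eq_integral continuous_imp_integrable_real continuous_on_mult
            continuous_on_diff cr P) simp
      moreover have "integral {0..T} (\<lambda>t. \<phi>' k t * P t) = integral {0..T} (\<lambda>t. real k * \<rho> (real k * (t - a) + 0) * P t)
        - integral {0..T} (\<lambda>t. real k * \<rho> (real k * (t - b) + 1) * P t)"
        unfolding \<phi>'_def left_diff_distrib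
        by (intro Henstock_Kurzweil_Integration.integral_diff integrable_continuous_real continuous_on_mult cr P)
      ultimately show ?thesis by simp
    qed
    ultimately have l1: "(\<lambda>k. \<integral>t. deriv (\<phi> k) t * P t \<partial>?M) \<longlonglongrightarrow> P a - P b" by simp
    have c\<phi>: "continuous_on X (\<phi> k)" for X k
      by (rule DERIV_continuous_on) (rule has_field_derivative_at_within[OF d\<phi>])
    let ?ind = "\<lambda>t. if t \<in> {a<..<b} then 1 else 0 :: real"
    have mind: "(\<lambda>t. ?ind t * Q t) \<in> borel_measurable ?M"
    proof (rule borel_measurable_times[OF _ borel_measurable_integrable[OF Q]], rule measurable_If_set)
      show "{a<..<b} \<inter> space ?M \<in> sets ?M" by (subst sets_restrict_space_iff) auto
    qed simp_all
    have \<phi>lim: "(\<lambda>k. \<phi> k t) \<longlonglongrightarrow> ?ind t" for t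
    proof -
      consider "t \<le> a" | "a < t \<and> t < b" | "b \<le> t" by linarith
      then have "\<forall>\<^sub>F k in sequentially. \<phi> k t = ?ind t"
      proof cases
        case 1
        show ?thesis using ev
        proof eventually_elim
          case (elim k)
          have "real k * (t - b) \<le> real k * (a - b)" using 1 by (intro mult_left_mono) auto
          then have "real k * (t - b) + 1 \<le> 0" using elim by (simp add: algebra_simps)
          then show ?case using 1 by (simp add: \<phi>_def S(2) mult_nonneg_nonpos)
        qed
      next
        case 2
        obtain k0 :: nat where k0: "1 / min (t - a) (b - t) < real k0" using reals_Archimedean2 by blast
        have "\<phi> k t = 1" if "k \<ge> k0" for k
        proof -
          have "1 / min (t - a) (b - t) \<le> real k" using k0 that by linarith
          then have m: "1 \<le> real k * min (t - a) (b - t)" using 2 by (simp add: field_simps)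
          have "real k * min (t - a) (b - t) \<le> real k * (t - a)"
            "real k * min (t - a) (b - t) \<le> real k * (b - t)" by (auto intro: mult_left_mono)
          then have "1 \<le> real k * (t - a)" "real k * (t - b) + 1 \<le> 0"
            using m by (auto simp: algebra_simps)
          then show ?thesis by (simp add: \<phi>_def S(2,3))
        qed
        then show ?thesis using 2 by (auto simp: eventually_sequentially)
      next
        case 3
        show ?thesis using ev
        proof eventually_elim
          case (elim k)
          have "real k * (b - a) \<le> real k * (t - a)" using 3 by (intro mult_left_mono) auto
          then have "1 \<le> real k * (t - a)" using elim by linarith
          then show ?case using 3 by (simp add: \<phi>_def S(3))
        qed
      qed
      then show ?thesis by (rule tendsto_eventually)
    qed
    have "(\<lambda>k. \<integral>t. \<phi> k t * Q t \<partial>?M) \<longlonglongrightarrow> (\<integral>t. ?ind t * Q t \<partial>?M)"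
    proof (rule integral_dominated_convergence[where w = "\<lambda>t. \<bar>Q t\<bar>"])
      show "(\<lambda>t. ?ind t * Q t) \<in> borel_measurable ?M" by (rule mind)
      show "(\<lambda>t. \<phi> k t * Q t) \<in> borel_measurable ?M" for k
        by (intro borel_measurable_integrable integrable_continuous_mult Q c\<phi>)
      show "AE t in ?M. (\<lambda>k. \<phi> k t * Q t) \<longlonglongrightarrow> ?ind t * Q t"
        by (intro AE_I2 tendsto_mult_right \<phi>lim)
      show "AE t in ?M. norm (\<phi> k t * Q t) \<le> \<bar>Q t\<bar>" for k
      proof (rule AE_I2)
        fix t
        have "\<bar>\<phi> k t\<bar> \<le> 1"
          unfolding \<phi>_def abs_le_iff
          using S(4,5)[of "real k * (t - a)"] S(4,5)[of "real k * (t - b) + 1"] by linarith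
        then have "\<bar>\<phi> k t\<bar> * \<bar>Q t\<bar> \<le> 1 * \<bar>Q t\<bar>" by (rule mult_right_mono) simp
        then show "norm (\<phi> k t * Q t) \<le> \<bar>Q t\<bar>" by (simp add: abs_mult)
      qed
    qed (use Q in simp)
    then have l2: "(\<lambda>k. - (\<integral>t. \<phi> k t * Q t \<partial>?M)) \<longlonglongrightarrow> - (\<integral>t. ?ind t * Q t \<partial>?M)"
      by (rule tendsto_minus)
    have "\<forall>\<^sub>F k in sequentially. (\<integral>t. deriv (\<phi> k) t * P t \<partial>?M) = - (\<integral>t. \<phi> k t * Q t \<partial>?M)"
      using ev by eventually_elim (rule weak[OF test])
    then have "(\<lambda>k. - (\<integral>t. \<phi> k t * Q t \<partial>?M)) \<longlonglongrightarrow> P a - P b"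
      by (rule Lim_transform_eventually[OF l1])
    with l2 have "P a - P b = - (\<integral>t. ?ind t * Q t \<partial>?M)" by (rule LIMSEQ_unique[rotated])
    also have "(\<integral>t. ?ind t * Q t \<partial>?M) = integral {0..T} (\<lambda>t. ?ind t * Q t)"
    proof (rule lebesgue_integral_eq_integral)
      show "integrable ?M (\<lambda>t. ?ind t * Q t)"
        by (rule Bochner_Integration.integrable_bound[OF Q mind]) auto
    qed simp
    also have "(\<lambda>t. ?ind t * Q t) = (\<lambda>t. if t \<in> {a<..<b} then Q t else 0)" by auto
    also have "integral {0..T} \<dots> = integral ({a<..<b} \<inter> {0..T}) Q" by (rule integral_restrict_Int)
    also have "{a<..<b} \<inter> {0..T} = {a<..<b}" using ab by auto
    also have "integral {a<..<b} Q = integral {a..b} Q"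
      using integral_open_interval_real[of a b Q] by simp
    finally show ?thesis by simp
  qed
  \<comment> \<open>The identity for interior end points says that \<open>D\<close> is constant on
    the open interval; continuity carries this to 0 and \<open>T\<close>, where no test function
    sees anything.\<close>
  define D where "D t = P t - integral {0..t} Q" for t
  have cD: "continuous_on {0..T} D"
    unfolding D_def[abs_def] by (intro continuous_intros P indefinite_integral_continuous_1 iQ)
  have D_eq: "D b = D a" if ab: "0 < a" "a < b" "b < T" for a b
  proof -
    have "integral {0..a} Q + integral {a..b} Q = integral {0..b} Q"
      by (rule Henstock_Kurzweil_Integration.integral_combine)
         (use ab in \<open>auto intro: integrable_subinterval_real[OF iQ]\<close>)
    then show ?thesis using diff[OF ab] by (simp add: D_def)
  qed
  have const: "D x = D (T / 2)" if "x \<in> {0<..<T}" for x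
    using D_eq[of x "T / 2"] D_eq[of "T / 2" x] that T by (cases x "T / 2" rule: linorder_cases) auto
  have "D x = D (T / 2)" if "x \<in> {0..T}" for x
  proof (rule continuous_constant_on_closure[of "{0<..<T}" D])
    show "continuous_on (closure {0<..<T}) D" using cD T by simp
    show "x \<in> closure {0<..<T}" using that T by simp
  qed (rule const)
  from this[of t] this[of 0] show ?thesis using t T by (simp add: D_def)
qed

section \<open>The graph space of the mixed problem\<close>

lemma borel_measurable_lebesgue_on_AE:
  fixes f g :: "real \<Rightarrow> real"
  assumes f: "f \<in> borel_measurable (lebesgue_on S)" and S: "S \<in> sets lebesgue"
    and ae: "AE t in lebesgue_on S. f t = g t"
  shows "g \<in> borel_measurable (lebesgue_on S)"
proof -
  \<comment> \<open>Extension by zero reduces the claim to Lebesgue measure on the whole line, whose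
    completeness permits changes on null sets.\<close>
  have "(\<lambda>t. if t \<in> S then f t else 0) \<in> borel_measurable lebesgue"
    using f S by (simp add: borel_measurable_if)
  moreover have "AE t in lebesgue. (if t \<in> S then f t else 0) = (if t \<in> S then g t else 0)"
    using ae S by (subst (asm) AE_restrict_space_iff) (auto elim: AE_mp)
  ultimately have "(\<lambda>t. if t \<in> S then g t else 0) \<in> borel_measurable lebesgue"
    by (rule borel_measurable_AE)
  then show ?thesis using S by (simp add: borel_measurable_if)
qed

lemma borel_measurable_lebesgue_on_AE_limit:
  fixes f :: "nat \<Rightarrow> real \<Rightarrow> real"
  assumes f: "\<And>n. f n \<in> borel_measurable (lebesgue_on S)" and S: "S \<in> sets lebesgue"
    and ae: "AE t in lebesgue_on S. (\<lambda>n. f n t) \<longlonglongrightarrow> g t"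
  shows "g \<in> borel_measurable (lebesgue_on S)"
proof (rule borel_measurable_lebesgue_on_AE[OF _ S])
  show "(\<lambda>t. lim (\<lambda>n. f n t)) \<in> borel_measurable (lebesgue_on S)"
    using f by (rule borel_measurable_lim_metric)
  show "AE t in lebesgue_on S. lim (\<lambda>n. f n t) = g t"
    using ae by (rule AE_mp) (auto intro: limI)
qed

lemma integrable_lebesgue_on_AE:
  fixes f g :: "real \<Rightarrow> real"
  assumes f: "integrable (lebesgue_on S) f" and S: "S \<in> sets lebesgue"
    and ae: "AE t in lebesgue_on S. f t = g t"
  shows "integrable (lebesgue_on S) g"
  using f borel_measurable_lebesgue_on_AE[OF borel_measurable_integrable[OF f] S ae] ae
  by (rule integrable_cong_AE_imp)

text \<open>If \<open>N v = 0\<close>, the bound contained in \<open>dual\<close> already forces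
  \<open>F v = 0\<close>; otherwise \<open>v\<close> is normalised. The same bound ensures that the
  real supremum is a true supremum.\<close>

lemma abs_le_dual_norm:
  assumes F: "F \<in> dual X N" and v: "v \<in> X"
    and X: "\<And>c v. v \<in> X \<Longrightarrow> c *\<^sub>R v \<in> X"
    and N0: "\<And>v. v \<in> X \<Longrightarrow> 0 \<le> N v" and N: "\<And>c v. v \<in> X \<Longrightarrow> N (c *\<^sub>R v) = \<bar>c\<bar> * N v"
  shows "\<bar>F v\<bar> \<le> dual_norm X N F * N v"
proof -
  obtain C where C: "\<And>v. v \<in> X \<Longrightarrow> \<bar>F v\<bar> \<le> C * N v"
    using F unfolding dual_def by blast
  have scale: "\<And>c v. v \<in> X \<Longrightarrow> F (c *\<^sub>R v) = c * F v" using F unfolding dual_def by blast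
  show ?thesis
  proof (cases "N v = 0")
    case True
    then show ?thesis using C[OF v] by simp
  next
    case False
    then have pos: "N v > 0" using N0[OF v] by simp
    let ?w = "(1 / N v) *\<^sub>R v"
    have "\<bar>F ?w\<bar> \<le> dual_norm X N F"
      unfolding dual_norm_def
    proof (rule cSUP_upper)
      show "?w \<in> {v \<in> X. N v \<le> 1}" using X[OF v] N[OF v] pos by simp
      show "bdd_above ((\<lambda>v. \<bar>F v\<bar>) ` {v \<in> X. N v \<le> 1})"
      proof (rule bdd_aboveI2)
        fix w assume w: "w \<in> {v \<in> X. N v \<le> 1}"
        then have "\<bar>F w\<bar> \<le> \<bar>C\<bar> * N w" using C[of w] N0[of w] by (smt (verit) abs_ge_self mult_right_mono mem_Collect_eq)
        also have "\<dots> \<le> \<bar>C\<bar> * 1" using w by (intro mult_left_mono) auto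
        finally show "\<bar>F w\<bar> \<le> \<bar>C\<bar>" by simp
      qed
    qed
    then have "\<bar>F v\<bar> / N v \<le> dual_norm X N F" using scale[OF v] pos by (simp add: abs_mult)
    then show ?thesis using pos by (simp add: field_simps)
  qed
qed

lemma dual_diff:
  assumes "F \<in> dual X N" "F' \<in> dual X N"
  shows "F - F' \<in> dual X N"
proof -
  obtain C where "\<forall>v\<in>X. \<bar>F v\<bar> \<le> C * N v" using assms(1) unfolding dual_def by blast
  moreover obtain C' where "\<forall>v\<in>X. \<bar>F' v\<bar> \<le> C' * N v" using assms(2) unfolding dual_def by blast
  ultimately have C: "v \<in> X \<Longrightarrow> \<bar>F v\<bar> \<le> C * N v" "v \<in> X \<Longrightarrow> \<bar>F' v\<bar> \<le> C' * N v" for v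
    by blast+
  have "\<bar>(F - F') v\<bar> \<le> (C + C') * N v" if "v \<in> X" for v
    using C(1)[OF that] C(2)[OF that] by (simp add: distrib_right)
  then have "\<exists>C. \<forall>v\<in>X. \<bar>(F - F') v\<bar> \<le> C * N v" by blast
  then show ?thesis
    using assms(1,2) unfolding dual_def by (auto simp: algebra_simps)
qed

text \<open>Evaluation at \<open>v\<close> is continuous for the dual norm, so the values at
  \<open>v\<close> of the approximating simple functions converge almost everywhere.\<close>

lemma dual_L2_measurable:
  assumes f: "f \<in> bochner_L2 S (dual X N) (dual_norm X N)" and S: "S \<in> sets lebesgue" and v: "v \<in> X"
    and X: "\<And>c v. v \<in> X \<Longrightarrow> c *\<^sub>R v \<in> X"
    and N0: "\<And>v. v \<in> X \<Longrightarrow> 0 \<le> N v" and N: "\<And>c v. v \<in> X \<Longrightarrow> N (c *\<^sub>R v) = \<bar>c\<bar> * N v"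
  shows "(\<lambda>t. f t v) \<in> borel_measurable (lebesgue_on S)"
proof -
  obtain s where s: "\<And>n. simple_function (lebesgue_on S) (s n)" "\<And>n. s n ` S \<subseteq> dual X N"
    and lim: "AE t in lebesgue_on S. f t \<in> dual X N \<and> (\<lambda>n. dual_norm X N (s n t - f t)) \<longlonglongrightarrow> 0"
    using f unfolding bochner_L2_def strongly_measurable_on_def by blast
  show ?thesis
  proof (rule borel_measurable_lebesgue_on_AE_limit[OF _ S])
    show "(\<lambda>t. s n t v) \<in> borel_measurable (lebesgue_on S)" for n
      by (rule borel_measurable_simple_function, rule simple_function_compose1[OF s(1)])
    show "AE t in lebesgue_on S. (\<lambda>n. s n t v) \<longlonglongrightarrow> f t v"
      using lim
    proof (rule AE_mp, intro AE_I2 impI)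
      fix t assume t: "t \<in> space (lebesgue_on S)"
        and ft: "f t \<in> dual X N \<and> (\<lambda>n. dual_norm X N (s n t - f t)) \<longlonglongrightarrow> 0"
      have "s n t \<in> dual X N" for n using s(2) t by auto
      then have "\<bar>(s n t - f t) v\<bar> \<le> dual_norm X N (s n t - f t) * N v" for n
        using ft by (intro abs_le_dual_norm dual_diff v X N0 N) auto
      moreover have "(\<lambda>n. dual_norm X N (s n t - f t) * N v) \<longlonglongrightarrow> 0 * N v"
        using ft by (intro tendsto_intros) auto
      ultimately have "(\<lambda>n. s n t v - f t v) \<longlonglongrightarrow> 0"
        by (intro Lim_null_comparison[of "\<lambda>n. s n t v - f t v"]) auto
      then show "(\<lambda>n. s n t v) \<longlonglongrightarrow> f t v" by (rule LIM_zero_cancel)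
    qed
  qed
qed

section \<open>Consequences of the axioms of a Hilbert complex\<close>

context hilbert_complex
begin

lemma V_subset_W: "V j \<subseteq> W j"
  using closure_subset[of "V j"] dense_V by simp

lemma d_zero: "d j 0 = 0"
  using d_scaleR[OF subspace_0[OF subspace_V], of j 0] by simp

lemma d_diff: "v \<in> V j \<Longrightarrow> w \<in> V j \<Longrightarrow> d j (v - w) = d j v - d j w"
  using d_add[of v j "- w"] d_scaleR[of w j "-1"] subspace_neg[OF subspace_V] by simp

lemma countable_dense_W: "\<exists>C. countable C \<and> W j \<subseteq> closure C"
proof -
  obtain C where "countable C" "C \<subseteq> W j" "top_of_set (W j) closure_of C = W j"
    using separable_W[of j] unfolding separable_space_def by auto
  then have "W j \<subseteq> closure C"
    unfolding closure_of_subtopology by (metis Int_absorb1 euclidean_closure_of inf_le2)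
  with \<open>countable C\<close> show ?thesis by blast
qed

end

lemma graph_norm_squared: "(graph_norm d j v)\<^sup>2 = (norm v)\<^sup>2 + (norm (d j v))\<^sup>2"
  by (simp add: graph_norm_def graph_inner_def power2_norm_eq_inner)

lemma norm_Pair_squared: "(norm (x, y))\<^sup>2 = (norm x)\<^sup>2 + (norm y)\<^sup>2"
  by (simp add: norm_Pair)

section \<open>The graph space and the operators of the mixed problem\<close>

locale mixed_problem = hilbert_complex W V d
  for W V :: "int \<Rightarrow> 'a::{real_inner, complete_space} set" and d +
  fixes k :: int and T :: real
  assumes T: "0 < T"
begin

abbreviation "Y \<equiv> Y_space V k"
abbreviation "NY \<equiv> Y_norm d k"

definition graph_embed :: "'a \<times> 'a \<Rightarrow> ('a \<times> 'a) \<times> ('a \<times> 'a)"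
  where "graph_embed y = (y, (d (k - 1) (fst y), d k (snd y)))"

definition graph_space :: "(('a \<times> 'a) \<times> ('a \<times> 'a)) set"
  where "graph_space = graph_embed ` Y"

lemma fst_graph_embed [simp]: "fst (graph_embed y) = y"
  by (simp add: graph_embed_def)

lemma Y_iff: "y \<in> Y \<longleftrightarrow> fst y \<in> V (k - 1) \<and> snd y \<in> V k"
  by (cases y) (simp add: Y_space_def)

lemma subspace_Y: "subspace Y"
  unfolding Y_space_def by (intro subspace_Times subspace_V)

lemma graph_embed_add: "x \<in> Y \<Longrightarrow> y \<in> Y \<Longrightarrow> graph_embed (x + y) = graph_embed x + graph_embed y"
  by (simp add: graph_embed_def Y_iff d_add)

lemma graph_embed_scaleR: "x \<in> Y \<Longrightarrow> graph_embed (c *\<^sub>R x) = c *\<^sub>R graph_embed x"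
  by (simp add: graph_embed_def Y_iff d_scaleR)

lemma graph_embed_diff: "x \<in> Y \<Longrightarrow> y \<in> Y \<Longrightarrow> graph_embed (x - y) = graph_embed x - graph_embed y"
  by (simp add: graph_embed_def Y_iff d_diff)

lemma graph_embed_0: "graph_embed 0 = 0"
  by (simp add: graph_embed_def d_zero zero_prod_def)

lemma graph_embed_in: "y \<in> Y \<Longrightarrow> graph_embed y \<in> graph_space"
  by (simp add: graph_space_def)

lemma graph_spaceD:
  assumes "x \<in> graph_space"
  shows "fst x \<in> Y" "graph_embed (fst x) = x"
  using assms by (auto simp: graph_space_def)

lemma Y_norm_eq: "NY y = norm (graph_embed y)"
proof -
  have "NY y = sqrt ((norm (graph_embed y))\<^sup>2)"
    by (cases y) (simp add: Y_norm_def graph_norm_squared graph_embed_def norm_Pair_squared algebra_simps)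
  then show ?thesis by simp
qed

lemma subspace_graph_space: "subspace graph_space"
proof -
  have "0 \<in> graph_space" using graph_embed_in[OF subspace_0[OF subspace_Y]] by (simp add: graph_embed_0)
  moreover have "x + y \<in> graph_space" if "x \<in> graph_space" "y \<in> graph_space" for x y
    using graph_embed_in[OF subspace_add[OF subspace_Y graph_spaceD(1)[OF that(1)] graph_spaceD(1)[OF that(2)]]]
    by (simp add: graph_embed_add graph_spaceD that)
  moreover have "c *\<^sub>R x \<in> graph_space" if "x \<in> graph_space" for x c
    using graph_embed_in[OF subspace_scale[OF subspace_Y graph_spaceD(1)[OF that]], of c]
    by (simp add: graph_embed_scaleR graph_spaceD that)
  ultimately show ?thesis by (simp add: subspace_def)
qed

lemma closed_graph_space: "closed graph_space"
proof -
  let ?g = "\<lambda>j. {(v, d j v) |v. v \<in> V j}"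
  \<comment> \<open>A reordering of the four coordinates, under which the graph space is the product
    of the two closed graphs of \<open>d (k - 1)\<close> and \<open>d k\<close>.\<close>
  let ?\<pi> = "\<lambda>x :: ('a \<times> 'a) \<times> ('a \<times> 'a). ((fst (fst x), fst (snd x)), (snd (fst x), snd (snd x)))"
  have "graph_space = ?\<pi> -` (?g (k - 1) \<times> ?g k)"
  proof (intro set_eqI iffI)
    fix x assume "x \<in> graph_space"
    then show "x \<in> ?\<pi> -` (?g (k - 1) \<times> ?g k)"
      by (auto simp: graph_space_def graph_embed_def Y_iff)
  next
    fix x assume "x \<in> ?\<pi> -` (?g (k - 1) \<times> ?g k)"
    then have "fst x \<in> Y" "graph_embed (fst x) = x"
      by (auto simp: graph_embed_def Y_iff prod_eq_iff)
    then show "x \<in> graph_space" unfolding graph_space_def by (metis imageI)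
  qed
  moreover have "closed (?\<pi> -` (?g (k - 1) \<times> ?g k))"
    by (intro closed_vimage closed_Times d_closed continuous_intros)
  ultimately show ?thesis by simp
qed

lemma separable_graph_space: "\<exists>C. countable C \<and> C \<subseteq> graph_space \<and> graph_space \<subseteq> closure C"
proof -
  have "\<forall>j. \<exists>C. countable C \<and> W j \<subseteq> closure C" using countable_dense_W by blast
  from choice[OF this] obtain C where C: "\<forall>j. countable (C j) \<and> W j \<subseteq> closure (C j)" ..
  \<comment> \<open>The degree \<open>k - 1 + 1\<close> is left as it stands in
    \<open>d_maps\<close>.\<close>
  let ?C = "(C (k - 1) \<times> C k) \<times> (C (k - 1 + 1) \<times> C (k + 1))"
  let ?S = "(W (k - 1) \<times> W k) \<times> (W (k - 1 + 1) \<times> W (k + 1))"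
  have "countable ?C" using C by (intro countable_SIGMA) auto
  moreover have "?S \<subseteq> closure ?C"
    unfolding closure_Times using C by (intro Sigma_mono) auto
  moreover have "graph_space \<subseteq> ?S"
  proof
    fix x assume "x \<in> graph_space"
    then obtain y where y: "fst y \<in> V (k - 1)" "snd y \<in> V k" "x = graph_embed y"
      by (auto simp: graph_space_def Y_iff)
    then show "x \<in> ?S"
      using d_maps[OF y(1)] d_maps[OF y(2)] V_subset_W by (cases y) (auto simp: graph_embed_def)
  qed
  ultimately show ?thesis using countable_dense_subset by metis
qed

abbreviation "P \<equiv> proj_on graph_space"

lemmas P_in = proj_on_in[OF subspace_graph_space closed_graph_space]
  and P_inner = inner_proj_on[OF subspace_graph_space closed_graph_space]
  and P_linear = bounded_linear_proj_on[OF subspace_graph_space closed_graph_space]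

text \<open>
  The bilinear form \<open>\<langle>d \<sigma>, d \<omega>\<rangle> + \<langle>d \<sigma>, \<phi>\<rangle> + \<langle>d u, d \<phi>\<rangle>\<close> is the inner product of
  \<open>form_op (graph_embed (\<sigma>, u))\<close> with \<open>graph_embed (\<omega>, \<phi>)\<close>; it is not symmetric.
\<close>

definition form_op :: "('a \<times> 'a) \<times> ('a \<times> 'a) \<Rightarrow> ('a \<times> 'a) \<times> ('a \<times> 'a)"
  where "form_op x = ((0, fst (snd x)), snd x)"

definition form_op_adj :: "('a \<times> 'a) \<times> ('a \<times> 'a) \<Rightarrow> ('a \<times> 'a) \<times> ('a \<times> 'a)"
  where "form_op_adj x = (0, (snd (fst x) + fst (snd x), snd (snd x)))"

abbreviation "mass_op (x :: ('a \<times> 'a) \<times> ('a \<times> 'a)) \<equiv> P (fst x, 0)"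
abbreviation "stiffness_op x \<equiv> P (form_op x)"
abbreviation "stiffness_op_adj x \<equiv> P (form_op_adj x)"

lemma form_op_inner: "form_op x \<bullet> y = x \<bullet> form_op_adj y"
  by (cases x; cases y) (auto simp: form_op_def form_op_adj_def inner_prod_def inner_add_right)

lemma bounded_linear_form_op: "bounded_linear form_op" "bounded_linear form_op_adj"
  unfolding form_op_def[abs_def] form_op_adj_def[abs_def]
  by (intro bounded_linear_Pair bounded_linear_zero bounded_linear_add bounded_linear_fst
      bounded_linear_snd bounded_linear_compose[OF bounded_linear_fst] bounded_linear_compose[OF bounded_linear_snd])+

text \<open>The constants in Garding's inequality: with \<open>x = ((a, b), (c, e))\<close> the
  cross term \<open>c \<bullet> b\<close> is at least minus half the sum of the squared norms of
  \<open>b\<close> and \<open>c\<close>. Half of the square of \<open>c = d \<sigma>\<close>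
  remains, and the loss in \<open>b = u\<close> is covered by adding the norm of H once, whence
  \<open>1/2\<close> and 1.\<close>

sublocale pde: parabolic T graph_space fst mass_op stiffness_op stiffness_op_adj "1/2" 1
proof (rule parabolic.intro[OF L2_setting.intro])
  show "finite_measure (lebesgue_on {0..T})"
    using T emeasure_lborel_Icc[of 0 T] by (intro finite_measureI) (simp add: emeasure_restrict_space)
  show "L2_setting_axioms graph_space"
    by unfold_locales (simp_all add: subspace_graph_space closed_graph_space separable_graph_space)
  show "parabolic_axioms T graph_space fst (\<lambda>x. mass_op x) (\<lambda>x. stiffness_op x) (\<lambda>x. stiffness_op_adj x) (1/2) 1"
  proof (rule parabolic_axioms.intro)
    show "bounded_linear (\<lambda>x. mass_op x)"
      by (intro bounded_linear_compose[OF P_linear] bounded_linear_Pair bounded_linear_fst bounded_linear_zero)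
    show "bounded_linear (\<lambda>x. stiffness_op x)" "bounded_linear (\<lambda>x. stiffness_op_adj x)"
      by (intro bounded_linear_compose[OF P_linear] bounded_linear_form_op)+
    show "mass_op x \<bullet> y = fst x \<bullet> fst y" if "y \<in> graph_space" for x y
      unfolding P_inner[OF that] by (simp add: inner_prod_def)
    show "stiffness_op x \<bullet> y = x \<bullet> stiffness_op_adj y" if "x \<in> graph_space" "y \<in> graph_space" for x y
      using P_inner[OF that(2), of "form_op x"] P_inner[OF that(1), of "form_op_adj y"] form_op_inner[of x y]
      by (simp only: inner_commute[of x])
    show "x = 0" if "x \<in> graph_space" "fst x = 0" for x
      using graph_spaceD(2)[OF that(1)] that(2) by (simp add: graph_embed_0)
    show "1 / 2 * (norm x)\<^sup>2 \<le> stiffness_op x \<bullet> x + 1 * (norm (fst x))\<^sup>2" if "x \<in> graph_space" for x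
    proof -
      obtain a b c e where x: "x = ((a, b), (c, e))" by (metis surj_pair)
      have "0 \<le> (norm (b + c))\<^sup>2" by simp
      also have "\<dots> = (norm b)\<^sup>2 + (norm c)\<^sup>2 + 2 * (c \<bullet> b)"
        unfolding power2_norm_eq_inner by (simp add: inner_add_left inner_add_right inner_commute)
      finally have 1: "- (norm b)\<^sup>2 - (norm c)\<^sup>2 \<le> 2 * (c \<bullet> b)" by linarith
      have 2: "stiffness_op x \<bullet> x = c \<bullet> b + (norm c)\<^sup>2 + (norm e)\<^sup>2"
        unfolding P_inner[OF that] by (simp add: form_op_def x inner_prod_def power2_norm_eq_inner)
      have 3: "0 \<le> (norm a)\<^sup>2" "0 \<le> (norm e)\<^sup>2" by simp_all
      have arith: "1 / 2 * (r + s + (t + q)) \<le> w + t + q + 1 * (r + s)"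
        if "- s - t \<le> 2 * w" "0 \<le> r" "0 \<le> q" for r s t q w :: real
        using that by argo
      show ?thesis
        unfolding 2 unfolding x norm_Pair_squared fst_conv by (rule arith[OF 1 3])
    qed
  qed (use T in \<open>simp_all add: P_in bounded_linear_fst\<close>)
qed

section \<open>The dual of Y and the Bochner spaces seen through the graph space\<close>

abbreviation "I \<equiv> {0..T}"

text \<open>The Riesz map from the graph space to the dual of Y, cut off outside \<open>Y\<close> to
  agree with the convention of \<open>dual\<close>.\<close>

definition functional :: "('a \<times> 'a) \<times> ('a \<times> 'a) \<Rightarrow> 'a \<times> 'a \<Rightarrow> real"
  where "functional x = (\<lambda>y. if y \<in> Y then x \<bullet> graph_embed y else 0)"

lemma functional_apply: "y \<in> Y \<Longrightarrow> functional x y = x \<bullet> graph_embed y"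
  by (simp add: functional_def)

lemma functional_diff: "functional x - functional z = functional (x - z)"
  by (rule ext) (simp add: functional_def inner_diff_left)

lemma functional_dual: "functional x \<in> dual Y NY"
proof -
  have "\<bar>functional x v\<bar> \<le> norm x * NY v" if "v \<in> Y" for v
    using that Cauchy_Schwarz_ineq2[of x "graph_embed v"] by (simp add: functional_apply Y_norm_eq)
  then have "\<exists>C. \<forall>v\<in>Y. \<bar>functional x v\<bar> \<le> C * NY v" by blast
  moreover have "functional x (v + w) = functional x v + functional x w" if "v \<in> Y" "w \<in> Y" for v w
    using that by (simp add: functional_apply graph_embed_add inner_add_right subspace_add[OF subspace_Y])
  moreover have "functional x (c *\<^sub>R v) = c * functional x v" if "v \<in> Y" for c v
    using that by (simp add: functional_apply graph_embed_scaleR subspace_scale[OF subspace_Y])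
  moreover have "functional x v = 0" if "v \<notin> Y" for v using that by (simp add: functional_def)
  ultimately show ?thesis unfolding dual_def by blast
qed

text \<open>For nonzero \<open>x\<close> the supremum is attained at \<open>fst x\<close> divided by
  \<open>norm x\<close>, whose graph is a unit vector. Hence norms in the dual of Y can be computed
  in the graph space.\<close>

lemma dual_norm_functional:
  assumes x: "x \<in> graph_space"
  shows "dual_norm Y NY (functional x) = norm x"
proof -
  let ?B = "{v \<in> Y. NY v \<le> 1}"
  have 0: "0 \<in> ?B" using subspace_0[OF subspace_Y] by (simp add: Y_norm_eq graph_embed_0)
  have le: "\<bar>functional x v\<bar> \<le> norm x" if "v \<in> ?B" for v
  proof -
    have "\<bar>functional x v\<bar> \<le> norm x * norm (graph_embed v)"
      using that Cauchy_Schwarz_ineq2[of x "graph_embed v"] by (simp add: functional_apply)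
    also have "\<dots> \<le> norm x * 1" using that by (intro mult_left_mono) (auto simp: Y_norm_eq)
    finally show ?thesis by simp
  qed
  have bdd: "bdd_above ((\<lambda>v. \<bar>functional x v\<bar>) ` ?B)" using le by (rule bdd_aboveI2)
  show ?thesis
    unfolding dual_norm_def
  proof (rule antisym)
    show "(SUP v\<in>?B. \<bar>functional x v\<bar>) \<le> norm x" by (rule cSUP_least[OF _ le]) (use 0 in blast)
    show "norm x \<le> (SUP v\<in>?B. \<bar>functional x v\<bar>)"
    proof (cases "x = 0")
      case True
      then have "norm x \<le> \<bar>functional x 0\<bar>" by simp
      also have "\<dots> \<le> (SUP v\<in>?B. \<bar>functional x v\<bar>)" by (rule cSUP_upper[OF 0 bdd])
      finally show ?thesis .
    next
      case False
      let ?v = "(1 / norm x) *\<^sub>R fst x"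
      have v: "?v \<in> Y" by (rule subspace_scale[OF subspace_Y graph_spaceD(1)[OF x]])
      have e: "graph_embed ?v = (1 / norm x) *\<^sub>R x"
        using graph_spaceD[OF x] by (simp add: graph_embed_scaleR)
      have "\<bar>functional x ?v\<bar> = norm x"
        unfolding functional_apply[OF v] e using False
        by (simp add: power2_norm_eq_inner[symmetric] power2_eq_square)
      moreover have "?v \<in> ?B" using v e False by (simp add: Y_norm_eq)
      ultimately show ?thesis using cSUP_upper[OF _ bdd, of ?v] by simp
    qed
  qed
qed

text \<open>The Gelfand embedding of \<open>h\<close> has the Riesz representative
  \<open>P (h, 0)\<close>. It depends continuously on \<open>h\<close>, so continuous H-valued
  functions become members of L^2(I,Y').\<close>

lemma gelfand_embed_eq: "gelfand_embed Y h = functional (P (h, 0))"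
proof (rule ext)
  show "gelfand_embed Y h v = functional (P (h, 0)) v" for v
  proof (cases "v \<in> Y")
    case True
    show ?thesis
      unfolding functional_apply[OF True] P_inner[OF graph_embed_in[OF True]]
      using True by (simp add: gelfand_embed_def graph_embed_def inner_prod_def)
  qed (simp add: gelfand_embed_def functional_def)
qed

lemma functional_L2:
  assumes x: "x \<in> L2_fun pde.M graph_space"
  shows "(\<lambda>t. functional (x t)) \<in> bochner_L2 I (dual Y NY) (dual_norm Y NY)"
proof -
  obtain s where s: "\<And>n. simple_function pde.M (s n)" "\<And>n t. s n t \<in> graph_space"
    "\<And>t. t \<in> space pde.M \<Longrightarrow> (\<lambda>n. norm (s n t - x t)) \<longlonglongrightarrow> 0"
    using pde.simple_approximation[OF pde.L2_D(1,2)[OF x]] by blast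
  have sub: "s n t - x t \<in> graph_space" if "t \<in> I" for n t
    using subspace_diff[OF subspace_graph_space s(2) pde.L2_D(1)[OF x]] that by simp
  have "strongly_measurable_on I (dual Y NY) (dual_norm Y NY) (\<lambda>t. functional (x t))"
    unfolding strongly_measurable_on_def
  proof (intro exI[of _ "\<lambda>n t. functional (s n t)"] conjI allI AE_I2)
    show "simple_function pde.M (\<lambda>t. functional (s n t))" for n
      by (rule simple_function_compose1[OF s(1)])
    show "(\<lambda>t. functional (s n t)) ` I \<subseteq> dual Y NY" for n using functional_dual by blast
    show "functional (x t) \<in> dual Y NY" for t by (rule functional_dual)
    show "(\<lambda>n. dual_norm Y NY (functional (s n t) - functional (x t))) \<longlonglongrightarrow> 0"
      if "t \<in> space pde.M" for t
      using s(3)[OF that] that by (simp add: functional_diff dual_norm_functional[OF sub])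
  qed
  moreover have "integrable pde.M (\<lambda>t. (dual_norm Y NY (functional (x t)))\<^sup>2)"
  proof (subst Bochner_Integration.integrable_cong[OF refl])
    show "(dual_norm Y NY (functional (x t)))\<^sup>2 = (norm (x t))\<^sup>2" if "t \<in> space pde.M" for t
      using pde.L2_D(1)[OF x that] by (simp add: dual_norm_functional)
    show "integrable pde.M (\<lambda>t. (norm (x t))\<^sup>2)" by (rule pde.L2_D(3)[OF x])
  qed
  ultimately show ?thesis by (simp add: bochner_L2_def)
qed

lemma Y_L2_if_graph_L2:
  assumes x: "x \<in> L2_fun pde.M graph_space" and ae: "AE t in pde.M. fst (x t) = U t"
  shows "U \<in> bochner_L2 I Y NY"
proof -
  obtain s where s: "\<And>n. simple_function pde.M (s n)" "\<And>n t. s n t \<in> graph_space"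
    "\<And>t. t \<in> space pde.M \<Longrightarrow> (\<lambda>n. norm (s n t - x t)) \<longlonglongrightarrow> 0"
    using pde.simple_approximation[OF pde.L2_D(1,2)[OF x]] by blast
  have "strongly_measurable_on I Y NY U"
    unfolding strongly_measurable_on_def
  proof (intro exI[of _ "\<lambda>n t. fst (s n t)"] conjI allI)
    show "simple_function pde.M (\<lambda>t. fst (s n t))" for n
      by (rule simple_function_compose1[OF s(1)])
    show "(\<lambda>t. fst (s n t)) ` I \<subseteq> Y" for n using graph_spaceD(1)[OF s(2)] by blast
    show "AE t in pde.M. U t \<in> Y \<and> (\<lambda>n. NY (fst (s n t) - U t)) \<longlonglongrightarrow> 0"
      using ae
    proof (rule AE_mp, intro AE_I2 impI)
      fix t assume t: "t \<in> space pde.M" and U: "fst (x t) = U t"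
      have xt: "x t \<in> graph_space" by (rule pde.L2_D(1)[OF x t])
      have UY: "U t \<in> Y" using graph_spaceD(1)[OF xt] U by simp
      have "NY (fst (s n t) - U t) = norm (s n t - x t)" for n
        unfolding Y_norm_eq
        using graph_embed_diff[OF graph_spaceD(1)[OF s(2)] UY] graph_spaceD(2)[OF s(2)] graph_spaceD(2)[OF xt] U
        by simp
      then show "U t \<in> Y \<and> (\<lambda>n. NY (fst (s n t) - U t)) \<longlonglongrightarrow> 0" using UY s(3)[OF t] by simp
    qed
  qed
  moreover have "integrable pde.M (\<lambda>t. (NY (U t))\<^sup>2)"
  proof (rule integrable_lebesgue_on_AE[OF pde.L2_D(3)[OF x]])
    show "AE t in pde.M. (norm (x t))\<^sup>2 = (NY (U t))\<^sup>2"
      using ae AE_space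
    proof eventually_elim
      case (elim t)
      then show ?case using graph_spaceD(2)[OF pde.L2_D(1)[OF x elim(2)]] by (simp add: Y_norm_eq)
    qed
  qed simp
  ultimately show ?thesis by (simp add: bochner_L2_def)
qed

text \<open>\<open>U t\<close> may lie outside \<open>Y\<close> on a null set. The default value 0
  there keeps \<open>x t\<close> in the graph space for every \<open>t\<close>, as
  \<open>L2_fun\<close> demands.\<close>

lemma graph_L2_if_Y_L2:
  assumes U: "U \<in> bochner_L2 I Y NY"
  defines "x \<equiv> \<lambda>t. if U t \<in> Y then graph_embed (U t) else 0"
  shows "x \<in> L2_fun pde.M graph_space" "AE t in pde.M. fst (x t) = U t"
proof -
  obtain s where s: "\<And>n. simple_function pde.M (s n)" "\<And>n. s n ` I \<subseteq> Y"
    and lim: "AE t in pde.M. U t \<in> Y \<and> (\<lambda>n. NY (s n t - U t)) \<longlonglongrightarrow> 0"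
    and int: "integrable pde.M (\<lambda>t. (NY (U t))\<^sup>2)"
    using U unfolding bochner_L2_def strongly_measurable_on_def by blast
  have UY: "AE t in pde.M. U t \<in> Y" using lim by (rule AE_mp) auto
  show "AE t in pde.M. fst (x t) = U t" using UY by (rule AE_mp) (auto simp: x_def)
  have "(\<lambda>t. x t \<bullet> y) \<in> borel_measurable pde.M" for y
  proof (rule borel_measurable_lebesgue_on_AE_limit)
    show "(\<lambda>t. graph_embed (s n t) \<bullet> y) \<in> borel_measurable pde.M" for n
      by (rule borel_measurable_simple_function, rule simple_function_compose1[OF s(1)])
    show "AE t in pde.M. (\<lambda>n. graph_embed (s n t) \<bullet> y) \<longlonglongrightarrow> x t \<bullet> y"
      using lim
    proof (rule AE_mp, intro AE_I2 impI)
      fix t assume t: "t \<in> space pde.M" and l: "U t \<in> Y \<and> (\<lambda>n. NY (s n t - U t)) \<longlonglongrightarrow> 0"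
      have "s n t \<in> Y" for n using s(2)[of n] t by (auto simp: image_subset_iff)
      then have "NY (s n t - U t) = norm (graph_embed (s n t) - graph_embed (U t))" for n
        using graph_embed_diff[of "s n t" "U t"] l by (simp add: Y_norm_eq)
      then have "(\<lambda>n. norm (graph_embed (s n t) - graph_embed (U t))) \<longlonglongrightarrow> 0"
        using l by simp
      then have "(\<lambda>n. graph_embed (s n t)) \<longlonglongrightarrow> graph_embed (U t)"
        by (simp add: tendsto_norm_zero_iff LIM_zero_iff)
      then show "(\<lambda>n. graph_embed (s n t) \<bullet> y) \<longlonglongrightarrow> x t \<bullet> y"
        using l by (auto simp: x_def intro!: tendsto_intros)
    qed
  qed simp
  moreover have "integrable pde.M (\<lambda>t. (norm (x t))\<^sup>2)"
  proof (rule integrable_lebesgue_on_AE[OF int])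
    show "AE t in pde.M. (NY (U t))\<^sup>2 = (norm (x t))\<^sup>2"
      using UY by (rule AE_mp) (auto simp: x_def Y_norm_eq)
  qed simp
  ultimately show "x \<in> L2_fun pde.M graph_space"
    by (auto simp: L2_fun_def x_def graph_embed_in subspace_0[OF subspace_graph_space])
qed

text \<open>Weak measurability comes from the adjoint: pairing with \<open>v\<close> is pairing
  \<open>x t\<close> with the fixed element \<open>stiffness_op_adj v\<close>.\<close>

lemma stiffness_L2:
  assumes x: "x \<in> L2_fun pde.M graph_space"
  shows "(\<lambda>t. stiffness_op (x t)) \<in> L2_fun pde.M graph_space"
proof -
  have m: "(\<lambda>t. stiffness_op (x t) \<bullet> v) \<in> borel_measurable pde.M" if "v \<in> graph_space" for v
  proof -
    have "(\<lambda>t. x t \<bullet> stiffness_op_adj v) \<in> borel_measurable pde.M" by (intro pde.L2_D(2)[OF x] P_in)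
    moreover have "stiffness_op (x t) \<bullet> v = x t \<bullet> stiffness_op_adj v" if "t \<in> space pde.M" for t
      by (rule pde.A_adjoint[OF pde.L2_D(1)[OF x that] \<open>v \<in> graph_space\<close>])
    ultimately show ?thesis by (simp only: cong: measurable_cong)
  qed
  obtain K where K: "\<And>y. norm (stiffness_op y) \<le> norm y * K"
    using bounded_linear.bounded[OF pde.A] by blast
  have "integrable pde.M (\<lambda>t. (norm (stiffness_op (x t)))\<^sup>2)"
  proof (rule Bochner_Integration.integrable_bound)
    show "integrable pde.M (\<lambda>t. (norm (x t))\<^sup>2 * K\<^sup>2)" using pde.L2_D(3)[OF x] by simp
    show "(\<lambda>t. (norm (stiffness_op (x t)))\<^sup>2) \<in> borel_measurable pde.M"
      by (intro borel_measurable_power pde.norm_measurable P_in m)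
    show "AE t in pde.M. norm ((norm (stiffness_op (x t)))\<^sup>2) \<le> norm ((norm (x t))\<^sup>2 * K\<^sup>2)"
      using power_mono[OF K norm_ge_zero, of _ 2] by (simp add: power_mult_distrib)
  qed
  with m show ?thesis by (auto simp: L2_fun_def P_in)
qed

section \<open>The load functional\<close>

lemma graph_norm_scaleR: "v \<in> V j \<Longrightarrow> graph_norm d j (c *\<^sub>R v) = \<bar>c\<bar> * graph_norm d j v"
  by (simp add: graph_norm_def graph_inner_def d_scaleR real_sqrt_mult flip: distrib_left mult.assoc)

lemma graph_norm_nonneg: "0 \<le> graph_norm d j v"
  by (simp add: graph_norm_def graph_inner_def)

lemma dual_V_apply_le:
  "F \<in> dual (V j) (graph_norm d j) \<Longrightarrow> v \<in> V j \<Longrightarrow>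
    \<bar>F v\<bar> \<le> dual_norm (V j) (graph_norm d j) F * graph_norm d j v"
  by (rule abs_le_dual_norm)
     (auto simp: subspace_scale[OF subspace_V] graph_norm_scaleR graph_norm_nonneg)

text \<open>\<open>x\<close> represents the sum of both right-hand sides as one functional on Y. The
  condition \<open>F 0 = 0\<close> is included so that each equation can be recovered from the sum
  by setting the other test function to zero.\<close>

definition represents :: "('a \<Rightarrow> real) \<Rightarrow> ('a \<times> 'a) \<times> ('a \<times> 'a) \<Rightarrow> bool"
  where "represents F x \<longleftrightarrow> F 0 = 0 \<and>
    (\<forall>\<omega>\<in>V (k - 1). \<forall>\<phi>\<in>V k. x \<bullet> graph_embed (\<omega>, \<phi>) = F (d (k - 1) \<omega>) + F \<phi>)"

text \<open>Both terms are bounded by the graph norm on Y: \<open>\<phi>\<close> directly, and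
  \<open>d \<omega>\<close> because it lies in \<open>V k\<close> and is annihilated by
  \<open>d k\<close>, so its graph norm is its plain norm.\<close>

lemma load_exists:
  assumes f: "f \<in> bochner_L2 I (dual (V k) (graph_norm d k)) (dual_norm (V k) (graph_norm d k))"
  obtains h where "h \<in> L2_fun pde.M graph_space"
    "AE t in pde.M. represents (f t) (h t)"
proof -
  let ?D = "dual (V k) (graph_norm d k)" and ?n = "dual_norm (V k) (graph_norm d k)"
  let ?F = "\<lambda>t x. f t (fst (snd x)) + f t (snd (fst x))"
  have fD: "AE t in pde.M. f t \<in> ?D" and f2: "integrable pde.M (\<lambda>t. (?n (f t))\<^sup>2)"
  proof -
    have "AE t in pde.M. f t \<in> ?D \<and> (\<exists>s. (\<lambda>n. ?n (s n t - f t)) \<longlonglongrightarrow> 0)"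
      using f unfolding bochner_L2_def strongly_measurable_on_def by (auto elim!: AE_mp)
    then show "AE t in pde.M. f t \<in> ?D" by (rule AE_mp) auto
    show "integrable pde.M (\<lambda>t. (?n (f t))\<^sup>2)" using f by (simp add: bochner_L2_def)
  qed
  have comp: "fst (snd x) \<in> V k" "snd (fst x) \<in> V k" "graph_norm d k (fst (snd x)) \<le> norm x"
    "graph_norm d k (snd (fst x)) \<le> norm x" if "x \<in> graph_space" for x
  proof -
    obtain y where y: "fst y \<in> V (k - 1)" "snd y \<in> V k" "x = graph_embed y"
    proof -
      obtain y where "y \<in> Y" "x = graph_embed y" using \<open>x \<in> graph_space\<close> unfolding graph_space_def by blast
      then show ?thesis using that[of y] by (simp add: Y_iff)
    qed
    show "fst (snd x) \<in> V k" "snd (fst x) \<in> V k"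
      using y d_maps[OF y(1)] by (auto simp: graph_embed_def)
    have x: "(norm x)\<^sup>2 = (norm (fst y))\<^sup>2 + (norm (snd y))\<^sup>2 + ((norm (d (k - 1) (fst y)))\<^sup>2 + (norm (d k (snd y)))\<^sup>2)"
      unfolding y(3) by (cases y) (simp add: graph_embed_def norm_Pair_squared)
    \<comment> \<open>The place where the complex property makes \<open>f t\<close> applicable to
      \<open>d \<omega>\<close> with a bound in the graph norm of \<open>\<omega>\<close>.\<close>
    have dd: "d k (d (k - 1) (fst y)) = 0" using d_d[OF y(1)] by simp
    show "graph_norm d k (fst (snd x)) \<le> norm x"
    proof (rule power2_le_imp_le)
      show "(graph_norm d k (fst (snd x)))\<^sup>2 \<le> (norm x)\<^sup>2"
        unfolding x graph_norm_squared by (simp add: y(3) graph_embed_def dd)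
    qed simp
    show "graph_norm d k (snd (fst x)) \<le> norm x"
    proof (rule power2_le_imp_le)
      show "(graph_norm d k (snd (fst x)))\<^sup>2 \<le> (norm x)\<^sup>2"
        unfolding x graph_norm_squared by (simp add: y(3) graph_embed_def)
    qed simp
  qed
  \<comment> \<open>A representative is chosen at every \<open>t\<close>, with an arbitrary element
    of the graph space on the null set where \<open>f t\<close> is not in the dual.\<close>
  have "\<exists>h\<in>graph_space. f t \<in> ?D \<longrightarrow> (\<forall>x\<in>graph_space. ?F t x = h \<bullet> x)" for t
  proof (cases "f t \<in> ?D")
    case True
    then have lin: "\<And>v w. v \<in> V k \<Longrightarrow> w \<in> V k \<Longrightarrow> f t (v + w) = f t v + f t w"
      "\<And>c v. v \<in> V k \<Longrightarrow> f t (c *\<^sub>R v) = c * f t v"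
      by (auto simp: dual_def)
    obtain h where "h \<in> graph_space" "\<And>x. x \<in> graph_space \<Longrightarrow> ?F t x = h \<bullet> x"
    proof (rule riesz_representation[OF subspace_graph_space closed_graph_space])
      show "?F t (x + y) = ?F t x + ?F t y" if "x \<in> graph_space" "y \<in> graph_space" for x y
        using comp(1,2)[OF that(1)] comp(1,2)[OF that(2)] by (simp add: lin)
      show "?F t (c *\<^sub>R x) = c * ?F t x" if "x \<in> graph_space" for c x
        using comp(1,2)[OF that] by (simp add: lin distrib_left)
      show "\<bar>?F t x\<bar> \<le> (\<bar>?n (f t)\<bar> + \<bar>?n (f t)\<bar>) * norm x" if x: "x \<in> graph_space" for x
      proof -
        have b: "\<bar>f t v\<bar> \<le> \<bar>?n (f t)\<bar> * norm x" if "v \<in> V k" "graph_norm d k v \<le> norm x" for v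
        proof -
          have "\<bar>f t v\<bar> \<le> ?n (f t) * graph_norm d k v" by (rule dual_V_apply_le[OF True that(1)])
          also have "\<dots> \<le> \<bar>?n (f t)\<bar> * norm x"
            using that(2) graph_norm_nonneg by (intro mult_mono) auto
          finally show ?thesis .
        qed
        show ?thesis using b[OF comp(1,3)[OF x]] b[OF comp(2,4)[OF x]] by (simp add: distrib_right)
      qed
    qed blast
    then show ?thesis by blast
  next
    case False
    then show ?thesis using subspace_0[OF subspace_graph_space] by blast
  qed
  then have "\<forall>t. \<exists>h. h \<in> graph_space \<and> (f t \<in> ?D \<longrightarrow> (\<forall>x\<in>graph_space. ?F t x = h \<bullet> x))" by blast
  from choice[OF this] obtain h where h0: "\<forall>t. h t \<in> graph_space \<and> (f t \<in> ?D \<longrightarrow> (\<forall>x\<in>graph_space. ?F t x = h t \<bullet> x))" ..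
  then have h: "h t \<in> graph_space" "f t \<in> ?D \<Longrightarrow> x \<in> graph_space \<Longrightarrow> h t \<bullet> x = ?F t x" for t x
    by auto
  have fm: "(\<lambda>t. f t v) \<in> borel_measurable pde.M" if "v \<in> V k" for v
    by (rule dual_L2_measurable[OF f _ that])
       (auto simp: subspace_scale[OF subspace_V] graph_norm_scaleR graph_norm_nonneg)
  have hm: "(\<lambda>t. h t \<bullet> x) \<in> borel_measurable pde.M" if x: "x \<in> graph_space" for x
  proof (rule borel_measurable_lebesgue_on_AE)
    show "(\<lambda>t. ?F t x) \<in> borel_measurable pde.M" by (intro borel_measurable_add fm comp x)
    show "AE t in pde.M. ?F t x = h t \<bullet> x" using fD by (rule AE_mp) (use h x in auto)
  qed simp
  \<comment> \<open>Testing with \<open>h t\<close> itself: each of the two terms contributes the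
    dual norm of \<open>f t\<close> times \<open>norm (h t)\<close>, and the factor 2 is
    squared.\<close>
  have hb: "(norm (h t))\<^sup>2 \<le> 4 * (?n (f t))\<^sup>2" if t: "f t \<in> ?D" for t
  proof -
    have b: "\<bar>f t v\<bar> \<le> \<bar>?n (f t)\<bar> * norm (h t)" if "v \<in> V k" "graph_norm d k v \<le> norm (h t)" for v
    proof -
      have "\<bar>f t v\<bar> \<le> ?n (f t) * graph_norm d k v" by (rule dual_V_apply_le[OF t that(1)])
      also have "\<dots> \<le> \<bar>?n (f t)\<bar> * norm (h t)"
        using that(2) graph_norm_nonneg by (intro mult_mono) auto
      finally show ?thesis .
    qed
    have "(norm (h t))\<^sup>2 = ?F t (h t)" using h(2)[OF t h(1)] by (simp add: power2_norm_eq_inner)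
    also have "\<dots> \<le> 2 * \<bar>?n (f t)\<bar> * norm (h t)"
      using b[OF comp(1,3)[OF h(1)]] b[OF comp(2,4)[OF h(1)]] by linarith
    finally have "norm (h t) \<le> 2 * \<bar>?n (f t)\<bar>"
      by (cases "h t = 0") (auto simp: power2_eq_square)
    then have "(norm (h t))\<^sup>2 \<le> (2 * \<bar>?n (f t)\<bar>)\<^sup>2" by (rule power_mono) simp
    then show ?thesis by (simp add: power_mult_distrib)
  qed
  have "integrable pde.M (\<lambda>t. (norm (h t))\<^sup>2)"
  proof (rule Bochner_Integration.integrable_bound)
    show "integrable pde.M (\<lambda>t. 4 * (?n (f t))\<^sup>2)" using f2 by simp
    show "(\<lambda>t. (norm (h t))\<^sup>2) \<in> borel_measurable pde.M"
      by (intro borel_measurable_power pde.norm_measurable h(1) hm)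
    show "AE t in pde.M. norm ((norm (h t))\<^sup>2) \<le> norm (4 * (?n (f t))\<^sup>2)"
      using fD by (rule AE_mp) (use hb in auto)
  qed
  then have "h \<in> L2_fun pde.M graph_space" using h(1) hm by (auto simp: L2_fun_def)
  moreover have "AE t in pde.M. represents (f t) (h t)"
    unfolding represents_def using fD
  proof (rule AE_mp, intro AE_I2 impI conjI ballI)
    fix t assume t: "f t \<in> ?D"
    have "\<forall>c. \<forall>v\<in>V k. f t (c *\<^sub>R v) = c * f t v" using t unfolding dual_def by blast
    then show "f t 0 = 0" using subspace_0[OF subspace_V[of k]] by (metis scaleR_zero_left mult_zero_left)
    fix \<omega> \<phi> assume "\<omega> \<in> V (k - 1)" "\<phi> \<in> V k"
    then have "graph_embed (\<omega>, \<phi>) \<in> graph_space" by (intro graph_embed_in) (simp add: Y_iff)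
    from h(2)[OF t this] show "h t \<bullet> graph_embed (\<omega>, \<phi>) = f t (d (k - 1) \<omega>) + f t \<phi>"
      by (simp add: graph_embed_def)
  qed
  ultimately show ?thesis by (rule that)
qed

section \<open>Solutions of the mixed problem\<close>

lemma stiffness_inner:
  assumes "\<omega> \<in> V (k - 1)" "\<phi> \<in> V k"
  shows "stiffness_op x \<bullet> graph_embed (\<omega>, \<phi>)
    = fst (snd x) \<bullet> d (k - 1) \<omega> + fst (snd x) \<bullet> \<phi> + snd (snd x) \<bullet> d k \<phi>"
proof -
  have "graph_embed (\<omega>, \<phi>) \<in> graph_space" by (intro graph_embed_in) (simp add: Y_iff assms)
  then show ?thesis
    by (subst P_inner) (simp_all add: form_op_def graph_embed_def inner_prod_def)
qed

lemma closure_fst_graph_space: "closure (fst ` graph_space) = H_space W k"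
proof -
  have "fst ` graph_space = V (k - 1) \<times> V k"
    by (auto simp: graph_space_def image_image Y_space_def)
  then show ?thesis by (simp add: closure_Times dense_V H_space_def)
qed

text \<open>Eliminates the derivative \<open>U'\<close>, which enters only through the equations.
  What remains relates the continuous representative to the load, so that two solutions for the same
  load can be subtracted.\<close>

lemma solution_integral_identity:
  assumes sol: "solves_mixed_problem W V d k I f g \<sigma> u"
    and h: "h \<in> L2_fun pde.M graph_space"
    and hf: "AE t in pde.M. represents (f t) (h t)"
  obtains x where "x \<in> L2_fun pde.M graph_space" "AE t in pde.M. fst (x t) = (\<sigma> t, u t)"
    "\<And>v t. v \<in> graph_space \<Longrightarrow> t \<in> I \<Longrightarrow>
      (\<sigma> t, u t) \<bullet> fst v - (\<sigma> 0, u 0) \<bullet> fst v = integral {0..t} (\<lambda>s. (h s - stiffness_op (x s)) \<bullet> v)"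
proof -
  define U where "U t = (\<sigma> t, u t)" for t
  have UL: "U \<in> bochner_L2 I Y NY" and UC: "continuous_on I U"
    using sol by (auto simp: solves_mixed_problem_def solution_space_def bounded_continuous_into_def U_def[abs_def])
  obtain U' where U': "U' \<in> bochner_L2 I (dual Y NY) (dual_norm Y NY)"
    "weak_derivative_dual I Y (\<lambda>t. gelfand_embed Y (U t)) U'"
    and eq: "AE t in pde.M.
        (\<forall>\<omega> \<in> V (k - 1).
          U' t (\<omega>, 0) + d (k - 1) (\<sigma> t) \<bullet> d (k - 1) \<omega> = f t (d (k - 1) \<omega>)) \<and>
        (\<forall>\<phi> \<in> V k.
          U' t (0, \<phi>) + d (k - 1) (\<sigma> t) \<bullet> \<phi> + d k (u t) \<bullet> d k \<phi> = f t \<phi>)"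
    using sol unfolding solves_mixed_problem_def U_def by blast
  have U'D: "AE t in pde.M. U' t \<in> dual Y NY"
    using U'(1) unfolding bochner_L2_def strongly_measurable_on_def by (auto elim!: AE_mp)
  define x where "x t = (if U t \<in> Y then graph_embed (U t) else 0)" for t
  have x: "x \<in> L2_fun pde.M graph_space" "AE t in pde.M. fst (x t) = U t"
    using graph_L2_if_Y_L2[OF UL] by (simp_all add: x_def[abs_def])
  have r: "(\<lambda>t. h t - stiffness_op (x t)) \<in> L2_fun pde.M graph_space"
    by (rule pde.diff_in[OF h stiffness_L2[OF x(1)]])
  have id: "U t \<bullet> fst v - U 0 \<bullet> fst v = integral {0..t} (\<lambda>s. (h s - stiffness_op (x s)) \<bullet> v)"
    if v: "v \<in> graph_space" and t: "t \<in> I" for v t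
  proof (rule integral_eq_if_weak_derivative[OF T _ _ _ t])
    obtain \<omega> \<phi> where y: "fst v = (\<omega>, \<phi>)" by (metis surj_pair)
    have yV: "\<omega> \<in> V (k - 1)" "\<phi> \<in> V k" and yY: "(\<omega>, \<phi>) \<in> Y"
      using graph_spaceD(1)[OF v] by (auto simp: y Y_iff)
    have vy: "v = graph_embed (\<omega>, \<phi>)" using graph_spaceD(2)[OF v] y by simp
    show "continuous_on I (\<lambda>t. U t \<bullet> fst v)" by (intro continuous_intros UC)
    show "integrable pde.M (\<lambda>s. (h s - stiffness_op (x s)) \<bullet> v)" by (rule pde.inner_integrable[OF r v])
    have ae: "AE t in pde.M. (h t - stiffness_op (x t)) \<bullet> v = U' t (\<omega>, \<phi>)"
      using hf eq U'D x(2) AE_space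
    proof eventually_elim
      case (elim t)
      note ht = elim(1)[unfolded represents_def] and e = elim(2) and D = elim(3) and xt = elim(4) and tM = elim(5)
      have "x t = graph_embed (U t)"
        using graph_spaceD(2)[OF pde.L2_D(1)[OF x(1) tM]] xt by simp
      then have c: "fst (snd (x t)) = d (k - 1) (\<sigma> t)" "snd (snd (x t)) = d k (u t)"
        by (simp_all add: graph_embed_def U_def)
      \<comment> \<open>The equations prescribe \<open>U' t\<close> only at
        \<open>(\<omega>, 0)\<close> and \<open>(0, \<phi>)\<close>; additivity, valid almost
        everywhere, gives its value at \<open>(\<omega>, \<phi>)\<close>.\<close>
      have parts: "(\<omega>, 0) \<in> Y" "(0, \<phi>) \<in> Y" using yV subspace_0[OF subspace_V] by (simp_all add: Y_iff)
      have "\<forall>v\<in>Y. \<forall>w\<in>Y. U' t (v + w) = U' t v + U' t w" using D unfolding dual_def by blast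
      then have "U' t ((\<omega>, 0) + (0, \<phi>)) = U' t (\<omega>, 0) + U' t (0, \<phi>)" using parts by blast
      then have "U' t (\<omega>, \<phi>) = U' t (\<omega>, 0) + U' t (0, \<phi>)" by simp
      moreover have "h t \<bullet> v = f t (d (k - 1) \<omega>) + f t \<phi>" using ht yV vy by simp
      moreover have "stiffness_op (x t) \<bullet> v
          = d (k - 1) (\<sigma> t) \<bullet> d (k - 1) \<omega> + d (k - 1) (\<sigma> t) \<bullet> \<phi> + d k (u t) \<bullet> d k \<phi>"
        unfolding vy stiffness_inner[OF yV] c ..
      moreover have "U' t (\<omega>, 0) + d (k - 1) (\<sigma> t) \<bullet> d (k - 1) \<omega> = f t (d (k - 1) \<omega>)"
        "U' t (0, \<phi>) + d (k - 1) (\<sigma> t) \<bullet> \<phi> + d k (u t) \<bullet> d k \<phi> = f t \<phi>"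
        using e yV by blast+
      ultimately show ?case
        unfolding inner_diff_left by linarith
    qed
    fix \<psi> assume \<psi>: "test_function I \<psi>"
    have c\<psi>: "continuous_on I \<psi>"
    proof -
      have "((deriv ^^ 0) \<psi>) differentiable_on UNIV" using \<psi> unfolding test_function_def by blast
      then show ?thesis
        using differentiable_imp_continuous_on continuous_on_subset by (metis funpow_0 subset_UNIV)
    qed
    have "(\<integral>t. deriv \<psi> t * gelfand_embed Y (U t) (\<omega>, \<phi>) \<partial>pde.M) = - (\<integral>t. \<psi> t * U' t (\<omega>, \<phi>) \<partial>pde.M)"
      using U'(2) \<psi> yY unfolding weak_derivative_dual_def by blast
    also have "(\<integral>t. \<psi> t * U' t (\<omega>, \<phi>) \<partial>pde.M) = (\<integral>t. \<psi> t * ((h t - stiffness_op (x t)) \<bullet> v) \<partial>pde.M)"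
    proof (rule integral_cong_AE)
      show m: "(\<lambda>t. \<psi> t * ((h t - stiffness_op (x t)) \<bullet> v)) \<in> borel_measurable pde.M"
        by (intro borel_measurable_integrable integrable_continuous_mult c\<psi> pde.inner_integrable[OF r v])
      show ae': "AE t in pde.M. \<psi> t * U' t (\<omega>, \<phi>) = \<psi> t * ((h t - stiffness_op (x t)) \<bullet> v)"
        using ae by (rule AE_mp) auto
      show "(\<lambda>t. \<psi> t * U' t (\<omega>, \<phi>)) \<in> borel_measurable pde.M"
        by (rule borel_measurable_lebesgue_on_AE[OF m]) (use ae in \<open>auto elim: AE_mp\<close>)
    qed
    finally show "(\<integral>t. deriv \<psi> t * (U t \<bullet> fst v) \<partial>pde.M) = - (\<integral>t. \<psi> t * ((h t - stiffness_op (x t)) \<bullet> v) \<partial>pde.M)"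
      using yY by (simp add: gelfand_embed_def y)
  qed
  show ?thesis by (rule that[of x]) (use x id in \<open>simp_all add: U_def\<close>)
qed

text \<open>Both solutions are compared with one common representative \<open>h\<close> of the load,
  which cancels in the difference. Continuity of the representatives makes equality hold at every
  \<open>t\<close>.\<close>

lemma solution_unique:
  assumes s1: "solves_mixed_problem W V d k I f g \<sigma>1 u1" and s2: "solves_mixed_problem W V d k I f g \<sigma>2 u2"
    and f: "f \<in> bochner_L2 I (dual (V k) (graph_norm d k)) (dual_norm (V k) (graph_norm d k))"
    and init: "(\<sigma>1 0, u1 0) = (\<sigma>2 0, u2 0)" and t: "t \<in> I"
  shows "\<sigma>1 t = \<sigma>2 t \<and> u1 t = u2 t"
proof -
  obtain h where h: "h \<in> L2_fun pde.M graph_space"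
    "AE t in pde.M. represents (f t) (h t)"
    by (rule load_exists[OF f])
  obtain x1 where x1: "x1 \<in> L2_fun pde.M graph_space" "AE t in pde.M. fst (x1 t) = (\<sigma>1 t, u1 t)"
    "\<And>v t. v \<in> graph_space \<Longrightarrow> t \<in> I \<Longrightarrow>
      (\<sigma>1 t, u1 t) \<bullet> fst v - (\<sigma>1 0, u1 0) \<bullet> fst v = integral {0..t} (\<lambda>s. (h s - stiffness_op (x1 s)) \<bullet> v)"
    by (rule solution_integral_identity[OF s1 h]) (rule that; assumption)
  obtain x2 where x2: "x2 \<in> L2_fun pde.M graph_space" "AE t in pde.M. fst (x2 t) = (\<sigma>2 t, u2 t)"
    "\<And>v t. v \<in> graph_space \<Longrightarrow> t \<in> I \<Longrightarrow>
      (\<sigma>2 t, u2 t) \<bullet> fst v - (\<sigma>2 0, u2 0) \<bullet> fst v = integral {0..t} (\<lambda>s. (h s - stiffness_op (x2 s)) \<bullet> v)"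
    by (rule solution_integral_identity[OF s2 h]) (rule that; assumption)
  let ?U = "\<lambda>t. (\<sigma>1 t, u1 t) - (\<sigma>2 t, u2 t)"
  have C: "continuous_on I (\<lambda>t. (\<sigma>1 t, u1 t))" "(\<lambda>t. (\<sigma>1 t, u1 t)) ` I \<subseteq> H_space W k"
    "continuous_on I (\<lambda>t. (\<sigma>2 t, u2 t))" "(\<lambda>t. (\<sigma>2 t, u2 t)) ` I \<subseteq> H_space W k"
    using s1 s2 by (auto simp: solves_mixed_problem_def solution_space_def bounded_continuous_into_def)
  have subH: "subspace (H_space W k)" unfolding H_space_def by (intro subspace_Times subspace_W)
  have "?U t = 0"
  proof (rule pde.zero_if_homogeneous[OF _ _ _ _ _ t])
    show "continuous_on I ?U" by (rule continuous_on_diff[OF C(1,3)])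
    show "?U t \<in> closure (fst ` graph_space)" if "t \<in> I" for t
      unfolding closure_fst_graph_space using C(2,4) that by (intro subspace_diff[OF subH]) auto
    show "(\<lambda>t. x1 t - x2 t) \<in> L2_fun pde.M graph_space" by (rule pde.diff_in[OF x1(1) x2(1)])
    show "AE t in pde.M. fst (x1 t - x2 t) = ?U t"
      by (rule AE_mp[OF x1(2)], rule AE_mp[OF x2(2)]) simp
    show "?U t \<bullet> fst v = - integral {0..t} (\<lambda>s. (x1 s - x2 s) \<bullet> stiffness_op_adj v)"
      if v: "v \<in> graph_space" and t: "t \<in> I" for v t
    proof -
      have int: "(\<lambda>s. (h s - stiffness_op (x s)) \<bullet> v) integrable_on {0..t}"
        if "x \<in> L2_fun pde.M graph_space" for x
      proof (rule integrable_subinterval_real[OF integrable_on_if_lebesgue_on])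
        show "integrable pde.M (\<lambda>s. (h s - stiffness_op (x s)) \<bullet> v)"
          by (rule pde.inner_integrable[OF pde.diff_in[OF h(1) stiffness_L2[OF that]] v])
      qed (use t in auto)
      have "?U t \<bullet> fst v = integral {0..t} (\<lambda>s. (h s - stiffness_op (x1 s)) \<bullet> v)
          - integral {0..t} (\<lambda>s. (h s - stiffness_op (x2 s)) \<bullet> v)"
        using x1(3)[OF v t] x2(3)[OF v t] init by (simp only: inner_diff_left)
      also have "\<dots> = integral {0..t} (\<lambda>s. (h s - stiffness_op (x1 s)) \<bullet> v - (h s - stiffness_op (x2 s)) \<bullet> v)"
        by (rule Henstock_Kurzweil_Integration.integral_diff[symmetric, OF int[OF x1(1)] int[OF x2(1)]])
      also have "\<dots> = integral {0..t} (\<lambda>s. - ((x1 s - x2 s) \<bullet> stiffness_op_adj v))"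
      proof (rule integral_cong)
        fix s assume "s \<in> {0..t}"
        then have "x1 s \<in> graph_space" "x2 s \<in> graph_space"
          using t pde.L2_D(1)[OF x1(1)] pde.L2_D(1)[OF x2(1)] by auto
        then show "(h s - stiffness_op (x1 s)) \<bullet> v - (h s - stiffness_op (x2 s)) \<bullet> v
            = - ((x1 s - x2 s) \<bullet> stiffness_op_adj v)"
          using v by (simp add: inner_diff_left pde.A_adjoint)
      qed
      finally show ?thesis by simp
    qed
  qed
  then show ?thesis by (simp add: zero_prod_def)
qed

text \<open>Any pair in H is admissible as initial value, since H is the closure of the product of
  the domains.\<close>

lemma mixed_solution_exists:
  assumes f: "f \<in> bochner_L2 I (dual (V k) (graph_norm d k)) (dual_norm (V k) (graph_norm d k))"
    and g0: "(s, g) \<in> H_space W k"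
  shows "\<exists>\<sigma> u. solves_mixed_problem W V d k I f g \<sigma> u \<and> (\<sigma> 0, u 0) = (s, g)"
proof -
  obtain h where h: "h \<in> L2_fun pde.M graph_space"
    "AE t in pde.M. represents (f t) (h t)"
    by (rule load_exists[OF f])
  obtain U x where UC: "continuous_on I U" and U0: "U 0 = (s, g)"
    and UH: "\<And>t. t \<in> I \<Longrightarrow> U t \<in> closure (fst ` graph_space)"
    and x: "x \<in> L2_fun pde.M graph_space" and ae: "AE t in pde.M. fst (x t) = U t"
    and weak: "\<And>v \<psi> \<psi>'. v \<in> graph_space \<Longrightarrow> (\<And>t. (\<psi> has_real_derivative \<psi>' t) (at t)) \<Longrightarrow>
      continuous_on I \<psi>' \<Longrightarrow> \<psi> 0 = 0 \<Longrightarrow> \<psi> T = 0 \<Longrightarrow>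
      (\<integral>t. \<psi>' t * (U t \<bullet> fst v) \<partial>pde.M) = - (\<integral>t. \<psi> t * ((h t - stiffness_op (x t)) \<bullet> v) \<partial>pde.M)"
    using pde.solution_exists[OF h(1) g0[folded closure_fst_graph_space]] by blast
  \<comment> \<open>The candidate for the derivative is read off from the equation as load minus
    stiffness term, transported to the dual of Y.\<close>
  define U' where "U' t = functional (h t - stiffness_op (x t))" for t
  have U'L: "U' \<in> bochner_L2 I (dual Y NY) (dual_norm Y NY)"
    unfolding U'_def[abs_def]
    by (rule functional_L2[OF pde.diff_in[OF h(1) stiffness_L2[OF x]]])
  have U'w: "weak_derivative_dual I Y (\<lambda>t. gelfand_embed Y (U t)) U'"
    unfolding weak_derivative_dual_def
  proof (intro allI impI ballI)
    fix \<psi> v assume \<psi>: "test_function I \<psi>" and v: "v \<in> Y"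
    have diff: "((deriv ^^ n) \<psi>) differentiable_on UNIV" for n
      using \<psi> unfolding test_function_def by blast
    obtain K where K: "K \<subseteq> interior I" "\<And>t. t \<notin> K \<Longrightarrow> \<psi> t = 0"
      using \<psi> unfolding test_function_def by blast
    have "(\<integral>t. deriv \<psi> t * (U t \<bullet> fst (graph_embed v)) \<partial>pde.M)
        = - (\<integral>t. \<psi> t * ((h t - stiffness_op (x t)) \<bullet> graph_embed v) \<partial>pde.M)"
    proof (rule weak[OF graph_embed_in[OF v]])
      show "(\<psi> has_real_derivative deriv \<psi> t) (at t)" for t
        using diff[of 0] by (auto simp: differentiable_on_def DERIV_deriv_iff_real_differentiable)
      show "continuous_on I (deriv \<psi>)"
        using differentiable_imp_continuous_on[OF diff[of 1]] by (auto intro: continuous_on_subset)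
      have "0 \<notin> K" "T \<notin> K" using K(1) by auto
      then show "\<psi> 0 = 0" "\<psi> T = 0" using K(2) by blast+
    qed
    then show "(\<integral>t. deriv \<psi> t * gelfand_embed Y (U t) v \<partial>pde.M) = - (\<integral>t. \<psi> t * U' t v \<partial>pde.M)"
      using v by (simp add: gelfand_embed_def U'_def functional_apply)
  qed
  have UgL: "(\<lambda>t. gelfand_embed Y (U t)) \<in> bochner_L2 I (dual Y NY) (dual_norm Y NY)"
    unfolding gelfand_embed_eq
  proof (intro functional_L2 pde.continuous_L2 P_in)
    show "continuous_on I (\<lambda>t. P (U t, 0))"
      by (intro bounded_linear.continuous_on[OF P_linear] continuous_intros UC)
  qed
  have UH1: "(\<lambda>t. gelfand_embed Y (U t)) \<in> bochner_H1_dual I Y NY"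
    unfolding bochner_H1_dual_def using UgL U'L U'w by blast
  have UCH: "U \<in> bounded_continuous_into I (H_space W k)"
    unfolding bounded_continuous_into_def
    using UC UH closure_fst_graph_space compact_imp_bounded[OF compact_continuous_image[OF UC compact_Icc]]
    by auto
  have space: "U \<in> solution_space W V d k I"
    unfolding solution_space_def using Y_L2_if_graph_L2[OF x ae] UH1 UCH by blast
  have eq: "AE t in pde.M.
      (\<forall>\<omega> \<in> V (k - 1).
        U' t (\<omega>, 0) + d (k - 1) (fst (U t)) \<bullet> d (k - 1) \<omega> = f t (d (k - 1) \<omega>)) \<and>
      (\<forall>\<phi> \<in> V k.
        U' t (0, \<phi>) + d (k - 1) (fst (U t)) \<bullet> \<phi> + d k (snd (U t)) \<bullet> d k \<phi> = f t \<phi>)"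
    using h(2) ae AE_space
  proof eventually_elim
    case (elim t)
    note ht = elim(1)[unfolded represents_def] and xt = elim(2) and tM = elim(3)
    have "x t = graph_embed (U t)"
      using graph_spaceD(2)[OF pde.L2_D(1)[OF x tM]] xt by simp
    then have c: "fst (snd (x t)) = d (k - 1) (fst (U t))" "snd (snd (x t)) = d k (snd (U t))"
      by (simp_all add: graph_embed_def)
    have zero: "0 \<in> V j" for j by (rule subspace_0[OF subspace_V])
    have val: "U' t (\<omega>, \<phi>) = f t (d (k - 1) \<omega>) + f t \<phi>
        - (d (k - 1) (fst (U t)) \<bullet> d (k - 1) \<omega> + d (k - 1) (fst (U t)) \<bullet> \<phi> + d k (snd (U t)) \<bullet> d k \<phi>)"
      if "\<omega> \<in> V (k - 1)" "\<phi> \<in> V k" for \<omega> \<phi>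
    proof -
      have "(\<omega>, \<phi>) \<in> Y" using that by (simp add: Y_iff)
      then have "U' t (\<omega>, \<phi>) = (h t - stiffness_op (x t)) \<bullet> graph_embed (\<omega>, \<phi>)"
        by (simp only: U'_def functional_apply)
      then show ?thesis
        unfolding inner_diff_left stiffness_inner[OF that] c using ht that by simp
    qed
    \<comment> \<open>The two equations are the joint one with \<open>\<phi> = 0\<close> and with
      \<open>\<omega> = 0\<close>; \<open>f t 0 = 0\<close> removes the other load term.\<close>
    show ?case
      using ht by (auto simp: val zero d_zero)
  qed
  have "solves_mixed_problem W V d k I f g (\<lambda>t. fst (U t)) (\<lambda>t. snd (U t))"
    unfolding solves_mixed_problem_def using space U'L U'w eq U0 by auto
  then show ?thesis using U0 by (intro exI[of _ "\<lambda>t. fst (U t)"] exI[of _ "\<lambda>t. snd (U t)"]) simp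
qed

text \<open>The description in \<open>adj\<close> is meaningful because two candidates differ by an
  element of \<open>W (k - 1)\<close> orthogonal to the dense subspace
  \<open>V (k - 1)\<close>.\<close>

lemma adj_in_W:
  assumes g: "g \<in> adj_dom W V d k"
  shows "adj W V d k g \<in> W (k - 1)"
proof -
  obtain z where z: "z \<in> W (k - 1)" "\<forall>v\<in>V (k - 1). d (k - 1) v \<bullet> g = v \<bullet> z"
    using g unfolding adj_dom_def by blast
  have "adj W V d k g \<in> W (k - 1) \<and> (\<forall>v\<in>V (k - 1). d (k - 1) v \<bullet> g = v \<bullet> adj W V d k g)"
    unfolding adj_def
  proof (rule theI)
    show "z \<in> W (k - 1) \<and> (\<forall>v\<in>V (k - 1). d (k - 1) v \<bullet> g = v \<bullet> z)" using z by blast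
    fix z' assume z': "z' \<in> W (k - 1) \<and> (\<forall>v\<in>V (k - 1). d (k - 1) v \<bullet> g = v \<bullet> z')"
    have "V (k - 1) \<subseteq> {v. (z' - z) \<bullet> v = 0}"
    proof
      fix v assume "v \<in> V (k - 1)"
      then have "v \<bullet> z' = v \<bullet> z" using z z' by metis
      then show "v \<in> {v. (z' - z) \<bullet> v = 0}" by (simp add: inner_diff_left inner_commute[of _ v])
    qed
    then have "closure (V (k - 1)) \<subseteq> {v. (z' - z) \<bullet> v = 0}"
      by (rule closure_minimal) (rule closed_hyperplane)
    moreover have "z' - z \<in> W (k - 1)" using z z' subspace_diff[OF subspace_W] by blast
    ultimately have "(z' - z) \<bullet> (z' - z) = 0" using dense_V by blast
    then show "z' = z" by simp
  qed
  then show ?thesis by blast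
qed

end

text \<open>Membership of \<open>g\<close> in the domain of the adjoint places
  \<open>adj W V d k g\<close> in \<open>W (k - 1)\<close>, so the prescribed initial pair belongs
  to H.\<close>

theorem theorem3p2:
  fixes W V :: "int \<Rightarrow> 'a::{real_inner, complete_space} set"
    and d :: "int \<Rightarrow> 'a \<Rightarrow> 'a"
    and k :: int
    and T :: real
    and f :: "real \<Rightarrow> 'a \<Rightarrow> real"
    and g :: 'a
  assumes "closed_hilbert_complex W V d"
    and "T > 0"
    and "g \<in> adj_dom W V d k"
    and "f \<in> bochner_L2 {0..T} (dual (V k) (graph_norm d k)) (dual_norm (V k) (graph_norm d k))"
  shows "\<exists>\<sigma> u.
    (solves_mixed_problem W V d k {0..T} f g \<sigma> u \<and> (\<sigma> 0, u 0) = (adj W V d k g, g)) \<and>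
    (\<forall>\<sigma>' u'.
      solves_mixed_problem W V d k {0..T} f g \<sigma>' u' \<and> (\<sigma>' 0, u' 0) = (adj W V d k g, g) \<longrightarrow>
      (\<forall>t \<in> {0..T}. \<sigma>' t = \<sigma> t \<and> u' t = u t))"
proof -
  interpret closed_hilbert_complex W V d by (rule assms(1))
  interpret mixed_problem W V d k T by unfold_locales (rule assms(2))
  have "(adj W V d k g, g) \<in> H_space W k"
    using adj_in_W[OF assms(3)] assms(3) by (simp add: H_space_def adj_dom_def)
  from mixed_solution_exists[OF assms(4) this] obtain \<sigma> u
    where sol: "solves_mixed_problem W V d k {0..T} f g \<sigma> u" "(\<sigma> 0, u 0) = (adj W V d k g, g)"
    by blast
  show ?thesis
  proof (rule exI[of _ \<sigma>], rule exI[of _ u], intro conjI sol allI impI ballI)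
    fix \<sigma>' u' t
    assume "solves_mixed_problem W V d k {0..T} f g \<sigma>' u' \<and> (\<sigma>' 0, u' 0) = (adj W V d k g, g)"
      and t: "t \<in> {0..T}"
    then show "\<sigma>' t = \<sigma> t" "u' t = u t"
      using solution_unique[of f g \<sigma>' u' \<sigma> u t] sol assms(4) by auto
  qed
qed

end
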